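(* Let $(E,d,\mu)$ be a locally compact separable metric measure space with $\mu$ a Radon measure of full support, $V(x,r)=\mu(B(x,r))$, and suppose there are constants $a_1,a_2>0$ and $d_2\ge d_1>0$ with $$a_1\left(\frac Rr\right)^{d_1}\le\frac{V(x,R)}{V(x,r)}\le a_2\left(\frac Rr\right)^{d_2}\quad\text{for all }x\in E,\ 0<r\le R.$$ Let $S$ be a driftless subordinator satisfying the scaling and monotonicity assumptions stated in the context, with Laplace exponent $\phi$ and densities $\bar p(r,\cdot)$ of $S_r$. Let $\Phi:[0,\infty)\to[0,\infty)$ be strictly increasing with $\Phi(0)=0$ and suppose there are constants $a_3,a_4>0$ and $1<\alpha_1\le\alpha_2<\infty$ with $a_3(R/r)^{\alpha_1}\le\Phi(R)/\Phi(r)\le a_4(R/r)^{\alpha_2}$ for all $0<r\le R$. Let $m(t,r)$ be strictly positive for all $t,r>0$, non-increasing in $t\in(0,\infty)$ for fixed $r>0$, and determined by $$\frac t{m(t,r)}\simeq\Phi\left(\frac r{m(t,r)}\right),\qquad t,r>0.$$ Let $\{P^0_t;t\ge0\}$ be a uniformly bounded and strongly continuous semigroup on $L^p(E;\mu)$, $p\ge1$, or on $C_\infty(E)$, corresponding to a conservative diffusion $X$, whose heat kernel $p^0(t,x,y)$ with respect to $\mu$ satisfies, for some positive constants $C_1,C_2,C_3,C_4$, $$\frac{C_1}{V(x,\Phi^{-1}(t))}\exp\left(-C_2m(t,d(x,y))\right)\le p^0(t,x,y)\le\frac{C_3}{V(x,\Phi^{-1}(t))}\exp\left(-C_4m(t,d(x,y))\right),\quad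 t>0,\ x,y\in E.$$ Let $q(t,x,y)=\int_0^\infty p^0(r,x,y)\,\bar p(r,t)\,dr$. Then: (i) If $\Phi(d(x,y))\phi(t^{-1})\le1$, then $$q(t,x,y)\simeq\frac{\phi(t^{-1})}t\int_{\Phi(d(x,y))}^{2/\phi(t^{-1})}\frac r{V(x,\Phi^{-1}(r))}\,dr.$$ (ii) There exist constants $c_i>0$ $(i=1,\dots,4)$ such that if $\Phi(d(x,y))\phi(t^{-1})\ge1$, then $$\frac{c_1}{t\,V(x,\Phi^{-1}(1/\phi(t^{-1})))}\,\frac{n(t,d(x,y))}{\phi(n(t,d(x,y))/t)}\,e^{-c_2n(t,d(x,y))}\le q(t,x,y)\le\frac{c_3}{t\,V(x,\Phi^{-1}(1/\phi(t^{-1})))}\,\frac{n(t,d(x,y))}{\phi(n(t,d(x,y))/t)}\,e^{-c_4n(t,d(x,y))},$$ where $n(\cdot,r)$ is a (positive) non-increasing function on $(0,\infty)$ determined by $$\frac1{\phi(n(t,r)/t)}\simeq\Phi\left(\frac r{n(t,r)}\right),\qquad t,r>0.$$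
   Context: Assumptions on the driftless subordinator $S$ ($\mathbb E[e^{-\lambda S_t}]=e^{-t\phi(\lambda)}$, $\phi(\lambda)=\int_0^\infty(1-e^{-\lambda x})\,\nu(dx)$): (a) there are $0<\beta_1<\beta_2<1$ and constants $k_1,k_2>0$ with $k_1\kappa^{\beta_1}\le\phi(\kappa\lambda)/\phi(\lambda)\le k_2\kappa^{\beta_2}$ for all $\lambda>0$, $\kappa\ge1$, with the normalization $\phi(1)=1$; (b) the Lévy measure has a density $\nu(z)$ with respect to Lebesgue measure such that $t\mapsto t\nu(t)$ is non-increasing on $(0,\infty)$. Under these assumptions $S_r$ has a bounded density $\bar p(r,t)$, smooth in $t$, for each $r>0$. A conservative diffusion is a strong Markov process with continuous sample paths and infinite lifetime. $h\simeq k$ means $c'k\le h\le c''k$ for constants $c',c''>0$ independent of the arguments in the specified range. $\Phi^{-1}$ is the (right-continuous generalized) inverse of $\Phi$. When $d(x,y)=0$, $m(t,0)$ is read as $0$. $B(x,r)$ is the open ball; $C_\infty(E)$ is the space of continuous functions vanishing at infinity. *)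

theory Defs
  imports "HOL-Probability.Probability"
begin

text \<open>Two-sided estimates up to positive constants, uniform over the range \<open>A\<close>. The second version
  is for quantities that may be infinite.\<close>

definition comparable_on :: "'z set \<Rightarrow> ('z \<Rightarrow> real) \<Rightarrow> ('z \<Rightarrow> real) \<Rightarrow> bool" where
  "comparable_on A h k \<longleftrightarrow>
     (\<exists>c' c''. 0 < c' \<and> 0 < c'' \<and> (\<forall>z\<in>A. c' * k z \<le> h z \<and> h z \<le> c'' * k z))"

definition ecomparable_on :: "'z set \<Rightarrow> ('z \<Rightarrow> ennreal) \<Rightarrow> ('z \<Rightarrow> ennreal) \<Rightarrow> bool" where
  "ecomparable_on A h k \<longleftrightarrow>
     (\<exists>c' c''. 0 < c' \<and> 0 < c'' \<and> (\<forall>z\<in>A. ennreal c' * k z \<le> h z \<and> h z \<le> ennreal c'' * k z))"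

definition radon_measure :: "'a::topological_space measure \<Rightarrow> bool" where
  "radon_measure \<mu> \<longleftrightarrow> sets \<mu> = sets borel \<and>
     (\<forall>K. compact K \<longrightarrow> emeasure \<mu> K < \<infinity>) \<and>
     (\<forall>B\<in>sets borel. emeasure \<mu> B = (SUP K\<in>{K. compact K \<and> K \<subseteq> B}. emeasure \<mu> K))"

definition full_support :: "'a::topological_space measure \<Rightarrow> bool" where
  "full_support \<mu> \<longleftrightarrow> (\<forall>U. open U \<and> U \<noteq> {} \<longrightarrow> 0 < emeasure \<mu> U)"

definition vol :: "'a::metric_space measure \<Rightarrow> 'a \<Rightarrow> real \<Rightarrow> real" where
  "vol \<mu> x r = measure \<mu> (ball x r)"

definition subordinator :: "'w measure \<Rightarrow> (real \<Rightarrow> 'w \<Rightarrow> real) \<Rightarrow> bool" where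
  "subordinator M S \<longleftrightarrow> prob_space M \<and>
     (\<forall>t\<ge>0. S t \<in> borel_measurable M) \<and>
     (AE \<omega> in M. S 0 \<omega> = 0 \<and> mono_on {0..} (\<lambda>t. S t \<omega>) \<and>
        (\<forall>t\<ge>0. continuous (at_right t) (\<lambda>s. S s \<omega>))) \<and>
     (\<forall>(n::nat) (t::nat \<Rightarrow> real). 0 \<le> t 0 \<and> mono t \<longrightarrow>
        prob_space.indep_vars M (\<lambda>_. borel) (\<lambda>i \<omega>. S (t (Suc i)) \<omega> - S (t i) \<omega>) {..<n}) \<and>
     (\<forall>s\<ge>0. \<forall>t\<ge>0. distr M borel (\<lambda>\<omega>. S (s + t) \<omega> - S s \<omega>) = distr M borel (S t))"

definition subordinator_levy_measure :: "real measure \<Rightarrow> bool" where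
  "subordinator_levy_measure N \<longleftrightarrow> sets N = sets borel \<and> emeasure N {..0} = 0 \<and>
     (\<integral>\<^sup>+x. ennreal (min 1 x) \<partial>N) < \<infinity>"

text \<open>Absence of a drift means that \<open>\<phi>\<close> has no linear term.\<close>

definition driftless_subordinator ::
  "'w measure \<Rightarrow> (real \<Rightarrow> 'w \<Rightarrow> real) \<Rightarrow> real measure \<Rightarrow> (real \<Rightarrow> real) \<Rightarrow> bool" where
  "driftless_subordinator M S N \<phi> \<longleftrightarrow> subordinator M S \<and> subordinator_levy_measure N \<and>
     (\<forall>l\<ge>0. \<phi> l = (\<integral>x. 1 - exp (- (l * x)) \<partial>N)) \<and>
     (\<forall>l\<ge>0. \<forall>t\<ge>0. prob_space.expectation M (\<lambda>\<omega>. exp (- (l * S t \<omega>))) = exp (- (t * \<phi> l)))"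

definition smooth_on_pos :: "(real \<Rightarrow> real) \<Rightarrow> bool" where
  "smooth_on_pos f \<longleftrightarrow> (\<forall>k. ((deriv ^^ k) f) differentiable_on {0<..})"

text \<open>A density is only determined almost everywhere; smoothness on the half-line fixes the version
  pointwise, and the values at nonpositive arguments play no role.\<close>

definition subordinator_densities ::
  "'w measure \<Rightarrow> (real \<Rightarrow> 'w \<Rightarrow> real) \<Rightarrow> (real \<Rightarrow> real \<Rightarrow> real) \<Rightarrow> bool" where
  "subordinator_densities M S pbar \<longleftrightarrow> (\<forall>r>0.
     (\<forall>t>0. 0 \<le> pbar r t) \<and>
     distributed M lborel (S r) (\<lambda>t. ennreal (pbar r t) * indicator {0<..} t) \<and>
     (\<exists>C. \<forall>t>0. pbar r t \<le> C) \<and>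
     smooth_on_pos (pbar r))"

text \<open>A process on \<open>W\<close> with laws \<open>P x\<close> (start in \<open>x\<close>), filtration \<open>F\<close> and times in \<open>[0,\<infinity>)\<close>. The
  filtration and the stopping times use the time set \<open>[0,\<infinity>]\<close>, so that a stopping time may be infinite
  and a member of its \<open>\<sigma>\<close>-algebra is in particular in \<open>F \<infinity>\<close>. All \<open>X t\<close> are \<open>'a\<close>-valued for every
  \<open>t \<ge> 0\<close>, without a cemetery point: the lifetime is infinite.\<close>

definition strong_markov_process ::
  "'w measure \<Rightarrow> (ennreal \<Rightarrow> 'w measure) \<Rightarrow> (real \<Rightarrow> 'w \<Rightarrow> 'a::metric_space) \<Rightarrow> ('a \<Rightarrow> 'w measure) \<Rightarrow> bool"
where
  "strong_markov_process W F X P \<longleftrightarrow>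
     filtration (space W) F \<and> (\<forall>t. sets (F t) \<subseteq> sets W) \<and>
     (\<forall>t\<ge>0. X t \<in> measurable (F (ennreal t)) borel) \<and>
     (\<forall>x. prob_space (P x) \<and> sets (P x) = sets W \<and> (AE \<omega> in P x. X 0 \<omega> = x)) \<and>
     (\<forall>t\<ge>0. \<forall>B\<in>sets borel.
        (\<lambda>x. measure (P x) {\<omega>\<in>space W. X t \<omega> \<in> B}) \<in> borel_measurable borel) \<and>
     (\<forall>T x s B. stopping_time F T \<and> 0 \<le> s \<and> B \<in> sets borel \<longrightarrow>
        (AE \<omega> in P x. T \<omega> < \<infinity> \<longrightarrow>
           real_cond_exp (P x) (filtration.pre_sigma (space W) F T)
             (indicator {\<omega>'\<in>space W. T \<omega>' < \<infinity> \<and> X (enn2real (T \<omega>') + s) \<omega>' \<in> B}) \<omega> =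
           measure (P (X (enn2real (T \<omega>)) \<omega>)) {\<omega>'\<in>space W. X s \<omega>' \<in> B}))"

definition conservative_diffusion ::
  "'w measure \<Rightarrow> (ennreal \<Rightarrow> 'w measure) \<Rightarrow> (real \<Rightarrow> 'w \<Rightarrow> 'a::metric_space) \<Rightarrow> ('a \<Rightarrow> 'w measure) \<Rightarrow> bool"
where
  "conservative_diffusion W F X P \<longleftrightarrow> strong_markov_process W F X P \<and>
     (\<forall>\<omega>\<in>space W. continuous_on {0..} (\<lambda>t. X t \<omega>))"

text \<open>The spaces \<open>L\<^sup>p\<close> and \<open>C\<^sub>\<infinity>\<close> are described by a set \<open>FS\<close> of functions with a (semi)norm \<open>N\<close>;
  elements at \<open>N\<close>-distance zero are identified, whence the shape of the semigroup laws below.\<close>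

definition Lp_space :: "real \<Rightarrow> 'a measure \<Rightarrow> ('a \<Rightarrow> real) set" where
  "Lp_space p \<mu> = {f \<in> borel_measurable \<mu>. integrable \<mu> (\<lambda>x. \<bar>f x\<bar> powr p)}"

definition Lp_norm :: "real \<Rightarrow> 'a measure \<Rightarrow> ('a \<Rightarrow> real) \<Rightarrow> real" where
  "Lp_norm p \<mu> f = (\<integral>x. \<bar>f x\<bar> powr p \<partial>\<mu>) powr (1 / p)"

definition C_infty :: "('a::topological_space \<Rightarrow> real) set" where
  "C_infty = {f. continuous_on UNIV f \<and> (\<forall>\<epsilon>>0. \<exists>K. compact K \<and> (\<forall>x. x \<notin> K \<longrightarrow> \<bar>f x\<bar> < \<epsilon>))}"

definition sup_norm :: "('a \<Rightarrow> real) \<Rightarrow> real" where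
  "sup_norm f = (SUP x. \<bar>f x\<bar>)"

definition bounded_C0_semigroup ::
  "('a \<Rightarrow> real) set \<Rightarrow> (('a \<Rightarrow> real) \<Rightarrow> real) \<Rightarrow> (real \<Rightarrow> ('a \<Rightarrow> real) \<Rightarrow> 'a \<Rightarrow> real) \<Rightarrow> bool" where
  "bounded_C0_semigroup FS N T \<longleftrightarrow>
     (\<forall>t\<ge>0. \<forall>f\<in>FS. T t f \<in> FS) \<and>
     (\<forall>t\<ge>0. \<forall>f\<in>FS. \<forall>g\<in>FS. \<forall>a b.
        N (\<lambda>x. T t (\<lambda>y. a * f y + b * g y) x - (a * T t f x + b * T t g x)) = 0) \<and>
     (\<forall>f\<in>FS. N (\<lambda>x. T 0 f x - f x) = 0) \<and>
     (\<forall>s\<ge>0. \<forall>t\<ge>0. \<forall>f\<in>FS. N (\<lambda>x. T (s + t) f x - T s (T t f) x) = 0) \<and>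
     (\<exists>C. \<forall>t\<ge>0. \<forall>f\<in>FS. N (T t f) \<le> C * N f) \<and>
     (\<forall>f\<in>FS. ((\<lambda>t. N (\<lambda>x. T t f x - f x)) \<longlongrightarrow> 0) (at_right 0))"

definition diffusion_semigroup ::
  "'a::metric_space measure \<Rightarrow> (real \<Rightarrow> 'w \<Rightarrow> 'a) \<Rightarrow> ('a \<Rightarrow> 'w measure) \<Rightarrow>
     (real \<Rightarrow> ('a \<Rightarrow> real) \<Rightarrow> 'a \<Rightarrow> real) \<Rightarrow> bool" where
  "diffusion_semigroup \<mu> X P T \<longleftrightarrow>
     (\<exists>p\<ge>1. bounded_C0_semigroup (Lp_space p \<mu>) (Lp_norm p \<mu>) T \<and>
        (\<forall>t\<ge>0. \<forall>f\<in>Lp_space p \<mu>.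
           AE x in \<mu>. has_bochner_integral (P x) (\<lambda>\<omega>. f (X t \<omega>)) (T t f x))) \<or>
     (bounded_C0_semigroup C_infty sup_norm T \<and>
        (\<forall>t\<ge>0. \<forall>f\<in>C_infty. \<forall>x. has_bochner_integral (P x) (\<lambda>\<omega>. f (X t \<omega>)) (T t f x)))"

definition heat_kernel ::
  "'a::metric_space measure \<Rightarrow> (real \<Rightarrow> 'w \<Rightarrow> 'a) \<Rightarrow> ('a \<Rightarrow> 'w measure) \<Rightarrow>
     (real \<Rightarrow> 'a \<Rightarrow> 'a \<Rightarrow> real) \<Rightarrow> bool" where
  "heat_kernel \<mu> X P p0 \<longleftrightarrow>
     (\<forall>t>0. \<forall>x. (\<forall>y. 0 \<le> p0 t x y) \<and> distributed (P x) \<mu> (X t) (\<lambda>y. ennreal (p0 t x y))) \<and>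
     (\<forall>x y. set_borel_measurable borel {0<..} (\<lambda>t. p0 t x y))"

definition right_inv :: "(real \<Rightarrow> real) \<Rightarrow> real \<Rightarrow> real" where
  "right_inv \<Phi> t = Inf {s. 0 \<le> s \<and> t < \<Phi> s}"

definition m_function :: "(real \<Rightarrow> real) \<Rightarrow> (real \<Rightarrow> real \<Rightarrow> real) \<Rightarrow> bool" where
  "m_function \<Phi> m \<longleftrightarrow>
     (\<forall>t>0. \<forall>r>0. 0 < m t r) \<and>
     (\<forall>r>0. antimono_on {0<..} (\<lambda>t. m t r)) \<and>
     (\<forall>t>0. m t 0 = 0) \<and>
     comparable_on ({0<..} \<times> {0<..}) (\<lambda>(t, r). t / m t r) (\<lambda>(t, r). \<Phi> (r / m t r))"

definition n_function :: "(real \<Rightarrow> real) \<Rightarrow> (real \<Rightarrow> real) \<Rightarrow> (real \<Rightarrow> real \<Rightarrow> real) \<Rightarrow> bool" where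
  "n_function \<phi> \<Phi> n \<longleftrightarrow>
     (\<forall>t>0. \<forall>r>0. 0 < n t r) \<and>
     (\<forall>r>0. antimono_on {0<..} (\<lambda>t. n t r)) \<and>
     comparable_on ({0<..} \<times> {0<..}) (\<lambda>(t, r). 1 / \<phi> (n t r / t)) (\<lambda>(t, r). \<Phi> (r / n t r))"

text \<open>The value may be \<open>\<infinity>\<close> on the diagonal.\<close>

definition subordinate_kernel ::
  "(real \<Rightarrow> 'a \<Rightarrow> 'a \<Rightarrow> real) \<Rightarrow> (real \<Rightarrow> real \<Rightarrow> real) \<Rightarrow> real \<Rightarrow> 'a \<Rightarrow> 'a \<Rightarrow> ennreal" where
  "subordinate_kernel p0 pbar t x y = (\<integral>\<^sup>+r\<in>{0<..}. ennreal (p0 r x y * pbar r t) \<partial>lborel)"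

end

theory Submission
  imports Defs
begin

text \<open>Write \<open>p(r, t)\<close> for the density of \<open>S\<^sub>r\<close>. Since \<open>z \<nu>(z)\<close> is non-increasing, \<open>S\<^sub>r\<close> is
  self-decomposable, and comparing Laplace transforms gives
  \<open>t p(r, t) = r \<integral>\<^sub>0\<^sup>t z \<nu>(z) p(r, t - z) dz\<close>. Bounding \<open>z \<nu>(z)\<close> from below by its value at \<open>t\<close> yields
  \<open>p(r, t) \<ge> c (r \<phi>(1/t) / t) P(S\<^sub>r \<le> t)\<close>; splitting off the small \<open>z\<close> and absorbing them into a supremum
  of \<open>\<tau>\<^sup>2 p(r, \<tau>)\<close> over \<open>\<tau> \<le> t\<close> yields the same bound from above with the square root of \<open>P(S\<^sub>r \<le> t)\<close>.
  This probability is at most \<open>e\<^sup>-\<^sup>c\<^sup>n\<close> for \<open>r \<ge> n / \<phi>(n/t)\<close> by Chernoff's bound, and at least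
  \<open>e\<^sup>-\<^sup>L\<^sup>n\<close> up to a constant for \<open>r \<le> 2 n / \<phi>(n/t)\<close>, by cutting \<open>S\<^sub>r\<close> into about \<open>n\<close> independent increments.
  At time \<open>r = n / \<phi>(n/t)\<close> the exponent \<open>m(r, d)\<close> of the heat kernel is comparable with \<open>n = n(t, d)\<close> as
  well, so both exponentials in the integral for \<open>q\<close> balance there.\<close>

section \<open>Laplace transforms\<close>

text \<open>Neither \<open>\<Phi>\<close> nor its inverse need be continuous, so equations such as
  the one defining \<open>n\<close> are only solved up to constants; the gap \<beta>2 < 1 <
  \<alpha>1 between the scaling exponents makes approximate solutions comparable. The density is
  bounded for each r, but not uniformly in r. This boundedness serves only to make the supremum of
  \<tau>^2 p(r, \<tau>) finite, so that half of it can be absorbed. Cutting off the small jumps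
  costs a power of 1 + r \<phi>(1/\<tau>); Chernoff's bound pays for it with one of the two square
  roots of the distribution function, which is why only the other root survives. A factor exp(-r
  \<phi>(1/t) / 4) is kept throughout, since the mixture runs over all r. In the off-diagonal upper
  bound only half of the heat kernel exponent takes part in the balance: the other half is spent on
  replacing the volume at time r by the volume at time 1 / \<phi>(1/t). The lower bound needs a
  single window [R, 2R] with R = n / \<phi>(n/t).\<close>

lemma abs_exp_minus_diff_le:
  fixes a b :: real
  shows "\<bar>exp (- a) - exp (- b)\<bar> \<le> \<bar>a - b\<bar> * exp (- min a b)"
proof -
  have *: "\<bar>exp (- a) - exp (- b)\<bar> \<le> \<bar>a - b\<bar> * exp (- min a b)" if "a \<le> b" for a b :: real
  proof -
    have "exp (- a) - exp (- b) = exp (- a) * (1 - exp (- (b - a)))"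
      by (simp add: algebra_simps flip: exp_add)
    also have "\<dots> \<le> exp (- a) * (b - a)"
    proof (intro mult_left_mono)
      show "1 - exp (- (b - a)) \<le> b - a"
        using exp_ge_add_one_self[of "- (b - a)"] by linarith
    qed simp
    finally show ?thesis
      using that by (simp add: mult.commute)
  qed
  show ?thesis
    using *[of a b] *[of b a] by (cases "a \<le> b") (auto simp: abs_minus_commute min.commute)
qed

text \<open>The majorant is \<open>min 1 x\<close> because that is the function a Levy measure of a
  subordinator integrates.\<close>

lemma mult_exp_minus_le:
  fixes c x :: real
  assumes "0 < c" "0 \<le> x"
  shows "x * exp (- (c * x)) \<le> max 1 (1 / c) * min 1 x"
proof -
  have "c * x \<le> exp (c * x)"
    using exp_ge_add_one_self[of "c * x"] by linarith
  then have "x * exp (- (c * x)) \<le> 1 / c"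
    using assms by (simp add: exp_minus field_simps)
  moreover have "x * exp (- (c * x)) \<le> x"
    using assms by (simp add: mult_left_le)
  moreover have "1 * x \<le> max 1 (1 / c) * x"
    using assms by (intro mult_right_mono) auto
  moreover have "1 / c \<le> max 1 (1 / c)"
    by simp
  ultimately show ?thesis
    by (cases "x \<le> 1") (use assms in \<open>simp_all add: min_def\<close>)
qed

lemma one_minus_exp_le:
  fixes l x :: real
  assumes "0 \<le> l" "0 \<le> x"
  shows "0 \<le> 1 - exp (- (l * x))" "1 - exp (- (l * x)) \<le> max 1 l * min 1 x"
proof -
  show "0 \<le> 1 - exp (- (l * x))"
    using assms by simp
  have "1 - exp (- (l * x)) \<le> l * x"
    using exp_ge_add_one_self[of "- (l * x)"] by simp
  moreover have "1 - exp (- (l * x)) \<le> 1"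
    by simp
  moreover have "l * x \<le> max 1 l * x"
    using assms by (intro mult_right_mono) auto
  ultimately show "1 - exp (- (l * x)) \<le> max 1 l * min 1 x"
  proof (cases "x \<le> 1")
    case False
    have "1 - exp (- (l * x)) \<le> 1 * 1"
      by simp
    also have "\<dots> \<le> max 1 l * min 1 x"
      using False by (intro mult_mono) auto
    finally show ?thesis .
  qed (simp add: min_def)
qed

text \<open>Only integrability of \<open>min 1 x\<close> enters, so the same differentiation applies
  to the Levy measure and to the law of \<open>S r\<close>.\<close>

lemma
  fixes N :: "real measure"
  assumes N: "sets N = sets borel" "AE x in N. 0 < x" "integrable N (\<lambda>x. min 1 x)"
  shows integrable_one_minus_exp: "0 \<le> l \<Longrightarrow> integrable N (\<lambda>x. 1 - exp (- (l * x)))"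
    and integrable_mult_exp: "0 < l \<Longrightarrow> integrable N (\<lambda>x. x * exp (- (l * x)))"
    and DERIV_laplace_exponent: "0 < l \<Longrightarrow>
      ((\<lambda>l. \<integral>x. 1 - exp (- (l * x)) \<partial>N) has_real_derivative (\<integral>x. x * exp (- (l * x)) \<partial>N)) (at l)"
proof -
  note [measurable_cong] = N(1)
  show int1: "integrable N (\<lambda>x. 1 - exp (- (l * x)))" if "0 \<le> l" for l
    by (rule Bochner_Integration.integrable_bound[of _ "\<lambda>x. max 1 l * min 1 x"])
      (use N that one_minus_exp_le in \<open>auto elim!: eventually_mono\<close>)
  have int2: "integrable N (\<lambda>x. x * exp (- (l * x)))" if "0 < l" for l
    by (rule Bochner_Integration.integrable_bound[of _ "\<lambda>x. max 1 (1 / l) * min 1 x"])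
      (use N that mult_exp_minus_le in \<open>auto elim!: eventually_mono simp: abs_mult\<close>)
  show "integrable N (\<lambda>x. x * exp (- (l * x)))" if "0 < l" for l
    by (rule int2) fact
  show "((\<lambda>l. \<integral>x. 1 - exp (- (l * x)) \<partial>N) has_real_derivative (\<integral>x. x * exp (- (l * x)) \<partial>N)) (at l)"
    if l: "0 < l" for l
    unfolding DERIV_def tendsto_at_iff_sequentially
  proof (intro allI impI)
    fix X :: "nat \<Rightarrow> real"
    assume X: "\<forall>i. X i \<in> UNIV - {0}" "X \<longlonglongrightarrow> 0"
    define Q where "Q h x = ((1 - exp (- ((l + h) * x))) - (1 - exp (- (l * x)))) / h" for h x :: real
    \<comment> \<open>Increments below \<open>l / 2\<close> keep both exponentials of the difference
      quotient under \<open>exp (- (l / 2 * x))\<close>, which yields one majorant for all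
      indices.\<close>
    have "eventually (\<lambda>i. dist (X i) 0 < l / 2) sequentially"
      using X(2) l by (intro tendstoD) auto
    then obtain n0 where n0: "\<bar>X i\<bar> < l / 2" if "i \<ge> n0" for i
      by (auto simp: eventually_sequentially dist_real_def)
    have "(\<lambda>i. \<integral>x. Q (X (i + n0)) x \<partial>N) \<longlonglongrightarrow> (\<integral>x. x * exp (- (l * x)) \<partial>N)"
    proof (rule integral_dominated_convergence[where w="\<lambda>x. x * exp (- (l / 2 * x))"])
      show "(\<lambda>x. Q (X (i + n0)) x) \<in> borel_measurable N" for i
        unfolding Q_def by measurable
      show "integrable N (\<lambda>x. x * exp (- (l / 2 * x)))"
        using l by (intro int2) auto
      show "AE x in N. (\<lambda>i. Q (X (i + n0)) x) \<longlonglongrightarrow> x * exp (- (l * x))"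
      proof (rule AE_I2)
        fix x
        have "((\<lambda>u. 1 - exp (- (u * x))) has_real_derivative x * exp (- (l * x))) (at l)"
          by (auto intro!: derivative_eq_intros)
        then have "(\<lambda>h. Q h x) \<midarrow>0\<rightarrow> x * exp (- (l * x))"
          by (simp add: DERIV_def Q_def)
        then have "((\<lambda>h. Q h x) \<circ> X) \<longlonglongrightarrow> x * exp (- (l * x))"
          using X unfolding tendsto_at_iff_sequentially by blast
        then show "(\<lambda>i. Q (X (i + n0)) x) \<longlonglongrightarrow> x * exp (- (l * x))"
          by (auto simp: o_def dest: LIMSEQ_ignore_initial_segment[where k=n0])
      qed
      show "AE x in N. norm (Q (X (i + n0)) x) \<le> x * exp (- (l / 2 * x))" for i
        using N(2)
      proof eventually_elim
        case (elim x)
        define h where "h = X (i + n0)"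
        have h: "h \<noteq> 0" "\<bar>h\<bar> < l / 2"
          using X(1) n0[of "i + n0"] by (auto simp: h_def)
        have "\<bar>exp (- (l * x)) - exp (- ((l + h) * x))\<bar> \<le> \<bar>l * x - (l + h) * x\<bar> * exp (- min (l * x) ((l + h) * x))"
          by (rule abs_exp_minus_diff_le)
        also have "\<dots> \<le> (\<bar>h\<bar> * x) * exp (- (l / 2 * x))"
        proof (intro mult_mono)
          have "l * x \<ge> l / 2 * x" "(l + h) * x \<ge> l / 2 * x"
            using elim h l by (intro mult_right_mono; force)+
          then show "exp (- min (l * x) ((l + h) * x)) \<le> exp (- (l / 2 * x))"
            by simp
        qed (use elim in \<open>auto simp: algebra_simps abs_mult\<close>)
        finally show ?case
          using h by (simp add: Q_def h_def[symmetric] divide_simps abs_mult mult_ac)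
      qed
    qed (measurable)
    then have "(\<lambda>i. \<integral>x. Q (X i) x \<partial>N) \<longlonglongrightarrow> (\<integral>x. x * exp (- (l * x)) \<partial>N)"
      by (rule LIMSEQ_offset)
    moreover have "eventually (\<lambda>i. (\<integral>x. Q (X i) x \<partial>N) =
        ((\<integral>x. 1 - exp (- ((l + X i) * x)) \<partial>N) - (\<integral>x. 1 - exp (- (l * x)) \<partial>N)) / X i) sequentially"
      using eventually_ge_at_top[of n0]
    proof eventually_elim
      case (elim i)
      have "l + X i \<ge> 0"
        using n0[OF elim] by linarith
      then show ?case
        using int1[of "l + X i"] int1[of l] l
        unfolding Q_def by (subst Bochner_Integration.integral_diff[symmetric]) auto
    qed
    ultimately show "((\<lambda>h. ((\<integral>x. 1 - exp (- ((l + h) * x)) \<partial>N) - (\<integral>x. 1 - exp (- (l * x)) \<partial>N)) / h) \<circ> X)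
        \<longlonglongrightarrow> (\<integral>x. x * exp (- (l * x)) \<partial>N)"
      unfolding o_def by (rule Lim_transform_eventually)
  qed
qed

text \<open>Pushed forward by \<open>x \<mapsto> e\<^sup>-\<^sup>x\<close>, the densities live on \<open>[0,1]\<close> and their Laplace transforms at
  the integers become moments, which determine the characteristic function.\<close>

lemma laplace_transform_unique:
  fixes f g :: "real \<Rightarrow> real"
  assumes meas[measurable]: "f \<in> borel_measurable borel" "g \<in> borel_measurable borel"
    and nonneg: "\<And>x. 0 \<le> f x" "\<And>x. 0 \<le> g x"
    and supp: "\<And>x. x \<le> 0 \<Longrightarrow> f x = 0" "\<And>x. x \<le> 0 \<Longrightarrow> g x = 0"
    and int: "\<And>l. 0 < l \<Longrightarrow> integrable lborel (\<lambda>x. exp (- (l * x)) * f x)"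
      "\<And>l. 0 < l \<Longrightarrow> integrable lborel (\<lambda>x. exp (- (l * x)) * g x)"
    and eq: "\<And>l. 0 < l \<Longrightarrow> (\<integral>x. exp (- (l * x)) * f x \<partial>lborel) = (\<integral>x. exp (- (l * x)) * g x \<partial>lborel)"
  shows "AE x in lborel. f x = g x"
proof -
  define Z where "Z = (\<integral>x. exp (- x) * f x \<partial>lborel)"
  have Zg: "Z = (\<integral>x. exp (- x) * g x \<partial>lborel)"
    using eq[of 1] by (simp add: Z_def)
  have Z0: "0 \<le> Z"
    unfolding Z_def by (intro integral_nonneg_AE) (auto simp: nonneg)
  have int1: "integrable lborel (\<lambda>x. exp (- x) * f x)" "integrable lborel (\<lambda>x. exp (- x) * g x)"
    using int[of 1] by simp_all
  show ?thesis
  proof (cases "Z = 0")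
    case True
    have "AE x in lborel. exp (- x) * f x = 0"
      using True int1(1) unfolding Z_def
      by (subst (asm) integral_nonneg_eq_0_iff_AE) (auto simp: nonneg)
    moreover have "AE x in lborel. exp (- x) * g x = 0"
      using True int1(2) unfolding Zg
      by (subst (asm) integral_nonneg_eq_0_iff_AE) (auto simp: nonneg)
    ultimately show ?thesis
      by eventually_elim simp
  next
    case False
    then have Zpos: "0 < Z"
      using Z0 by simp
    \<comment> \<open>The functions themselves need not be integrable, since finiteness is known
      only for positive \<open>l\<close>. Tilting by \<open>exp (- x)\<close> and dividing by
      \<open>Z\<close> produces a probability law.\<close>
    define D where "D h = density lborel (\<lambda>x. ennreal (exp (- x) * h x / Z))" for h :: "real \<Rightarrow> real"
    define E where "E h = distr (D h) borel (\<lambda>x. exp (- x))" for h :: "real \<Rightarrow> real"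
    \<comment> \<open>The power series of \<open>exp (\<i> * t * exp (- x))\<close> is integrated
      term by term: term \<open>n\<close> contributes the Laplace transform at \<open>Suc n\<close>,
      the extra 1 being the tilt.\<close>
    have char_E: "(\<lambda>n. (\<i> * t) ^ n / fact n / Z * complex_of_real (\<integral>x. exp (- (real (Suc n) * x)) * h x \<partial>lborel)) sums
        char (E h) t"
      if h[measurable]: "h \<in> borel_measurable borel" and h0: "\<And>x. 0 \<le> h x" and hs: "\<And>x. x \<le> 0 \<Longrightarrow> h x = 0"
        and hi: "\<And>l. 0 < l \<Longrightarrow> integrable lborel (\<lambda>x. exp (- (l * x)) * h x)" for h t
    proof -
      define c where "c n x = (\<i> * t) ^ n / fact n / Z * complex_of_real (exp (- (real (Suc n) * x)) * h x)" for n x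
      have exp_eq: "exp (- (real (Suc n) * x)) = exp (- x) ^ n * exp (- x)" for n x
      proof -
      have "- (real (Suc n) * x) = real n * (- x) + (- x)"
        by (simp add: algebra_simps)
      then show ?thesis
        by (simp only: exp_add exp_of_nat_mult)
    qed
      have "c n x = (\<i> * t * complex_of_real (exp (- x))) ^ n / fact n * (exp (- x) * h x / Z)" for n x
        unfolding c_def exp_eq by (simp add: power_mult_distrib field_simps)
      moreover have "(\<lambda>n. (\<i> * t * complex_of_real (exp (- x))) ^ n / fact n * (exp (- x) * h x / Z)) sums
          (exp (\<i> * t * complex_of_real (exp (- x))) * (exp (- x) * h x / Z))" for x
        using exp_converges[of "\<i> * t * complex_of_real (exp (- x))"] by (intro sums_mult2) (simp add: scaleR_conv_of_real field_simps)
      ultimately have c_sums: "(\<lambda>n. c n x) sums (exp (\<i> * t * complex_of_real (exp (- x))) * (exp (- x) * h x / Z))" for x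
        by (simp cong: sums_cong)
      have norm_c: "norm (c n x) = \<bar>t\<bar> ^ n / fact n / Z * (exp (- (real (Suc n) * x)) * h x)" for n x
        using h0 Zpos by (simp add: c_def norm_mult norm_divide norm_power)
      have c_le: "norm (c n x) \<le> \<bar>t\<bar> ^ n / fact n / Z * (exp (- (1 * x)) * h x)" for n x
        unfolding norm_c
      proof (cases "x \<le> 0")
        case True
        then show "\<bar>t\<bar> ^ n / fact n / Z * (exp (- (real (Suc n) * x)) * h x) \<le>
            \<bar>t\<bar> ^ n / fact n / Z * (exp (- (1 * x)) * h x)"
          by (simp add: hs)
      next
        case False
        then show "\<bar>t\<bar> ^ n / fact n / Z * (exp (- (real (Suc n) * x)) * h x) \<le>
            \<bar>t\<bar> ^ n / fact n / Z * (exp (- (1 * x)) * h x)"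
          using h0 Zpos by (intro mult_left_mono mult_right_mono) (auto simp: algebra_simps)
      qed
      have c_int: "integrable lborel (c n)" for n
        unfolding c_def[abs_def] by (intro integrable_mult_right integrable_of_real hi) auto
      have "(\<lambda>n. integral\<^sup>L lborel (c n)) sums (\<integral>x. (\<Sum>n. c n x) \<partial>lborel)"
      proof (rule sums_integral[OF c_int])
        have sm: "summable (\<lambda>n. \<bar>t\<bar> ^ n / fact n)"
          using summable_exp_generic[of "\<bar>t\<bar>"] by (simp add: field_simps)
        show "AE x in lborel. summable (\<lambda>n. norm (c n x))"
        proof (rule AE_I2)
          fix x
          have "summable (\<lambda>n. \<bar>t\<bar> ^ n / fact n / Z * (exp (- (1 * x)) * h x))"
            by (intro summable_mult2 summable_divide sm)
          then show "summable (\<lambda>n. norm (c n x))"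
            by (rule summable_comparison_test'[where g="\<lambda>n. \<bar>t\<bar> ^ n / fact n / Z * (exp (- (1 * x)) * h x)"])
              (simp only: real_norm_def abs_norm_cancel c_le)
        qed
        have "(\<integral>x. norm (c n x) \<partial>lborel) \<le> \<bar>t\<bar> ^ n / fact n / Z * (\<integral>x. exp (- (1 * x)) * h x \<partial>lborel)" for n
          using c_le hi[of 1] c_int
          by (subst integral_mult_right_zero[symmetric]) (intro integral_mono integrable_norm integrable_mult_right, auto)
          then have "norm (\<integral>x. norm (c n x) \<partial>lborel) \<le> \<bar>t\<bar> ^ n / fact n / Z * (\<integral>x. exp (- (1 * x)) * h x \<partial>lborel)" for n
            by (subst real_norm_def, subst abs_of_nonneg) (auto intro!: integral_nonneg_AE)
          moreover have "summable (\<lambda>n. \<bar>t\<bar> ^ n / fact n / Z * (\<integral>x. exp (- (1 * x)) * h x \<partial>lborel))"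
            by (intro summable_mult2 summable_divide sm)
          ultimately show "summable (\<lambda>n. \<integral>x. norm (c n x) \<partial>lborel)"
            by (rule summable_comparison_test'[rotated])
      qed
      moreover have "(\<Sum>n. c n x) = exp (\<i> * t * complex_of_real (exp (- x))) * (exp (- x) * h x / Z)" for x
        using c_sums by (simp add: sums_iff)
      moreover have "integral\<^sup>L lborel (c n) =
          (\<i> * t) ^ n / fact n / Z * complex_of_real (\<integral>x. exp (- (real (Suc n) * x)) * h x \<partial>lborel)" for n
        unfolding c_def[abs_def] by (simp only: integral_mult_right_zero integral_complex_of_real)
      moreover have "char (E h) t = (\<integral>x. exp (\<i> * t * complex_of_real (exp (- x))) * (exp (- x) * h x / Z) \<partial>lborel)"
        unfolding char_def E_def D_def using h0 Zpos
        by (subst integral_distr) (auto simp: integral_density scaleR_conv_of_real mult_ac)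
      ultimately show ?thesis
        by simp
    qed
    have "char (E f) t = char (E g) t" for t
      using char_E[OF meas(1) nonneg(1) supp(1) int(1), of t] char_E[OF meas(2) nonneg(2) supp(2) int(2), of t] eq
      by (simp add: sums_iff)
    moreover have "real_distribution (E h)"
      if h[measurable]: "h \<in> borel_measurable borel" and h0: "\<And>x. 0 \<le> h x"
        and hi: "integrable lborel (\<lambda>x. exp (- x) * h x)" "(\<integral>x. exp (- x) * h x \<partial>lborel) = Z" for h
    proof -
      have "emeasure (D h) UNIV = (\<integral>\<^sup>+x. ennreal (exp (- x) * h x / Z) \<partial>lborel)"
        unfolding D_def by (subst emeasure_density) auto
      also have "\<dots> = 1"
        using hi Zpos h0 by (subst nn_integral_eq_integral) auto
      finally have "prob_space (D h)"
        by (intro prob_spaceI) (simp add: D_def)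
      then have "prob_space (E h)"
        unfolding E_def by (intro prob_space.prob_space_distr) (auto simp: D_def)
      then show ?thesis
        by (intro real_distribution.intro real_distribution_axioms.intro) (auto simp: E_def)
    qed
    ultimately have "E f = E g"
      using int1 by (intro Levy_uniqueness) (auto simp: Z_def[symmetric] Zg[symmetric] nonneg)
    \<comment> \<open>\<open>- ln\<close> undoes the substitution, so equality of the push-forwards
      descends to the tilted laws.\<close>
    moreover have "distr (E h) lborel (\<lambda>y. - ln y) = D h" for h
      unfolding E_def by (subst distr_distr) (auto simp: o_def D_def intro!: distr_id2)
    ultimately have "D f = D g"
      by metis
    then have "AE x in lborel. ennreal (exp (- x) * f x / Z) = ennreal (exp (- x) * g x / Z)"
      unfolding D_def by (intro sigma_finite_measure.density_unique sigma_finite_lborel) auto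
    then show ?thesis
      by eventually_elim (use nonneg Zpos in simp)
  qed
qed

lemma powr_mult_exp_minus_bounded:
  fixes A c :: real
  assumes "0 \<le> A" "0 < c"
  obtains C where "0 < C" "\<And>y. 0 \<le> y \<Longrightarrow> (1 + y) powr A * exp (- (c * y)) \<le> C"
proof
  \<comment> \<open>Raising \<open>1 + y \<le> K * exp ((1 + y) / K)\<close> to the power
    \<open>A\<close> gives the exponent \<open>A / K\<close>, which this choice keeps below
    \<open>c\<close>.\<close>
  define K where "K = max 1 (A / c)"
  have K: "1 \<le> K" "A / K \<le> c"
    using assms by (auto simp: K_def field_simps max_def)
  show "0 < K powr A * exp c"
    using K by simp
  fix y :: real
  assume y: "0 \<le> y"
  have "1 + y \<le> K * exp ((1 + y) / K)"
    using exp_ge_add_one_self[of "(1 + y) / K"] K y by (simp add: field_simps)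
  then have "(1 + y) powr A \<le> (K * exp ((1 + y) / K)) powr A"
    using y assms by (intro powr_mono2) auto
  also have "\<dots> = K powr A * exp (A / K * (1 + y))"
    using K by (simp add: powr_mult exp_powr_real mult_ac)
  also have "\<dots> \<le> K powr A * exp (c * (1 + y))"
    using K y by (intro mult_left_mono exp_le_cancel_iff[THEN iffD2] mult_right_mono) auto
  finally have "(1 + y) powr A * exp (- (c * y)) \<le> K powr A * exp (c * (1 + y)) * exp (- (c * y))"
    by (intro mult_right_mono) auto
  then show "(1 + y) powr A * exp (- (c * y)) \<le> K powr A * exp c"
    by (simp add: algebra_simps flip: exp_add)
qed

lemma nn_integral_lborel_convolution:
  fixes a b :: "real \<Rightarrow> ennreal"
  assumes [measurable]: "a \<in> borel_measurable borel" "b \<in> borel_measurable borel"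
  shows "(\<integral>\<^sup>+t. \<integral>\<^sup>+z. a z * b (t - z) \<partial>lborel \<partial>lborel) = (\<integral>\<^sup>+z. a z \<partial>lborel) * (\<integral>\<^sup>+z. b z \<partial>lborel)"
proof -
  have "(\<integral>\<^sup>+t. \<integral>\<^sup>+z. a z * b (t - z) \<partial>lborel \<partial>lborel) = (\<integral>\<^sup>+z. \<integral>\<^sup>+t. a z * b (t - z) \<partial>lborel \<partial>lborel)"
    by (rule lborel_pair.Fubini') measurable
  also have "\<dots> = (\<integral>\<^sup>+z. a z * (\<integral>\<^sup>+t. b t \<partial>lborel) \<partial>lborel)"
  proof (rule nn_integral_cong)
    fix z
    have "(\<integral>\<^sup>+t. b t \<partial>lborel) = (\<integral>\<^sup>+t. b (t - z) \<partial>lborel)"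
      using nn_integral_real_affine[of b 1 "- z"] by simp
    then show "(\<integral>\<^sup>+t. a z * b (t - z) \<partial>lborel) = a z * (\<integral>\<^sup>+t. b t \<partial>lborel)"
      by (simp add: nn_integral_cmult)
  qed
  also have "\<dots> = (\<integral>\<^sup>+z. a z \<partial>lborel) * (\<integral>\<^sup>+z. b z \<partial>lborel)"
    by (rule nn_integral_multc) simp
  finally show ?thesis .
qed

text \<open>A nonzero value would persist on a whole interval, which is not a null set.\<close>

lemma continuous_on_AE_zero_imp_zero:
  fixes f :: "real \<Rightarrow> real"
  assumes "continuous_on A f" "open A" "AE x in lborel. x \<in> A \<longrightarrow> f x = 0" "x \<in> A"
  shows "f x = 0"
proof (rule ccontr)
  assume "f x \<noteq> 0"
  define U where "U = A \<inter> f -` (- {0})"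
  have U: "open U" "x \<in> U"
    using assms \<open>f x \<noteq> 0\<close> unfolding U_def by (auto intro: continuous_open_preimage)
  then obtain e where e: "0 < e" "cball x e \<subseteq> U"
    using open_contains_cball by blast
  have "AE y in lborel. y \<notin> {x .. x + e}"
    using assms(3) by eventually_elim (use e in \<open>auto simp: U_def subset_eq dist_real_def\<close>)
  then have "emeasure lborel {x .. x + e} = 0"
    by (subst (asm) AE_iff_measurable[OF _ refl]) (auto simp: atLeastAtMost_def atLeast_def atMost_def Int_def)
  then show False
    using e by simp
qed

section \<open>Densities of a self-decomposable subordinator\<close>

locale subordinator_with_densities =
  fixes M :: "'w measure" and S :: "real \<Rightarrow> 'w \<Rightarrow> real" and N :: "real measure"
    and \<nu> \<phi> :: "real \<Rightarrow> real" and \<beta>1 \<beta>2 k1 k2 :: real and pbar :: "real \<Rightarrow> real \<Rightarrow> real"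
  assumes S: "driftless_subordinator M S N \<phi>"
    and beta: "0 < \<beta>1" "\<beta>1 < \<beta>2" "\<beta>2 < 1" and k12: "0 < k1" "0 < k2"
    and phi_scaling: "\<And>l k. 0 < l \<Longrightarrow> 1 \<le> k \<Longrightarrow>
        k1 * k powr \<beta>1 \<le> \<phi> (k * l) / \<phi> l \<and> \<phi> (k * l) / \<phi> l \<le> k2 * k powr \<beta>2"
    and nu_density: "set_borel_measurable borel {0<..} \<nu>" "\<And>z. 0 < z \<Longrightarrow> 0 \<le> \<nu> z"
      "N = density lborel (\<lambda>z. ennreal (\<nu> z) * indicator {0<..} z)"
    and nu_mono: "antimono_on {0<..} (\<lambda>t. t * \<nu> t)"
    and pbar: "subordinator_densities M S pbar"
begin

text \<open>Extended by zero, as \<open>p_ext\<close> below, because nothing is known at nonpositive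
  arguments while the convolutions run over the whole line.\<close>

definition nu_ext :: "real \<Rightarrow> real" where "nu_ext z = indicator {0<..} z * \<nu> z"

text \<open>Up to the factor \<open>r\<close> this is the k-function of the law of
  \<open>S r\<close>; its monotonicity on the half-line is what self-decomposability means.\<close>

definition znu :: "real \<Rightarrow> real" where "znu z = z * nu_ext z"

definition p_ext :: "real \<Rightarrow> real \<Rightarrow> real" where "p_ext r t = indicator {0<..} t * pbar r t"

definition dist_fn :: "real \<Rightarrow> real \<Rightarrow> real" where "dist_fn r t = measure M {\<omega> \<in> space M. S r \<omega> \<le> t}"

sublocale prob_space M
  using S by (simp add: driftless_subordinator_def subordinator_def)

lemma S_measurable[measurable]: "0 \<le> t \<Longrightarrow> S t \<in> borel_measurable M"
  using S by (simp add: driftless_subordinator_def subordinator_def)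

lemma S_nonneg: "0 \<le> t \<Longrightarrow> AE \<omega> in M. 0 \<le> S t \<omega>"
proof -
  assume t: "0 \<le> t"
  have "AE \<omega> in M. S 0 \<omega> = 0 \<and> mono_on {0..} (\<lambda>t. S t \<omega>) \<and>
      (\<forall>t\<ge>0. continuous (at_right t) (\<lambda>s. S s \<omega>))"
    using S by (simp add: driftless_subordinator_def subordinator_def)
  then show ?thesis
    by eventually_elim (use t in \<open>metis atLeast_iff monotone_onD order_refl\<close>)
qed

lemma laplace_S:
  "0 \<le> l \<Longrightarrow> 0 \<le> t \<Longrightarrow> expectation (\<lambda>\<omega>. exp (- (l * S t \<omega>))) = exp (- (t * \<phi> l))"
  using S by (simp add: driftless_subordinator_def)

lemma integrable_exp_S: "0 \<le> l \<Longrightarrow> 0 \<le> t \<Longrightarrow> integrable M (\<lambda>\<omega>. exp (- (l * S t \<omega>)))"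
  using laplace_S[of l t] not_integrable_integral_eq by fastforce

lemma nu_ext_measurable[measurable]: "nu_ext \<in> borel_measurable borel"
  using nu_density(1) by (simp add: nu_ext_def[abs_def] set_borel_measurable_def)

lemma nu_ext_nonneg: "0 \<le> nu_ext z"
  using nu_density(2) by (simp add: nu_ext_def indicator_def)

lemma znu_measurable[measurable]: "znu \<in> borel_measurable borel"
  by (simp add: znu_def[abs_def])

lemma znu_nonpos[simp]: "z \<le> 0 \<Longrightarrow> znu z = 0"
  by (simp add: znu_def nu_ext_def)

lemma znu_nonneg: "0 \<le> znu z"
  using nu_ext_nonneg[of z] by (cases "z \<le> 0") (simp, simp add: znu_def)

lemma znu_antimono: "0 < z \<Longrightarrow> z \<le> w \<Longrightarrow> znu w \<le> znu z"
  using nu_mono by (auto simp: znu_def nu_ext_def monotone_on_def)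

lemma N_eq: "N = density lborel (\<lambda>z. ennreal (nu_ext z))"
  unfolding nu_density(3) by (intro arg_cong2[where f=density] refl ext) (auto simp: nu_ext_def indicator_def)

lemma N_facts: "sets N = sets borel" "AE x in N. 0 < x" "integrable N (\<lambda>x. min 1 x)"
proof -
  show s: "sets N = sets borel"
    by (simp add: N_eq)
  show pos: "AE x in N. 0 < x"
    unfolding N_eq by (subst AE_density) (measurable, auto simp: nu_ext_def indicator_def)
  have "(\<integral>\<^sup>+x. ennreal (min 1 x) \<partial>N) < \<infinity>"
    using S by (simp add: driftless_subordinator_def subordinator_levy_measure_def)
  moreover have "(\<lambda>x. min 1 x) \<in> borel_measurable N"
    by (simp add: s cong: measurable_cong_sets)
  moreover have "AE x in N. 0 \<le> min 1 x"
    using pos by eventually_elim auto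
  ultimately show "integrable N (\<lambda>x. min 1 x)"
    by (intro integrableI_nonneg) auto
qed

lemma phi_eq_N: "0 \<le> l \<Longrightarrow> \<phi> l = (\<integral>x. 1 - exp (- (l * x)) \<partial>N)"
  using S by (simp add: driftless_subordinator_def)

lemma phi_integrable: "0 \<le> l \<Longrightarrow> integrable lborel (\<lambda>z. nu_ext z * (1 - exp (- (l * z))))"
  using integrable_one_minus_exp[OF N_facts, of l] unfolding N_eq
  by (subst (asm) integrable_density) (auto simp: nu_ext_nonneg)

lemma phi_eq: "0 \<le> l \<Longrightarrow> \<phi> l = (\<integral>z. nu_ext z * (1 - exp (- (l * z))) \<partial>lborel)"
  by (subst phi_eq_N) (auto simp: N_eq integral_density nu_ext_nonneg)

lemma phi_mono: "0 \<le> l \<Longrightarrow> l \<le> l' \<Longrightarrow> \<phi> l \<le> \<phi> l'"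
proof -
  assume l: "0 \<le> l" "l \<le> l'"
  have "nu_ext z * (1 - exp (- (l * z))) \<le> nu_ext z * (1 - exp (- (l' * z)))" for z
  proof (cases "z \<le> 0")
    case False
    then show ?thesis
      using l by (intro mult_left_mono nu_ext_nonneg) (auto intro!: mult_right_mono)
  qed (simp add: nu_ext_def)
  then show ?thesis
    using l by (simp add: phi_eq integral_mono phi_integrable)
qed

lemma phi_nonneg: "0 \<le> l \<Longrightarrow> 0 \<le> \<phi> l"
  unfolding phi_eq by (intro integral_nonneg_AE AE_I2) (auto simp: nu_ext_def indicator_def nu_density)

text \<open>Scaling with \<open>k = 1\<close> excludes zeros: at a zero the quotient would be 0 / 0
  = 0, which is less than \<open>k1\<close>.\<close>

lemma phi_pos: "0 < l \<Longrightarrow> 0 < \<phi> l"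
  using phi_scaling[of l 1] phi_nonneg[of l] k12 by (cases "\<phi> l = 0") auto

lemma phi_le: "0 < l \<Longrightarrow> 1 \<le> k \<Longrightarrow> \<phi> (k * l) \<le> k2 * k powr \<beta>2 * \<phi> l"
  using phi_scaling[of l k] phi_pos[of l] by (simp add: field_simps)

lemma phi_ge: "0 < l \<Longrightarrow> 1 \<le> k \<Longrightarrow> k1 * k powr \<beta>1 * \<phi> l \<le> \<phi> (k * l)"
  using phi_scaling[of l k] phi_pos[of l] by (simp add: field_simps)

lemma k2_ge_1: "1 \<le> k2"
  using phi_le[of 1 1] phi_pos[of 1] by simp

section \<open>Exponential bounds for the distribution function of the subordinator\<close>

lemma dist_fn_mono: "0 \<le> r \<Longrightarrow> t \<le> t' \<Longrightarrow> dist_fn r t \<le> dist_fn r t'"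
  unfolding dist_fn_def by (intro finite_measure_mono) auto

lemma dist_fn_nonneg: "0 \<le> dist_fn r t"
  by (simp add: dist_fn_def)

lemma dist_fn_chernoff:
  assumes "0 \<le> r" "0 \<le> l"
  shows "dist_fn r t \<le> exp (l * t - r * \<phi> l)"
proof -
  have "dist_fn r t = expectation (indicator {\<omega> \<in> space M. S r \<omega> \<le> t})"
    using assms by (simp add: dist_fn_def)
  also have "\<dots> \<le> expectation (\<lambda>\<omega>. exp (l * t) * exp (- (l * S r \<omega>)))"
    using assms by (intro integral_mono integrable_mult_right integrable_exp_S)
      (auto simp: indicator_def mult_left_mono emeasure_eq_measure simp flip: exp_add)
  also have "\<dots> = exp (l * t - r * \<phi> l)"
    using assms by (subst integral_mult_right_zero, subst laplace_S) (auto simp flip: exp_add)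
  finally show ?thesis .
qed

text \<open>Markov's inequality for the bounded variable 1 - exp(-S_r / t), which exceeds 1/2 where
  S_r > t. A bounded function is taken because S_r has infinite mean.\<close>

lemma dist_fn_markov:
  assumes "0 \<le> r" "0 < t"
  shows "1 - 2 * (r * \<phi> (1 / t)) \<le> dist_fn r t"
proof -
  have "1 - dist_fn r t = prob {\<omega> \<in> space M. t < S r \<omega>}"
    using prob_neg[of "\<lambda>\<omega>. S r \<omega> \<le> t"] assms by (simp add: dist_fn_def not_le)
  also have "\<dots> = expectation (indicator {\<omega> \<in> space M. t < S r \<omega>})"
    using assms by simp
  also have "\<dots> \<le> expectation (\<lambda>\<omega>. 2 * (1 - exp (- (1 / t * S r \<omega>))))"
  proof (intro integral_mono_AE integrable_mult_right Bochner_Integration.integrable_diff integrable_exp_S)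
    show "AE \<omega> in M. indicator {\<omega> \<in> space M. t < S r \<omega>} \<omega> \<le> 2 * (1 - exp (- (1 / t * S r \<omega>)))"
      using S_nonneg[OF assms(1)]
    proof eventually_elim
      case (elim \<omega>)
      show ?case
      proof (cases "t < S r \<omega>")
        case True
          then have "1 \<le> 1 / t * S r \<omega>"
            using assms by simp
          then have "2 \<le> exp (1 / t * S r \<omega>)"
            using exp_ge_add_one_self[of "1 / t * S r \<omega>"] by linarith
        then show ?thesis
          using True assms by (auto simp: indicator_def exp_minus field_simps)
      qed (use elim assms in simp)
    qed
  qed (use assms in \<open>auto simp: emeasure_eq_measure\<close>)
  also have "\<dots> = 2 * (1 - exp (- (r * \<phi> (1 / t))))"
    using assms laplace_S[of "1 / t" r] integrable_exp_S[of "1 / t" r] by (simp add: prob_space)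
  also have "\<dots> \<le> 2 * (r * \<phi> (1 / t))"
    using exp_ge_add_one_self[of "- (r * \<phi> (1 / t))"] by simp
  finally show ?thesis
    by simp
qed

text \<open>If \<open>n\<close> independent increments over time \<open>h\<close> all stay below
  \<open>u\<close>, their sum stays below \<open>n * u\<close>; by stationarity each does so with
  probability \<open>dist_fn h u\<close>.\<close>

lemma dist_fn_power_le:
  assumes "0 \<le> h" "0 < n"
  shows "dist_fn h u ^ n \<le> dist_fn (real n * h) (real n * u)"
proof -
  define Y where "Y i \<omega> = S (real (Suc i) * h) \<omega> - S (real i * h) \<omega>" for i \<omega>
  have "\<forall>(n::nat) (t::nat \<Rightarrow> real). 0 \<le> t 0 \<and> mono t \<longrightarrow>
      indep_vars (\<lambda>_. borel) (\<lambda>i \<omega>. S (t (Suc i)) \<omega> - S (t i) \<omega>) {..<n}"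
    using S by (simp add: driftless_subordinator_def subordinator_def)
  from this[rule_format, of "\<lambda>i. real i * h" n] have ind: "indep_vars (\<lambda>_. borel) Y {..<n}"
    using assms by (simp add: Y_def[abs_def] mono_def mult_right_mono)
  have Y_meas[measurable]: "Y i \<in> borel_measurable M" for i
    unfolding Y_def[abs_def] using assms by (intro borel_measurable_diff S_measurable) auto
  have stat: "\<forall>s\<ge>0. \<forall>t\<ge>0. distr M borel (\<lambda>\<omega>. S (s + t) \<omega> - S s \<omega>) = distr M borel (S t)"
    using S by (simp add: driftless_subordinator_def subordinator_def)
  have "prob (Y i -` {..u} \<inter> space M) = dist_fn h u" for i
  proof -
    have "distr M borel (Y i) = distr M borel (S h)"
      using stat[rule_format, of "real i * h" h] assms by (simp add: Y_def[abs_def] algebra_simps)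
    then have "measure (distr M borel (Y i)) {..u} = measure (distr M borel (S h)) {..u}"
      by simp
    then show ?thesis
      using assms by (simp add: measure_distr dist_fn_def vimage_def Int_def conj_commute)
  qed
  then have "dist_fn h u ^ n = (\<Prod>i<n. prob (Y i -` {..u} \<inter> space M))"
    by simp
  also have "\<dots> = prob (\<Inter>i<n. Y i -` {..u} \<inter> space M)"
    using assms by (intro indep_varsD_finite[OF ind, symmetric]) auto
  also have "\<dots> \<le> dist_fn (real n * h) (real n * u)"
    unfolding dist_fn_def
  \<comment> \<open>The telescoping sum starts at \<open>S 0\<close>, which vanishes only almost
    surely.\<close>
  proof (rule finite_measure_mono_AE)
    have "AE \<omega> in M. S 0 \<omega> = 0 \<and> mono_on {0..} (\<lambda>t. S t \<omega>) \<and>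
        (\<forall>t\<ge>0. continuous (at_right t) (\<lambda>s. S s \<omega>))"
      using S by (simp add: driftless_subordinator_def subordinator_def)
    then show "AE \<omega> in M. \<omega> \<in> (\<Inter>i<n. Y i -` {..u} \<inter> space M) \<longrightarrow>
        \<omega> \<in> {\<omega> \<in> space M. S (real n * h) \<omega> \<le> real n * u}"
    proof eventually_elim
      case (elim \<omega>)
      show ?case
      proof
        assume *: "\<omega> \<in> (\<Inter>i<n. Y i -` {..u} \<inter> space M)"
        have "S (real n * h) \<omega> - S (real 0 * h) \<omega> = (\<Sum>i<n. Y i \<omega>)"
          unfolding Y_def by (rule sum_lessThan_telescope[symmetric])
        also have "\<dots> \<le> (\<Sum>i<n. u)"
          using INT_D[OF *] by (intro sum_mono) simp
        finally show "\<omega> \<in> {\<omega> \<in> space M. S (real n * h) \<omega> \<le> real n * u}"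
          using elim INT_D[OF *, of 0] assms by simp
      qed
    qed
  qed (use assms in simp)
  finally show ?thesis .
qed

lemma dist_fn_lower:
  obtains L where "0 < L"
    "\<And>r t n. 0 < r \<Longrightarrow> 0 < t \<Longrightarrow> 0 < n \<Longrightarrow> r \<le> 2 * n / \<phi> (n / t) \<Longrightarrow> exp (- (L * n)) / 2 \<le> dist_fn r t"
proof
  \<comment> \<open>Solves \<open>2 * k2 * L powr (\<beta>2 - 1) = 1 / 4\<close>, which is what
    Markov's bound needs for probability 1/2.\<close>
  define L where "L = (8 * k2) powr (1 / (1 - \<beta>2))"
  have L1: "1 \<le> L"
    unfolding L_def using k2_ge_1 beta by (intro ge_one_powr_ge_zero) auto
  have "L powr (1 - \<beta>2) = 8 * k2"
    using beta k2_ge_1 by (simp add: L_def powr_powr)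
  then have L_inv: "L powr (\<beta>2 - 1) = 1 / (8 * k2)"
    using powr_minus_divide[of L "1 - \<beta>2"] by simp
  show "0 < L"
    using L1 by simp
  fix r t n :: real
  assume r: "0 < r" and t: "0 < t" and n: "0 < n" and rn: "r \<le> 2 * n / \<phi> (n / t)"
  \<comment> \<open>Rounding up costs at most one more factor 1/2, the source of the division by 2
    in the conclusion.\<close>
  define m where "m = nat \<lceil>n * L\<rceil>"
  have m: "n * L \<le> real m" "real m \<le> n * L + 1"
    using n L1 unfolding m_def by (auto simp: of_nat_nat)
  have nL: "0 < n * L"
    using n L1 by simp
  then have m0: "0 < real m"
    using m by linarith
  have "n \<le> n * L"
    using n L1 by simp
  then have "n \<le> real m"
    using m by linarith
  then have mn: "1 \<le> real m / n" "L \<le> real m / n"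
    using m n by (auto simp: pos_le_divide_eq mult.commute)
  have "\<phi> (real m / n * (n / t)) \<le> k2 * (real m / n) powr \<beta>2 * \<phi> (n / t)"
    using n t mn by (intro phi_le) auto
  then have "\<phi> (1 / (t / real m)) \<le> k2 * (real m / n) powr \<beta>2 * \<phi> (n / t)"
    using n t m0 by simp
  then have "r / real m * \<phi> (1 / (t / real m)) \<le> (2 * n / \<phi> (n / t)) / real m * (k2 * (real m / n) powr \<beta>2 * \<phi> (n / t))"
    using r rn m0 n t phi_nonneg[of "1 / (t / real m)"] phi_nonneg[of "n / t"]
    by (intro mult_mono divide_right_mono) auto
  also have "\<dots> = 2 * k2 * (real m / n) powr (\<beta>2 - 1)"
    using n t m0 phi_pos[of "n / t"] by (simp add: powr_diff field_simps)
  also have "\<dots> \<le> 2 * k2 * L powr (\<beta>2 - 1)"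
    using beta mn L1 k2_ge_1 by (intro mult_left_mono powr_mono2') auto
  also have "\<dots> \<le> 1 / 4"
    using L_inv k2_ge_1 by simp
  finally have "r / real m * \<phi> (1 / (t / real m)) \<le> 1 / 4" .
  moreover have "1 - 2 * (r / real m * \<phi> (1 / (t / real m))) \<le> dist_fn (r / real m) (t / real m)"
    using r t m0 by (intro dist_fn_markov) auto
  ultimately have "1 / 2 \<le> dist_fn (r / real m) (t / real m)"
    by linarith
  then have "(1 / 2) ^ m \<le> dist_fn (r / real m) (t / real m) ^ m"
    by (intro power_mono) auto
  also have "\<dots> \<le> dist_fn (real m * (r / real m)) (real m * (t / real m))"
    using r m0 by (intro dist_fn_power_le) auto
  also have "\<dots> = dist_fn r t"
    using m0 by simp
  finally have *: "(1 / 2) ^ m \<le> dist_fn r t" .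
  have "exp (- (L * n)) / 2 \<le> (1 / 2) powr (L * n) * (1 / 2)"
  proof -
    have "exp (- (L * n)) = exp (-1) powr (L * n)"
      by (simp add: exp_powr_real)
    also have "\<dots> \<le> (1 / 2) powr (L * n)"
      using exp_ge_add_one_self[of 1] nL by (intro powr_mono2) (auto simp: exp_minus field_simps mult.commute)
    finally show ?thesis by simp
  qed
  also have "\<dots> = (1 / 2) powr (L * n + 1)"
    by (simp add: powr_add)
  also have "\<dots> \<le> (1 / 2) powr real m"
    using m by (intro powr_mono') (auto simp: mult.commute)
  also have "\<dots> = (1 / 2) ^ m"
    by (simp add: powr_realpow)
  finally show "exp (- (L * n)) / 2 \<le> dist_fn r t"
    using * by simp
qed

text \<open>Chernoff's bound at \<open>l = \<delta> * n / t\<close>.\<close>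

lemma dist_fn_upper:
  obtains c where "0 < c"
    "\<And>r t n. 0 < r \<Longrightarrow> 0 < t \<Longrightarrow> 0 < n \<Longrightarrow> n / \<phi> (n / t) \<le> r \<Longrightarrow> dist_fn r t \<le> exp (- (c * n))"
proof
  define \<delta> where "\<delta> = (1 / (2 * k2)) powr (1 / (1 - \<beta>2))"
  have d1: "0 < \<delta>" "\<delta> \<le> 1"
    unfolding \<delta>_def using k2_ge_1 beta by (auto intro!: powr_le1)
  have "\<delta> powr (1 - \<beta>2) = 1 / (2 * k2)"
    using beta k2_ge_1 by (simp add: \<delta>_def powr_powr)
  then have dd: "\<delta> = \<delta> powr \<beta>2 / (2 * k2)"
    using d1 by (simp add: powr_diff field_simps)
  show "0 < \<delta>"
    by (rule d1)
  fix r t n :: real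
  assume r: "0 < r" and t: "0 < t" and n: "0 < n" and rn: "n / \<phi> (n / t) \<le> r"
  have "\<phi> (1 / \<delta> * (\<delta> * n / t)) \<le> k2 * (1 / \<delta>) powr \<beta>2 * \<phi> (\<delta> * n / t)"
    using n t d1 by (intro phi_le) auto
  then have "\<phi> (n / t) * \<delta> powr \<beta>2 / k2 \<le> \<phi> (\<delta> * n / t)"
    using d1 k2_ge_1 by (simp add: powr_divide field_simps)
  then have "n / \<phi> (n / t) * (\<phi> (n / t) * \<delta> powr \<beta>2 / k2) \<le> r * \<phi> (\<delta> * n / t)"
    using rn n t r phi_pos[of "n / t"] k2_ge_1 by (intro mult_mono) auto
  then have "n * (\<delta> powr \<beta>2 / k2) \<le> r * \<phi> (\<delta> * n / t)"
    using phi_pos[of "n / t"] n t by simp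
  moreover have "\<delta> powr \<beta>2 / k2 = 2 * \<delta>"
    using dd by simp
  ultimately have "\<delta> * n / t * t - r * \<phi> (\<delta> * n / t) \<le> - (\<delta> * n)"
    using t by (simp add: mult_ac)
  moreover have "dist_fn r t \<le> exp (\<delta> * n / t * t - r * \<phi> (\<delta> * n / t))"
    using r d1 n t by (intro dist_fn_chernoff) auto
  ultimately show "dist_fn r t \<le> exp (- (\<delta> * n))"
    by (meson exp_le_cancel_iff order_trans)
qed

end

section \<open>Size of z \<nu>(z) in terms of \<phi>(1/z)\<close>

lemma half_le_one_minus_exp:
  fixes y :: real
  assumes "0 \<le> y" "y \<le> 1"
  shows "y / 2 \<le> 1 - exp (- y)"
proof -
  have "exp (- y) \<le> 1 / (1 + y)"
    using exp_ge_add_one_self[of y] assms by (simp add: exp_minus field_simps)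
  also have "\<dots> \<le> 1 - y / 2"
  proof -
    have "y * y \<le> y * 1"
      using assms by (intro mult_left_mono) auto
    then show ?thesis
      using assms by (simp add: field_simps)
  qed
  finally show ?thesis by simp
qed

context subordinator_with_densities
begin

text \<open>On (0, h] one has z \<le> 2 h (1 - exp(-z / h)), so the small-jump integral is dominated
  by the integral that defines \<open>\<phi> (1 / h)\<close>.\<close>

lemma
  assumes h: "0 < h"
  shows znu_integrable: "integrable lborel (\<lambda>z. znu z * indicator {..h} z)"
    and znu_integral_le: "(\<integral>z. znu z * indicator {..h} z \<partial>lborel) \<le> 2 * h * \<phi> (1 / h)"
proof -
  have le: "znu z * indicator {..h} z \<le> 2 * h * (nu_ext z * (1 - exp (- (1 / h * z))))" for z
  proof (cases "0 < z \<and> z \<le> h")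
    case True
    then have "z \<le> 2 * h * (1 - exp (- (1 / h * z)))"
      using half_le_one_minus_exp[of "1 / h * z"] h by (simp add: field_simps)
    from mult_right_mono[OF this nu_ext_nonneg[of z]] True show ?thesis
      by (simp add: znu_def mult_ac)
  next
    case False
    have "0 \<le> nu_ext z * (1 - exp (- (1 / h * z)))"
      using nu_ext_nonneg[of z] h by (cases "z \<le> 0") (auto simp: nu_ext_def)
    then show ?thesis
      using False h by (cases "z \<le> 0") auto
  qed
  show int: "integrable lborel (\<lambda>z. znu z * indicator {..h} z)"
  proof (rule Bochner_Integration.integrable_bound[of _ "\<lambda>z. 2 * h * (nu_ext z * (1 - exp (- (1 / h * z))))"])
    show "AE z in lborel. norm (znu z * indicator {..h} z) \<le> norm (2 * h * (nu_ext z * (1 - exp (- (1 / h * z)))))"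
    proof (rule AE_I2)
      fix z
      have "0 \<le> znu z * indicator {..h} z"
        using znu_nonneg[of z] by (simp add: indicator_def)
      then show "norm (znu z * indicator {..h} z) \<le> norm (2 * h * (nu_ext z * (1 - exp (- (1 / h * z)))))"
        using le[of z] unfolding real_norm_def by linarith
    qed
  qed (use h in \<open>auto intro!: integrable_mult_right phi_integrable[of "1 / h", simplified]\<close>)
  have "(\<integral>z. znu z * indicator {..h} z \<partial>lborel) \<le> (\<integral>z. 2 * h * (nu_ext z * (1 - exp (- (1 / h * z)))) \<partial>lborel)"
    using h by (intro integral_mono int integrable_mult_right phi_integrable le) auto
  also have "\<dots> = 2 * h * \<phi> (1 / h)"
    using h by (subst phi_eq) auto
  finally show "(\<integral>z. znu z * indicator {..h} z \<partial>lborel) \<le> 2 * h * \<phi> (1 / h)" .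
qed

text \<open>By monotonicity \<open>h * znu h\<close> is at most the integral of \<open>znu\<close>
  over (0, h].\<close>

lemma znu_le:
  assumes h: "0 < h"
  shows "znu h \<le> 2 * \<phi> (1 / h)"
proof -
  have "h * znu h = (\<integral>z. znu h * indicator {0..h} z \<partial>lborel)"
    using h by simp
  also have "\<dots> \<le> (\<integral>z. znu z * indicator {..h} z \<partial>lborel)"
  proof (rule integral_mono_AE)
    show "AE z in lborel. znu h * indicator {0..h} z \<le> znu z * indicator {..h} z"
      using AE_lborel_singleton[of 0]
      by eventually_elim (use znu_antimono[of _ h] znu_nonneg in \<open>auto simp: indicator_def\<close>)
  qed (use h znu_integrable in \<open>auto intro!: integrable_mult_right\<close>)
  also have "\<dots> \<le> 2 * h * \<phi> (1 / h)"
    by (rule znu_integral_le[OF h])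
  finally show ?thesis
    using h by simp
qed

text \<open>By scaling, the parts of \<open>\<phi> (1 / t)\<close> coming from jumps below \<open>a t\<close> and above \<open>b t\<close> are small
  for small \<open>a\<close> and large \<open>b\<close>, and the part in between is controlled by \<open>znu (a t)\<close>.\<close>

lemma znu_ge:
  obtains c where "0 < c" "\<And>t. 0 < t \<Longrightarrow> c * \<phi> (1 / t) \<le> znu t"
proof
  \<comment> \<open>\<open>a\<close> and \<open>b\<close> are chosen so that the small and the large
    jumps account for at most a quarter of \<open>\<phi> (1 / t)\<close> each; the middle part must
    then carry the remaining half.\<close>
  define a where "a = (1 / (8 * k2)) powr (1 / (1 - \<beta>2))"
  define b where "b = max 1 ((8 / k1) powr (1 / \<beta>1))"
  have a: "0 < a" "a \<le> 1"
    unfolding a_def using k2_ge_1 beta by (auto intro!: powr_le1)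
  have "a powr (1 - \<beta>2) = 1 / (8 * k2)"
    using beta k2_ge_1 by (simp add: a_def powr_powr)
  then have a_small: "2 * a * (k2 * (1 / a) powr \<beta>2) = 1 / 4"
    using a k2_ge_1 by (simp add: powr_diff powr_divide field_simps)
  have b: "1 \<le> b"
    by (simp add: b_def)
  have "8 / k1 = ((8 / k1) powr (1 / \<beta>1)) powr \<beta>1"
    using beta k12 by (simp add: powr_powr)
  also have "\<dots> \<le> b powr \<beta>1"
    unfolding b_def using beta by (intro powr_mono2) auto
  finally have b_large: "2 / (k1 * b powr \<beta>1) \<le> 1 / 4"
    using k12 b by (simp add: field_simps)
  define c where "c = a / (2 * b)"
  \<comment> \<open>The argument below bounds \<open>znu\<close> at \<open>a * t\<close>; the extra
    divisor pays for passing from \<open>a * t\<close> to \<open>t\<close>.\<close>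
  define c' where "c' = c / (k2 * (1 / a) powr \<beta>2)"
  have *: "c * \<phi> (1 / t) \<le> znu (a * t)" if t: "0 < t" for t
  proof -
    have at: "0 < a * t" and bt: "0 < b * t"
      using a b t by auto
    have "\<phi> (1 / t) = (\<integral>z. nu_ext z * (1 - exp (- (1 / t * z))) \<partial>lborel)"
      using t by (intro phi_eq) auto
    also have "\<dots> \<le> (\<integral>z. 1 / t * (znu z * indicator {..a * t} z) + znu (a * t) / (a * t) * indicator {0..b * t} z
        + 2 * (nu_ext z * (1 - exp (- (1 / (b * t) * z)))) \<partial>lborel)"
    proof (intro integral_mono Bochner_Integration.integrable_add integrable_mult_right phi_integrable znu_integrable at)
      fix z
      have e: "0 \<le> nu_ext z * (1 - exp (- (1 / (b * t) * z)))"
        using nu_ext_nonneg[of z] bt by (cases "z \<le> 0") (auto simp: nu_ext_def)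
      have k: "0 \<le> znu (a * t) / (a * t)" "0 \<le> 1 / t * znu z"
        using znu_nonneg at t by auto
      consider "z \<le> 0" | "0 < z" "z \<le> a * t" | "a * t < z" "z \<le> b * t" | "0 < z" "b * t < z"
        by linarith
      then show "nu_ext z * (1 - exp (- (1 / t * z))) \<le>
        1 / t * (znu z * indicator {..a * t} z) + znu (a * t) / (a * t) * indicator {0..b * t} z
        + 2 * (nu_ext z * (1 - exp (- (1 / (b * t) * z))))"
      proof cases
        case 1
        then show ?thesis
          using k e by (auto simp: nu_ext_def indicator_def)
      next
        case 2
        have "nu_ext z * (1 - exp (- (1 / t * z))) \<le> nu_ext z * (1 / t * z)"
          using exp_ge_add_one_self[of "- (1 / t * z)"] by (intro mult_left_mono nu_ext_nonneg) linarith
        also have "\<dots> = 1 / t * znu z"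
          by (simp add: znu_def)
        finally show ?thesis
          using k e 2 by (simp add: indicator_def)
      next
        case 3
        then have z: "0 < z"
          using at by linarith
        have "nu_ext z * (1 - exp (- (1 / t * z))) \<le> nu_ext z * 1"
          by (intro mult_left_mono nu_ext_nonneg) auto
        also have "\<dots> = znu z / z"
          using z by (simp add: znu_def)
        also have "\<dots> \<le> znu (a * t) / (a * t)"
          using 3 at z by (intro frac_le znu_antimono znu_nonneg) auto
        finally show ?thesis
          using k e 3 z by (simp add: indicator_def)
      next
        case 4
        have "exp (- (1 / (b * t) * z)) \<le> exp (- 1)"
          using 4 bt by (simp add: field_simps)
        also have "\<dots> \<le> 1 / 2"
          using exp_ge_add_one_self[of 1] by (simp add: exp_minus field_simps)
        finally have "exp (- (1 / (b * t) * z)) \<le> 1 / 2" .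
        moreover have "1 - u \<le> 2 * (1 - v)" if "v \<le> 1 / 2" "0 < u" for u v :: real
          using that by simp
        ultimately have "1 - exp (- (1 / t * z)) \<le> 2 * (1 - exp (- (1 / (b * t) * z)))"
          using exp_gt_zero by blast
        then have "nu_ext z * (1 - exp (- (1 / t * z))) \<le> nu_ext z * (2 * (1 - exp (- (1 / (b * t) * z))))"
          by (rule mult_left_mono) (rule nu_ext_nonneg)
        also have "\<dots> = 2 * (nu_ext z * (1 - exp (- (1 / (b * t) * z))))"
          by (rule mult.left_commute)
        finally have "nu_ext z * (1 - exp (- (1 / t * z))) \<le> 2 * (nu_ext z * (1 - exp (- (1 / (b * t) * z))))" .
        moreover have "0 \<le> 1 / t * (znu z * indicator {..a * t} z)"
          "0 \<le> znu (a * t) / (a * t) * indicator {0..b * t} z"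
          using k znu_nonneg[of z] t by (auto simp: indicator_def)
        ultimately show ?thesis
          by linarith
      qed
    qed (use t a b in auto)
    also have "\<dots> = 1 / t * (\<integral>z. znu z * indicator {..a * t} z \<partial>lborel) + znu (a * t) / (a * t) * (b * t) +
        2 * \<phi> (1 / (b * t))"
      using t a b at bt znu_integrable[OF at] phi_integrable[of "1 / (b * t)"] phi_eq[of "1 / (b * t)"]
      by (subst Bochner_Integration.integral_add, force, force, subst Bochner_Integration.integral_add)
        (auto simp del: times_divide_eq_left)
    also have "\<dots> \<le> 1 / 4 * \<phi> (1 / t) + znu (a * t) * (b / a) + 1 / 4 * \<phi> (1 / t)"
    proof (intro add_mono)
      have "\<phi> (1 / a * (1 / t)) \<le> k2 * (1 / a) powr \<beta>2 * \<phi> (1 / t)"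
        using a t by (intro phi_le) auto
      then have "1 / t * (\<integral>z. znu z * indicator {..a * t} z \<partial>lborel) \<le>
          1 / t * (2 * (a * t) * (k2 * (1 / a) powr \<beta>2 * \<phi> (1 / t)))"
        using t at by (intro mult_left_mono order_trans[OF znu_integral_le[OF at]]) auto
      also have "\<dots> = (2 * a * (k2 * (1 / a) powr \<beta>2)) * \<phi> (1 / t)"
        using t by simp
      finally show "1 / t * (\<integral>z. znu z * indicator {..a * t} z \<partial>lborel) \<le> 1 / 4 * \<phi> (1 / t)"
        by (simp only: a_small)
      have "k1 * b powr \<beta>1 * \<phi> (1 / (b * t)) \<le> \<phi> (b * (1 / (b * t)))"
        using b bt by (intro phi_ge) auto
      then have "2 * \<phi> (1 / (b * t)) \<le> 2 / (k1 * b powr \<beta>1) * \<phi> (1 / t)"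
        using b k12 by (simp add: field_simps)
      also have "\<dots> \<le> 1 / 4 * \<phi> (1 / t)"
        using b_large t phi_nonneg[of "1 / t"] by (intro mult_right_mono) auto
      finally show "2 * \<phi> (1 / (b * t)) \<le> 1 / 4 * \<phi> (1 / t)" .
    qed (use a t in auto)
    finally show ?thesis
      using a b by (simp add: c_def field_simps)
  qed
  have c: "0 < c"
    using a b by (simp add: c_def)
  show "0 < c'"
    using a c k12 by (simp add: c'_def)
  fix t :: real
  assume t: "0 < t"
  have "\<phi> (1 / a * (a / t)) \<le> k2 * (1 / a) powr \<beta>2 * \<phi> (a / t)"
    using a t by (intro phi_le) auto
  then have "c' * \<phi> (1 / t) \<le> c' * (k2 * (1 / a) powr \<beta>2 * \<phi> (a / t))"
    using a c k12 by (intro mult_left_mono) (auto simp: c'_def)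
  also have "\<dots> = c * \<phi> (1 / (t / a))"
    using a k12 by (simp add: c'_def)
  also have "\<dots> \<le> znu (a * (t / a))"
    using a t by (intro *) auto
  finally show "c' * \<phi> (1 / t) \<le> znu t"
    using a by simp
qed

section \<open>The convolution equation for the densities\<close>

lemma
  assumes r: "0 < r"
  shows pbar_nonneg: "0 < t \<Longrightarrow> 0 \<le> pbar r t"
    and p_ext_measurable: "p_ext r \<in> borel_measurable borel"
    and S_distributed: "distributed M lborel (S r) (\<lambda>t. ennreal (p_ext r t))"
    and pbar_bounded: "\<exists>A>0. \<forall>t. p_ext r t \<le> A"
    and pbar_continuous: "continuous_on {0<..} (pbar r)"
proof -
  have *: "\<forall>t>0. 0 \<le> pbar r t" "distributed M lborel (S r) (\<lambda>t. ennreal (pbar r t) * indicator {0<..} t)"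
    "\<exists>C. \<forall>t>0. pbar r t \<le> C" "smooth_on_pos (pbar r)"
    using pbar r by (auto simp: subordinator_densities_def)
  show "0 < t \<Longrightarrow> 0 \<le> pbar r t"
    using * by auto
  have eq: "(\<lambda>t. ennreal (pbar r t) * indicator {0<..} t) = (\<lambda>t. ennreal (p_ext r t))"
    by (auto simp: p_ext_def indicator_def)
  show **: "distributed M lborel (S r) (\<lambda>t. ennreal (p_ext r t))"
    using *(2) by (simp add: eq)
  have "(\<lambda>t. enn2real (ennreal (p_ext r t))) \<in> borel_measurable borel"
    using distributed_borel_measurable[OF **] by measurable
  moreover have "enn2real (ennreal (p_ext r t)) = p_ext r t" for t
    using *(1) by (auto simp: p_ext_def indicator_def)
  ultimately show "p_ext r \<in> borel_measurable borel"
    by simp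
  obtain C where C: "\<And>t. 0 < t \<Longrightarrow> pbar r t \<le> C"
    using *(3) by auto
  have "p_ext r t \<le> max 1 C" for t
    using C[of t] by (auto simp: p_ext_def indicator_def)
  then show "\<exists>A>0. \<forall>t. p_ext r t \<le> A"
    by (intro exI[of _ "max 1 C"]) auto
  show "continuous_on {0<..} (pbar r)"
    using *(4) by (auto simp: smooth_on_pos_def intro!: differentiable_imp_continuous_on dest: spec[of _ 0])
qed

lemma p_ext_nonneg: "0 < r \<Longrightarrow> 0 \<le> p_ext r t"
  using pbar_nonneg[of r t] by (simp add: p_ext_def indicator_def)

lemma p_ext_nonpos[simp]: "t \<le> 0 \<Longrightarrow> p_ext r t = 0"
  by (simp add: p_ext_def)

lemma nn_integral_p_ext: "0 < r \<Longrightarrow> (\<integral>\<^sup>+t. ennreal (p_ext r t) \<partial>lborel) = 1"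
  using distributed_nn_integral[OF S_distributed, of r "\<lambda>_. 1"] by (simp add: emeasure_space_1)

lemma p_ext_integrable: "0 < r \<Longrightarrow> integrable lborel (p_ext r)"
  using nn_integral_p_ext[of r] p_ext_measurable[of r] p_ext_nonneg[of r]
  by (intro integrableI_nonneg) auto

lemma p_ext_reflect_integrable:
  assumes "0 < r"
  shows "integrable lborel (\<lambda>z. p_ext r (t - z) * indicator {0<..} z)"
proof -
  have "integrable lborel (\<lambda>z. p_ext r (t - z))"
    using lborel_integrable_real_affine[OF p_ext_integrable[OF assms], of "-1" t] by simp
  then show ?thesis
    using integrable_mult_indicator[of "{0<..}" lborel "\<lambda>z. p_ext r (t - z)"]
    by (simp add: mult.commute)
qed

lemma integral_p_ext_dist_fn:
  assumes "0 < r"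
  shows "(\<integral>z. p_ext r (t - z) * indicator {0<..} z \<partial>lborel) = dist_fn r t"
proof -
  note [measurable] = p_ext_measurable[OF assms]
  have "(\<integral>z. p_ext r (t - z) * indicator {0<..} z \<partial>lborel) = (\<integral>z. p_ext r z * indicator {..<t} z \<partial>lborel)"
    using lborel_integral_real_affine[of "-1" "\<lambda>z. p_ext r z * indicator {..<t} z" t]
    by (simp add: indicator_def cong: if_cong)
  also have "\<dots> = (\<integral>z. p_ext r z * indicator {..t} z \<partial>lborel)"
    by (rule integral_cong_AE) (use AE_lborel_singleton[of t] in \<open>auto simp: indicator_def\<close>)
  also have "\<dots> = expectation (\<lambda>\<omega>. indicator {..t} (S r \<omega>))"
    using S_distributed[OF assms] p_ext_nonneg[OF assms] by (intro distributed_integral) auto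
  also have "\<dots> = expectation (indicator {\<omega> \<in> space M. S r \<omega> \<le> t})"
    by (intro Bochner_Integration.integral_cong) (auto simp: indicator_def)
  also have "\<dots> = dist_fn r t"
    using assms by (simp add: dist_fn_def)
  finally show ?thesis .
qed

definition conv :: "real \<Rightarrow> real \<Rightarrow> real" where
  "conv r t = (\<integral>z. znu z * p_ext r (t - z) \<partial>lborel)"

lemma conv_integrable:
  assumes "0 < r"
  shows "integrable lborel (\<lambda>z. znu z * p_ext r (t - z))"
proof (cases "0 < t")
  case True
  note [measurable] = p_ext_measurable[OF assms]
  obtain A where A: "0 < A" "\<And>t. p_ext r t \<le> A"
    using pbar_bounded[OF assms] by auto
  show ?thesis
  proof (rule Bochner_Integration.integrable_bound[of _ "\<lambda>z. A * (znu z * indicator {..t} z)"])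
    show "AE z in lborel. norm (znu z * p_ext r (t - z)) \<le> norm (A * (znu z * indicator {..t} z))"
      using A p_ext_nonneg[OF assms] znu_nonneg mult_left_mono[OF A(2) znu_nonneg]
      by (intro AE_I2) (auto simp: abs_mult indicator_def mult.commute[of A])
  qed (use True in \<open>auto intro!: znu_integrable\<close>)
next
  case False
  have "(\<lambda>z. znu z * p_ext r (t - z)) = (\<lambda>_. 0)"
  proof (rule ext)
    fix z
    show "znu z * p_ext r (t - z) = 0"
      using False by (cases "z \<le> 0") auto
  qed
  then show ?thesis
    by simp
qed

lemma conv_measurable:
  assumes "0 < r"
  shows "conv r \<in> borel_measurable borel"
proof -
  note [measurable] = p_ext_measurable[OF assms]
  have "(\<lambda>t. \<integral>z. znu z * p_ext r (t - z) \<partial>lborel) \<in> borel_measurable lborel"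
    by measurable
  then show ?thesis
    by (simp add: conv_def[abs_def])
qed

lemma conv_nonneg: "0 < r \<Longrightarrow> 0 \<le> conv r t"
  unfolding conv_def by (intro integral_nonneg_AE AE_I2) (auto simp: znu_nonneg p_ext_nonneg)

text \<open>\<open>p_ext r\<close> can jump only at 0, so for each \<open>t\<close> the integrands
  converge at every \<open>z\<close> except \<open>z = t\<close>; the bound on the density supplies
  the majorant.\<close>

lemma conv_continuous:
  assumes "0 < r"
  shows "continuous_on {0<..} (conv r)"
proof -
  note [measurable] = p_ext_measurable[OF assms]
  obtain A where A: "0 < A" "\<And>t. p_ext r t \<le> A"
    using pbar_bounded[OF assms] by auto
  have p_ext_cont: "isCont (p_ext r) y" if "y \<noteq> 0" for y
  proof (cases "0 < y")
    case True
    have "isCont (pbar r) y"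
      using pbar_continuous[OF assms] True by (simp add: continuous_on_eq_continuous_at)
    moreover have "eventually (\<lambda>z. pbar r z = p_ext r z) (nhds y)"
      using eventually_nhds_in_open[of "{0<..}" y] True by (auto elim!: eventually_mono simp: p_ext_def)
    ultimately show ?thesis
      using isCont_cong[of "pbar r" "p_ext r" y] by simp
  next
    case False
    have "isCont (\<lambda>_. 0::real) y"
      by simp
    moreover have "eventually (\<lambda>z. 0 = p_ext r z) (nhds y)"
      using eventually_nhds_in_open[of "{..<0}" y] that False by (auto elim!: eventually_mono simp: p_ext_def)
    ultimately show ?thesis
      using isCont_cong[of "\<lambda>_. 0" "p_ext r" y] by simp
  qed
  show ?thesis
    unfolding continuous_on_sequentially
  proof (intro ballI allI impI)
    fix t :: real and X :: "nat \<Rightarrow> real"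
    assume t: "t \<in> {0<..}" and "(\<forall>n. X n \<in> {0<..}) \<and> X \<longlonglongrightarrow> t"
    then have X: "\<And>n. 0 < X n" "X \<longlonglongrightarrow> t"
      by auto
    obtain B where B: "0 < B" "\<And>n. X n \<le> B"
      using X(2) by (metis Bseq_def abs_ge_self convergentI convergent_imp_Bseq order_trans real_norm_def)
    have "(\<lambda>n. \<integral>z. znu z * p_ext r (X n - z) \<partial>lborel) \<longlonglongrightarrow> (\<integral>z. znu z * p_ext r (t - z) \<partial>lborel)"
    proof (rule integral_dominated_convergence[where w="\<lambda>z. A * (znu z * indicator {..B} z)"])
      show "AE z in lborel. (\<lambda>n. znu z * p_ext r (X n - z)) \<longlonglongrightarrow> znu z * p_ext r (t - z)"
        using AE_lborel_singleton[of t]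
      proof eventually_elim
        case (elim z)
        show ?case
          using elim by (intro tendsto_mult tendsto_const isCont_tendsto_compose[OF p_ext_cont] tendsto_diff X(2)) auto
      qed
      show "AE z in lborel. norm (znu z * p_ext r (X n - z)) \<le> A * (znu z * indicator {..B} z)" for n
      proof (rule AE_I2)
        fix z
        show "norm (znu z * p_ext r (X n - z)) \<le> A * (znu z * indicator {..B} z)"
          using A p_ext_nonneg[OF assms] znu_nonneg B(2)[of n] mult_left_mono[OF A(2) znu_nonneg]
          by (cases "z \<le> B") (auto simp: abs_mult mult.commute[of A])
      qed
    qed (use B in \<open>auto intro!: znu_integrable\<close>)
    then show "(conv r \<circ> X) \<longlonglongrightarrow> conv r t"
      by (simp add: conv_def[abs_def] o_def)
  qed
qed

text \<open>Differentiating \<open>E exp (- l S\<^sub>r) = exp (- r \<phi> l)\<close> in \<open>l\<close> shows that both sides have the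
  same Laplace transform; they are continuous, so they agree everywhere on the half-line.\<close>

lemma pbar_convolution_equation:
  assumes r: "0 < r" and t: "0 < t"
  shows "t * pbar r t = r * conv r t"
proof -
  note [measurable] = p_ext_measurable[OF r] conv_measurable[OF r]
  \<comment> \<open>The law of \<open>S r\<close> as a measure on the line, charging only the
    positive half-line, to which the differentiation result for Levy measures applies.\<close>
  define D where "D = density lborel (\<lambda>z. ennreal (p_ext r z))"
  have D_distr: "D = distr M lborel (S r)"
    using S_distributed[OF r] by (simp add: D_def distributed_def)
  have D_sets: "sets D = sets borel" and D_pos: "AE x in D. 0 < x"
    unfolding D_def by (simp, subst AE_density, simp) (auto simp: p_ext_def indicator_def)
  have "prob_space D"
    unfolding D_distr using r by (intro prob_space_distr) auto
  then interpret D: prob_space D .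
  have D_int: "integrable D (\<lambda>x. min 1 x)"
  proof (rule D.integrable_const_bound[of _ 1])
    show "AE x in D. norm (min 1 x) \<le> 1"
      using D_pos by eventually_elim auto
    show "(\<lambda>x. min 1 x) \<in> borel_measurable D"
      by (simp add: D_sets cong: measurable_cong_sets)
  qed
  have D_eq: "(\<integral>x. 1 - exp (- (l * x)) \<partial>D) = 1 - exp (- (r * \<phi> l))" if "0 \<le> l" for l
  proof -
    have "(\<integral>x. 1 - exp (- (l * x)) \<partial>D) = expectation (\<lambda>\<omega>. 1 - exp (- (l * S r \<omega>)))"
      unfolding D_distr using r by (intro integral_distr) auto
    also have "\<dots> = 1 - exp (- (r * \<phi> l))"
      using that r integrable_exp_S[of l r] laplace_S[of l r] by (simp add: prob_space)
    finally show ?thesis .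
  qed
  \<comment> \<open>The derivative of 1 - exp(-r \<phi>(l)) computed twice: through the Levy measure
    by the chain rule, and directly under the law of \<open>S r\<close>.\<close>
  have D_deriv: "(\<integral>x. x * exp (- (l * x)) \<partial>D) = r * (\<integral>x. x * exp (- (l * x)) \<partial>N) * exp (- (r * \<phi> l))"
    if l: "0 < l" for l
  proof -
    have "((\<lambda>l. \<integral>x. 1 - exp (- (l * x)) \<partial>N) has_real_derivative (\<integral>x. x * exp (- (l * x)) \<partial>N)) (at l)"
      by (intro DERIV_laplace_exponent N_facts l)
    then have "(\<phi> has_real_derivative (\<integral>x. x * exp (- (l * x)) \<partial>N)) (at l)"
      by (rule has_field_derivative_transform_within_open[of _ _ _ "{0<..}"]) (use l phi_eq_N in auto)
    then have "((\<lambda>l. 1 - exp (- (r * \<phi> l))) has_real_derivative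
        r * (\<integral>x. x * exp (- (l * x)) \<partial>N) * exp (- (r * \<phi> l))) (at l)"
      by (auto intro!: derivative_eq_intros)
    moreover have "((\<lambda>l. \<integral>x. 1 - exp (- (l * x)) \<partial>D) has_real_derivative (\<integral>x. x * exp (- (l * x)) \<partial>D)) (at l)"
      by (intro DERIV_laplace_exponent D_sets D_pos D_int l)
    then have "((\<lambda>l. 1 - exp (- (r * \<phi> l))) has_real_derivative (\<integral>x. x * exp (- (l * x)) \<partial>D)) (at l)"
      by (rule has_field_derivative_transform_within_open[of _ _ _ "{0<..}"]) (use l D_eq in auto)
    ultimately show ?thesis
      using DERIV_unique by blast
  qed
  have f_int: "integrable lborel (\<lambda>x. exp (- (l * x)) * (x * p_ext r x))"
    and f_eq: "(\<integral>x. exp (- (l * x)) * (x * p_ext r x) \<partial>lborel) = (\<integral>x. x * exp (- (l * x)) \<partial>D)" if "0 < l" for l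
    using integrable_mult_exp[OF D_sets D_pos D_int that] unfolding D_def
    by (auto simp: integrable_density integral_density p_ext_nonneg[OF r] mult_ac)
  \<comment> \<open>Computed with nonnegative integrals, so that Tonelli applies before
    \<open>conv r\<close> is known to have a finite Laplace transform.\<close>
  have g_nn: "(\<integral>\<^sup>+x. ennreal (exp (- (l * x)) * (r * conv r x)) \<partial>lborel) =
      ennreal (r * (\<integral>x. x * exp (- (l * x)) \<partial>N) * exp (- (r * \<phi> l)))" if l: "0 < l" for l
  proof -
    define a where "a z = ennreal (exp (- (l * z)) * znu z)" for z
    define b where "b z = ennreal (exp (- (l * z)) * p_ext r z)" for z
    have [measurable]: "a \<in> borel_measurable borel" "b \<in> borel_measurable borel"
      unfolding a_def[abs_def] b_def[abs_def] by measurable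
    \<comment> \<open>The tilt splits as exp(-l x) = exp(-l z) exp(-l (x - z)), so the tilted
      convolution is the convolution of the tilted factors.\<close>
    have "ennreal (exp (- (l * x)) * (r * conv r x)) = ennreal r * (\<integral>\<^sup>+z. a z * b (x - z) \<partial>lborel)" for x
    proof -
      have "a z * b (x - z) = ennreal (exp (- (l * x))) * ennreal (znu z * p_ext r (x - z))" for z
        unfolding a_def b_def using znu_nonneg p_ext_nonneg[OF r]
        by (simp add: algebra_simps flip: ennreal_mult exp_add)
      moreover have "(\<integral>\<^sup>+z. ennreal (znu z * p_ext r (x - z)) \<partial>lborel) = ennreal (conv r x)"
        unfolding conv_def using znu_nonneg p_ext_nonneg[OF r]
        by (intro nn_integral_eq_integral conv_integrable r) auto
      ultimately show ?thesis
        using r conv_nonneg[OF r] by (simp add: nn_integral_cmult mult_ac flip: ennreal_mult)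
    qed
    then have "(\<integral>\<^sup>+x. ennreal (exp (- (l * x)) * (r * conv r x)) \<partial>lborel) =
        ennreal r * ((\<integral>\<^sup>+z. a z \<partial>lborel) * (\<integral>\<^sup>+z. b z \<partial>lborel))"
      by (simp add: nn_integral_cmult nn_integral_lborel_convolution)
    moreover have "(\<integral>\<^sup>+z. a z \<partial>lborel) = ennreal (\<integral>x. x * exp (- (l * x)) \<partial>N)"
    proof -
      have "integrable lborel (\<lambda>z. nu_ext z *\<^sub>R (z * exp (- (l * z))))"
        using integrable_mult_exp[OF N_facts l] unfolding N_eq by (subst (asm) integrable_density) (auto simp: nu_ext_nonneg)
      then have "integrable lborel (\<lambda>z. exp (- (l * z)) * znu z)"
        by (simp add: znu_def mult_ac)
      then show ?thesis
        unfolding a_def using znu_nonneg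
        by (subst nn_integral_eq_integral, simp, simp)
          (simp add: znu_def N_eq integral_density nu_ext_nonneg mult_ac)
    qed
    moreover have "(\<integral>\<^sup>+z. b z \<partial>lborel) = ennreal (exp (- (r * \<phi> l)))"
    proof -
      have "(\<integral>\<^sup>+z. b z \<partial>lborel) = (\<integral>\<^sup>+z. ennreal (p_ext r z) * ennreal (exp (- (l * z))) \<partial>lborel)"
        unfolding b_def using p_ext_nonneg[OF r] by (simp add: mult.commute flip: ennreal_mult)
      also have "\<dots> = (\<integral>\<^sup>+\<omega>. ennreal (exp (- (l * S r \<omega>))) \<partial>M)"
        using S_distributed[OF r] by (intro distributed_nn_integral) auto
      also have "\<dots> = ennreal (exp (- (r * \<phi> l)))"
        using r l laplace_S[of l r] by (subst nn_integral_eq_integral[OF integrable_exp_S]) auto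
      finally show ?thesis .
    qed
    moreover have "0 \<le> (\<integral>x. x * exp (- (l * x)) \<partial>N)"
      using N_facts(2) by (intro integral_nonneg_AE) (auto elim!: eventually_mono)
    ultimately show ?thesis
      using r by (simp add: ennreal_mult mult_ac)
  qed
  have g_nonneg: "0 \<le> exp (- (l * x)) * (r * conv r x)" for l x
    using r conv_nonneg[OF r] by simp
  have "AE x in lborel. x * p_ext r x = r * conv r x"
  proof (rule laplace_transform_unique)
    show "0 \<le> x * p_ext r x" for x
      using p_ext_nonneg[OF r] by (cases "x \<le> 0") auto
    show "r * conv r x = 0" if "x \<le> 0" for x
    proof -
      have "znu z * p_ext r (x - z) = 0" for z
        using that by (cases "z \<le> 0") auto
      then have "(\<lambda>z. znu z * p_ext r (x - z)) = (\<lambda>_. 0)"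
        by (intro ext)
      then show ?thesis
        by (simp add: conv_def)
    qed
    show "integrable lborel (\<lambda>x. exp (- (l * x)) * (r * conv r x))" if "0 < l" for l
      by (rule integrableI_nn_integral_finite[OF _ _ g_nn]) (use that g_nonneg in auto)
    show "(\<integral>x. exp (- (l * x)) * (x * p_ext r x) \<partial>lborel) = (\<integral>x. exp (- (l * x)) * (r * conv r x) \<partial>lborel)"
      if l: "0 < l" for l
    proof -
      have "0 \<le> (\<integral>x. x * exp (- (l * x)) \<partial>N)"
        using N_facts(2) by (intro integral_nonneg_AE) (auto elim!: eventually_mono)
      then have "(\<integral>x. exp (- (l * x)) * (r * conv r x) \<partial>lborel) =
          r * (\<integral>x. x * exp (- (l * x)) \<partial>N) * exp (- (r * \<phi> l))"
        using r by (subst integral_eq_nn_integral) (auto simp: g_nn[OF l] g_nonneg)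
      then show ?thesis
        using f_eq[OF l] D_deriv[OF l] by simp
    qed
    show "0 \<le> r * conv r x" for x
      using r conv_nonneg[OF r] by simp
  qed (auto intro: f_int)
  moreover have "continuous_on {0<..} (\<lambda>x. x * pbar r x - r * conv r x)"
    by (intro continuous_intros pbar_continuous conv_continuous r)
  ultimately have "t * pbar r t - r * conv r t = 0"
    using t by (intro continuous_on_AE_zero_imp_zero[of "{0<..}" "\<lambda>x. x * pbar r x - r * conv r x"])
      (auto simp: p_ext_def elim!: eventually_mono)
  then show ?thesis
    by simp
qed

section \<open>Two-sided bounds for the densities\<close>

lemma pbar_lower:
  obtains c where "0 < c" "\<And>r t. 0 < r \<Longrightarrow> 0 < t \<Longrightarrow> c * (r * \<phi> (1 / t) / t) * dist_fn r t \<le> pbar r t"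
proof -
  obtain c where c: "0 < c" "\<And>t. 0 < t \<Longrightarrow> c * \<phi> (1 / t) \<le> znu t"
    by (rule znu_ge) blast
  have "c * (r * \<phi> (1 / t) / t) * dist_fn r t \<le> pbar r t" if r: "0 < r" and t: "0 < t" for r t
  proof -
    have "znu t * dist_fn r t = (\<integral>z. znu t * (p_ext r (t - z) * indicator {0<..} z) \<partial>lborel)"
      using integral_p_ext_dist_fn[OF r, of t] by simp
    also have "\<dots> \<le> conv r t"
      unfolding conv_def
    proof (rule integral_mono[OF _ conv_integrable[OF r]])
      show "integrable lborel (\<lambda>z. znu t * (p_ext r (t - z) * indicator {0<..} z))"
        by (intro integrable_mult_right p_ext_reflect_integrable r)
      show "znu t * (p_ext r (t - z) * indicator {0<..} z) \<le> znu z * p_ext r (t - z)" for z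
      proof (cases "0 < z \<and> z < t")
        case True
        then show ?thesis
          using znu_antimono[of z t] p_ext_nonneg[OF r] by (auto intro!: mult_right_mono)
      qed (auto simp: not_less)
    qed
    also have "\<dots> = t * pbar r t / r"
      using pbar_convolution_equation[OF r t] r by simp
    finally have "r * (znu t * dist_fn r t) \<le> t * pbar r t"
      using r by (simp add: field_simps)
    moreover have "r * (c * \<phi> (1 / t) * dist_fn r t) \<le> r * (znu t * dist_fn r t)"
      using r c(2)[OF t] dist_fn_nonneg by (intro mult_left_mono mult_right_mono) auto
    ultimately show ?thesis
      using t by (simp add: field_simps)
  qed
  then show ?thesis
    using that c(1) by blast
qed

text \<open>The convolution equation bounds \<open>\<tau>\<^sup>2 p(\<tau>)\<close> by half of the supremum \<open>D\<close> of that quantity over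
  \<open>(0, t]\<close>, plus a term with the distribution function: small jumps up to \<open>\<epsilon> \<tau>\<close> give the former, larger
  ones the latter.\<close>

lemma pbar_upper:
  obtains C where "0 < C"
    "\<And>r t. 0 < r \<Longrightarrow> 0 < t \<Longrightarrow> pbar r t \<le> C * (r * \<phi> (1 / t) / t) * sqrt (dist_fn r t)"
proof -
  \<comment> \<open>With the cut-off \<epsilon> below, the factor \<epsilon>^(-\<beta>2) equals (16
    k2 (1 + x))^\<kappa>.\<close>
  define \<kappa> where "\<kappa> = \<beta>2 / (1 - \<beta>2)"
  have kappa: "0 \<le> \<kappa>"
    using beta by (simp add: \<kappa>_def)
  obtain B where B: "0 < B" "\<And>y. 0 \<le> y \<Longrightarrow> (1 + y) powr \<kappa> * exp (- (1 / 2 * y)) \<le> B"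
    by (rule powr_mult_exp_minus_bounded[OF kappa, of "1 / 2"]) auto
  \<comment> \<open>The factors come from \<open>znu_le\<close> with the scaling of
    \<open>\<phi> (1 / h)\<close>, from the power of \<epsilon>, from Chernoff's bound, and from
    replacing \<tau> by \<open>t\<close>.\<close>
  define Q where "Q = 2 * k2 * (16 * k2) powr \<kappa> * (B * exp (1 / 2)) * k2"
  have Q: "0 < Q"
    using k2_ge_1 B by (simp add: Q_def)
  have step: "\<tau>\<^sup>2 * pbar r \<tau> \<le> D / 2 + Q * (t * (r * \<phi> (1 / t))) * sqrt (dist_fn r t)"
    if r: "0 < r" and t: "0 < \<tau>" "\<tau> \<le> t" and D: "\<And>s. 0 < s \<Longrightarrow> s \<le> t \<Longrightarrow> s\<^sup>2 * pbar r s \<le> D" for r t \<tau> D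
  proof -
    define x where "x = r * \<phi> (1 / \<tau>)"
    have x: "0 < x"
      using r t phi_pos by (simp add: x_def)
    \<comment> \<open>The cut-off has to shrink with \<open>x\<close>: the small jumps contribute a
      multiple of D x \<epsilon>^(1 - \<beta>2), which this choice brings below
      \<open>D / 2\<close>.\<close>
    define \<epsilon> where "\<epsilon> = (1 / (16 * k2 * (1 + x))) powr (1 / (1 - \<beta>2))"
    define h where "h = \<epsilon> * \<tau>"
    have k16: "16 \<le> 16 * k2 * (1 + x)"
      using mult_mono[of 16 "16 * k2" 1 "1 + x"] k2_ge_1 x by simp
    have eps0: "0 < \<epsilon>"
      using k2_ge_1 x by (simp add: \<epsilon>_def)
    have "\<epsilon> \<le> (1 / 16) powr (1 / (1 - \<beta>2))"
      unfolding \<epsilon>_def using k16 beta by (intro powr_mono2) (auto simp: field_simps)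
    also have "\<dots> \<le> (1 / 16) powr 1"
      using beta by (intro powr_mono') auto
    finally have eps1: "\<epsilon> \<le> 1 / 2"
      by simp
    have "\<epsilon> powr (1 - \<beta>2) = 1 / (16 * k2 * (1 + x))"
      using beta k2_ge_1 x by (simp add: \<epsilon>_def powr_powr add_pos_pos less_imp_neq[symmetric])
    then have eps_pow: "\<epsilon> * (1 / \<epsilon>) powr \<beta>2 = 1 / (16 * k2 * (1 + x))"
      using eps0 by (simp add: powr_diff powr_divide)
    have eps_neg: "(1 / \<epsilon>) powr \<beta>2 = (16 * k2) powr \<kappa> * (1 + x) powr \<kappa>"
      using k16 k2_ge_1 x beta unfolding \<epsilon>_def \<kappa>_def
      by (simp add: powr_divide powr_powr flip: powr_mult)
    have h: "0 < h" "h \<le> \<tau> / 2"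
      using eps0 eps1 t by (auto simp: h_def)
    have D0: "0 \<le> D"
      using D[of \<tau>] pbar_nonneg[OF r, of \<tau>] t by (meson mult_nonneg_nonneg order_trans zero_le_power2)
    have phi_h: "\<phi> (1 / h) \<le> k2 * (1 / \<epsilon>) powr \<beta>2 * \<phi> (1 / \<tau>)"
      using phi_le[of "1 / \<tau>" "1 / \<epsilon>"] eps0 eps1 t by (simp add: h_def)
    have "conv r \<tau> \<le> (\<integral>z. 4 * D / \<tau>\<^sup>2 * (znu z * indicator {..h} z) + znu h * (p_ext r (\<tau> - z) * indicator {0<..} z) \<partial>lborel)"
      unfolding conv_def
    proof (rule integral_mono[OF conv_integrable[OF r]])
      show "integrable lborel (\<lambda>z. 4 * D / \<tau>\<^sup>2 * (znu z * indicator {..h} z) + znu h * (p_ext r (\<tau> - z) * indicator {0<..} z))"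
        by (intro Bochner_Integration.integrable_add integrable_mult_right p_ext_reflect_integrable znu_integrable r h)
      show "znu z * p_ext r (\<tau> - z) \<le> 4 * D / \<tau>\<^sup>2 * (znu z * indicator {..h} z) + znu h * (p_ext r (\<tau> - z) * indicator {0<..} z)" for z
      proof -
        consider "z \<le> 0" | "0 < z" "z \<le> h" | "h < z"
          by linarith
        then show ?thesis
        proof cases
          case 1
          then show ?thesis by simp
        next
          case 2
          define s where "s = \<tau> - z"
          \<comment> \<open>Jumps of size at most \<open>\<tau> / 2\<close> leave an argument still
            comparable with \<open>\<tau>\<close>, where \<open>D\<close> controls the
            density.\<close>
          have s: "0 < s" "s \<le> t" "\<tau> / 2 \<le> s"
            using 2 h t by (auto simp: s_def)
          have "(\<tau> / 2)\<^sup>2 * pbar r s \<le> s\<^sup>2 * pbar r s"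
            using s t pbar_nonneg[OF r s(1)] by (intro mult_right_mono power_mono) auto
          also have "\<dots> \<le> D"
            using s by (intro D) auto
          finally have "pbar r s \<le> 4 * D / \<tau>\<^sup>2"
            using t by (simp add: field_simps)
          then have "znu z * p_ext r s \<le> znu z * (4 * D / \<tau>\<^sup>2)"
            using s znu_nonneg by (intro mult_left_mono) (auto simp: p_ext_def)
          also have "\<dots> = 4 * D / \<tau>\<^sup>2 * (znu z * indicator {..h} z)"
            using 2 by simp
          also have "\<dots> \<le> 4 * D / \<tau>\<^sup>2 * (znu z * indicator {..h} z) + znu h * (p_ext r s * indicator {0<..} z)"
            using znu_nonneg[of h] p_ext_nonneg[OF r] by simp
          finally show ?thesis
            unfolding s_def .
        next
          case 3
          then have "znu z * p_ext r (\<tau> - z) \<le> znu h * p_ext r (\<tau> - z)"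
            using znu_antimono[of h z] h p_ext_nonneg[OF r] by (intro mult_right_mono) auto
          then show ?thesis
            using 3 h by simp
        qed
      qed
    qed
    also have "\<dots> = 4 * D / \<tau>\<^sup>2 * (\<integral>z. znu z * indicator {..h} z \<partial>lborel) + znu h * dist_fn r \<tau>"
      using znu_integrable[OF h(1)] integral_p_ext_dist_fn[OF r, of \<tau>] p_ext_reflect_integrable[OF r, of \<tau>]
      by (subst Bochner_Integration.integral_add) (auto simp del: times_divide_eq_left)
    also have "\<dots> \<le> 4 * D / \<tau>\<^sup>2 * (2 * h * \<phi> (1 / h)) + 2 * \<phi> (1 / h) * dist_fn r \<tau>"
      using D0 znu_integral_le[OF h(1)] znu_le[OF h(1)] dist_fn_nonneg
      by (intro add_mono mult_left_mono mult_right_mono) auto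
    also have "\<dots> = (8 * D * h / \<tau>\<^sup>2 + 2 * dist_fn r \<tau>) * \<phi> (1 / h)"
      by (simp add: algebra_simps)
    also have "\<dots> \<le> (8 * D * h / \<tau>\<^sup>2 + 2 * dist_fn r \<tau>) * (k2 * (1 / \<epsilon>) powr \<beta>2 * \<phi> (1 / \<tau>))"
      using D0 h dist_fn_nonneg by (intro mult_left_mono phi_h) auto
    finally have "r * \<tau> * conv r \<tau> \<le> r * \<tau> * ((8 * D * h / \<tau>\<^sup>2 + 2 * dist_fn r \<tau>) * (k2 * (1 / \<epsilon>) powr \<beta>2 * \<phi> (1 / \<tau>)))"
      using r t by (intro mult_left_mono) auto
    moreover have "r * \<tau> * conv r \<tau> = \<tau>\<^sup>2 * pbar r \<tau>"
      using pbar_convolution_equation[OF r t(1)] by (simp add: power2_eq_square mult_ac)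
    moreover have "r * \<tau> * ((8 * D * h / \<tau>\<^sup>2 + 2 * dist_fn r \<tau>) * (k2 * (1 / \<epsilon>) powr \<beta>2 * \<phi> (1 / \<tau>))) =
        8 * D * k2 * x * (\<epsilon> * (1 / \<epsilon>) powr \<beta>2) + 2 * k2 * (\<tau> * x) * (1 / \<epsilon>) powr \<beta>2 * dist_fn r \<tau>"
      using t by (simp add: h_def x_def field_simps power2_eq_square)
    moreover have "8 * D * k2 * x * (\<epsilon> * (1 / \<epsilon>) powr \<beta>2) \<le> D / 2"
    proof -
      have "8 * D * k2 * x * (1 / (16 * k2 * y)) = D / 2 * (x / y)" if "0 < y" for y
        using k2_ge_1 that by simp
      then have "8 * D * k2 * x * (\<epsilon> * (1 / \<epsilon>) powr \<beta>2) = D / 2 * (x / (1 + x))"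
        unfolding eps_pow using x by simp
      also have "\<dots> \<le> D / 2 * 1"
        using D0 x by (intro mult_left_mono) auto
      finally show ?thesis
        by simp
    qed
    moreover have "2 * k2 * (\<tau> * x) * (1 / \<epsilon>) powr \<beta>2 * dist_fn r \<tau> \<le> Q * (t * (r * \<phi> (1 / t))) * sqrt (dist_fn r t)"
    proof -
      \<comment> \<open>The distribution function is split into two square roots: one decays in
        \<open>x\<close> by Chernoff and absorbs the power of \<open>1 + x\<close>, the other is
        kept and enlarged from \<open>\<tau>\<close> to \<open>t\<close>.\<close>
      have "dist_fn r \<tau> \<le> exp (1 - x)"
        using dist_fn_chernoff[of r "1 / \<tau>" \<tau>] r t by (simp add: x_def)
      also have "exp (1 - x) = (exp (1 / 2) * exp (- (1 / 2 * x)))\<^sup>2"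
        by (simp add: power2_eq_square flip: exp_add)
      finally have s1: "sqrt (dist_fn r \<tau>) \<le> exp (1 / 2) * exp (- (1 / 2 * x))"
        by (intro real_le_lsqrt) auto
      have s2: "sqrt (dist_fn r \<tau>) \<le> sqrt (dist_fn r t)"
        using dist_fn_mono[of r \<tau> t] r t by simp
      have "(1 + x) powr \<kappa> * sqrt (dist_fn r \<tau>) \<le> (1 + x) powr \<kappa> * (exp (1 / 2) * exp (- (1 / 2 * x)))"
        by (intro mult_left_mono s1) auto
      also have "\<dots> = ((1 + x) powr \<kappa> * exp (- (1 / 2 * x))) * exp (1 / 2)"
        by simp
      also have "\<dots> \<le> B * exp (1 / 2)"
        using x by (intro mult_right_mono B) auto
      finally have "(1 + x) powr \<kappa> * sqrt (dist_fn r \<tau>) \<le> B * exp (1 / 2)" .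
      from mult_mono[OF this s2] B(1) dist_fn_nonneg
      have "(1 + x) powr \<kappa> * sqrt (dist_fn r \<tau>) * sqrt (dist_fn r \<tau>) \<le> B * exp (1 / 2) * sqrt (dist_fn r t)"
        by simp
      then have F: "(1 + x) powr \<kappa> * dist_fn r \<tau> \<le> B * exp (1 / 2) * sqrt (dist_fn r t)"
        using dist_fn_nonneg[of r \<tau>] by (simp only: mult.assoc real_sqrt_mult_self abs_of_nonneg)
      \<comment> \<open>Because \<beta>2 < 1, the product \<tau> \<phi>(1/\<tau>) is non-decreasing
        up to the factor \<open>k2\<close>. The weight \<tau>^2 in the supremum is chosen to leave
        exactly this factor \<tau>.\<close>
      have "\<phi> (t / \<tau> * (1 / t)) \<le> k2 * (t / \<tau>) powr \<beta>2 * \<phi> (1 / t)"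
        using t by (intro phi_le) auto
      also have "\<dots> \<le> k2 * (t / \<tau>) powr 1 * \<phi> (1 / t)"
        using t beta k2_ge_1 phi_nonneg[of "1 / t"] by (intro mult_right_mono mult_left_mono powr_mono) auto
      finally have "\<phi> (1 / \<tau>) \<le> k2 * (t / \<tau>) * \<phi> (1 / t)"
        using t by simp
      then have G: "\<tau> * x \<le> k2 * (t * (r * \<phi> (1 / t)))"
        using t r by (simp add: x_def field_simps)
      have "2 * k2 * (\<tau> * x) * (1 / \<epsilon>) powr \<beta>2 * dist_fn r \<tau> =
          2 * k2 * (16 * k2) powr \<kappa> * ((\<tau> * x) * ((1 + x) powr \<kappa> * dist_fn r \<tau>))"
        by (simp add: eps_neg)
      also have "\<dots> \<le> 2 * k2 * (16 * k2) powr \<kappa> * (k2 * (t * (r * \<phi> (1 / t))) * (B * exp (1 / 2) * sqrt (dist_fn r t)))"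
        using k2_ge_1 t r x dist_fn_nonneg phi_nonneg[of "1 / t"] by (intro mult_left_mono mult_mono F G) auto
      also have "\<dots> = Q * (t * (r * \<phi> (1 / t))) * sqrt (dist_fn r t)"
        by (simp add: Q_def)
      finally show ?thesis .
    qed
    ultimately show ?thesis
      by linarith
  qed
  have "pbar r t \<le> 2 * Q * (r * \<phi> (1 / t) / t) * sqrt (dist_fn r t)" if r: "0 < r" and t: "0 < t" for r t
  proof -
    obtain A where A: "0 < A" "\<And>t. p_ext r t \<le> A"
      using pbar_bounded[OF r] by auto
    have bdd: "bdd_above ((\<lambda>s. s\<^sup>2 * pbar r s) ` {0<..t})"
    proof (rule bdd_aboveI2)
      fix s assume s: "s \<in> {0<..t}"
      then have "pbar r s \<le> A"
        using A(2)[of s] by (simp add: p_ext_def)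
      then show "s\<^sup>2 * pbar r s \<le> t\<^sup>2 * A"
        using s A pbar_nonneg[OF r, of s] by (intro mult_mono power_mono) auto
    qed
    define D where "D = (SUP s\<in>{0<..t}. s\<^sup>2 * pbar r s)"
    have D: "s\<^sup>2 * pbar r s \<le> D" if "0 < s" "s \<le> t" for s
      unfolding D_def using that by (intro cSUP_upper bdd) auto
    \<comment> \<open>\<open>D\<close> is a finite supremum by boundedness of the density, so
      \<open>D / 2\<close> can be moved to the left.\<close>
    have "D \<le> D / 2 + Q * (t * (r * \<phi> (1 / t))) * sqrt (dist_fn r t)"
      unfolding D_def[of] using t
      by (intro cSUP_least) (auto simp flip: D_def intro!: step[OF r] D)
    then have "D \<le> 2 * (Q * (t * (r * \<phi> (1 / t))) * sqrt (dist_fn r t))"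
      by simp
    with D[of t] t have "t\<^sup>2 * pbar r t \<le> 2 * (Q * (t * (r * \<phi> (1 / t))) * sqrt (dist_fn r t))"
      by linarith
    then show ?thesis
      using t by (simp add: field_simps power2_eq_square)
  qed
  then show ?thesis
    using that[of "2 * Q"] Q by simp
qed

text \<open>In the second bound the square root is split into two fourth roots: one yields decay in
  \<open>r\<close>, the other decay in \<open>n\<close>. The first bound is weakened from a half to
  a quarter in the exponent so that both share one form.\<close>

lemma pbar_upper_exp:
  obtains C c where "0 < C" "0 < c"
    "\<And>r t. 0 < r \<Longrightarrow> 0 < t \<Longrightarrow> pbar r t \<le> C * (r * \<phi> (1 / t) / t) * exp (- (r * \<phi> (1 / t) / 4))"
    "\<And>r t n. 0 < r \<Longrightarrow> 0 < t \<Longrightarrow> 0 < n \<Longrightarrow> n / \<phi> (n / t) \<le> r \<Longrightarrow>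
      pbar r t \<le> C * (r * \<phi> (1 / t) / t) * exp (- (r * \<phi> (1 / t) / 4)) * exp (- (c * n))"
proof -
  obtain C where C: "0 < C"
    "\<And>r t. 0 < r \<Longrightarrow> 0 < t \<Longrightarrow> pbar r t \<le> C * (r * \<phi> (1 / t) / t) * sqrt (dist_fn r t)"
    by (rule pbar_upper) blast
  obtain c where c: "0 < c"
    "\<And>r t n. 0 < r \<Longrightarrow> 0 < t \<Longrightarrow> 0 < n \<Longrightarrow> n / \<phi> (n / t) \<le> r \<Longrightarrow> dist_fn r t \<le> exp (- (c * n))"
    by (rule dist_fn_upper) blast
  have chern: "dist_fn r t \<le> exp (1 - r * \<phi> (1 / t))" if "0 < r" "0 < t" for r t
    using dist_fn_chernoff[of r "1 / t" t] that by simp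
  have sqrt_exp: "sqrt (exp u) = exp (u / 2)" for u :: real
    by (rule real_sqrt_unique) (auto simp flip: exp_of_nat_mult)
  have exp_one_minus: "exp (1 - u) = exp 1 * exp (- u)" for u :: real
    by (simp flip: exp_add)
  have p: "0 \<le> C * (r * \<phi> (1 / t) / t)" if "0 < r" "0 < t" for r t
    using that C phi_nonneg[of "1 / t"] by simp
  show ?thesis
  proof (rule that[of "C * exp 1" "c / 4"])
    show "0 < C * exp 1" "0 < c / 4"
      using C c by auto
    fix r t :: real
    assume r: "0 < r" and t: "0 < t"
    have "sqrt (dist_fn r t) \<le> exp ((1 - r * \<phi> (1 / t)) / 2)"
      using chern[OF r t] by (simp flip: sqrt_exp)
    also have "\<dots> \<le> exp (1 - r * \<phi> (1 / t) / 4)"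
      using r t phi_nonneg[of "1 / t"] by (simp add: field_simps)
    finally have "pbar r t \<le> C * (r * \<phi> (1 / t) / t) * exp (1 - r * \<phi> (1 / t) / 4)"
      by (intro order_trans[OF C(2)[OF r t]] mult_left_mono p r t)
    then show "pbar r t \<le> C * exp 1 * (r * \<phi> (1 / t) / t) * exp (- (r * \<phi> (1 / t) / 4))"
      by (simp only: exp_one_minus mult_ac)
    fix n :: real
    assume n: "0 < n" "n / \<phi> (n / t) \<le> r"
    have "sqrt (dist_fn r t) = sqrt (sqrt (dist_fn r t) * sqrt (dist_fn r t))"
      using dist_fn_nonneg[of r t] by simp
    also have "\<dots> \<le> sqrt (sqrt (exp (1 - r * \<phi> (1 / t))) * sqrt (exp (- (c * n))))"
      using chern[OF r t] c(2)[OF r t n] dist_fn_nonneg[of r t] by (intro real_sqrt_le_mono mult_mono) auto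
    also have "\<dots> = exp ((1 - r * \<phi> (1 / t)) / 2 / 2) * exp (- (c * n) / 2 / 2)"
      by (simp only: real_sqrt_mult sqrt_exp)
    also have "\<dots> \<le> exp (1 - r * \<phi> (1 / t) / 4) * exp (- (c * n) / 2 / 2)"
      by (intro mult_right_mono) (auto simp: field_simps)
    finally have "pbar r t \<le> C * (r * \<phi> (1 / t) / t) * (exp (1 - r * \<phi> (1 / t) / 4) * exp (- (c * n) / 2 / 2))"
      by (intro order_trans[OF C(2)[OF r t]] mult_left_mono p r t)
    moreover have "- (c * n) / 2 / 2 = - (c / 4 * n)"
      by simp
    ultimately show "pbar r t \<le> C * exp 1 * (r * \<phi> (1 / t) / t) * exp (- (r * \<phi> (1 / t) / 4)) * exp (- (c / 4 * n))"
      by (simp only: exp_one_minus mult_ac)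
  qed
qed

lemma pbar_lower_exp:
  obtains c L where "0 < c" "0 < L"
    "\<And>r t n. 0 < r \<Longrightarrow> 0 < t \<Longrightarrow> 0 < n \<Longrightarrow> r \<le> 2 * n / \<phi> (n / t) \<Longrightarrow>
      c * (r * \<phi> (1 / t) / t) * exp (- (L * n)) \<le> pbar r t"
proof -
  obtain c where c: "0 < c" "\<And>r t. 0 < r \<Longrightarrow> 0 < t \<Longrightarrow> c * (r * \<phi> (1 / t) / t) * dist_fn r t \<le> pbar r t"
    by (rule pbar_lower) blast
  obtain L where L: "0 < L"
    "\<And>r t n. 0 < r \<Longrightarrow> 0 < t \<Longrightarrow> 0 < n \<Longrightarrow> r \<le> 2 * n / \<phi> (n / t) \<Longrightarrow> exp (- (L * n)) / 2 \<le> dist_fn r t"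
    by (rule dist_fn_lower) blast
  show ?thesis
  proof (rule that[of "c / 2" L])
    fix r t n :: real
    assume *: "0 < r" "0 < t" "0 < n" "r \<le> 2 * n / \<phi> (n / t)"
    have "c * (r * \<phi> (1 / t) / t) * (exp (- (L * n)) / 2) \<le> c * (r * \<phi> (1 / t) / t) * dist_fn r t"
      using * c phi_nonneg[of "1 / t"] by (intro mult_left_mono L) auto
    also have "\<dots> \<le> pbar r t"
      using * by (intro c)
    finally show "c / 2 * (r * \<phi> (1 / t) / t) * exp (- (L * n)) \<le> pbar r t"
      by simp
  qed (use c L in auto)
qed
end

lemma powr_le_imp_le_powr_inverse:
  fixes k p A :: real
  assumes "0 < k" "0 < p" "k powr p \<le> A"
  shows "k \<le> A powr (1 / p)"
proof -
  have "k = (k powr p) powr (1 / p)"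
    using assms by (simp add: powr_powr)
  also have "\<dots> \<le> A powr (1 / p)"
    using assms by (intro powr_mono2) auto
  finally show ?thesis .
qed

section \<open>The scale function and its inverse\<close>

locale scale_function =
  fixes \<Phi> :: "real \<Rightarrow> real" and a3 a4 \<alpha>1 \<alpha>2 :: real
  assumes Phi: "strict_mono_on {0..} \<Phi>" "\<Phi> 0 = 0"
    and a34: "0 < a3" "0 < a4" and alpha: "1 < \<alpha>1" "\<alpha>1 \<le> \<alpha>2"
    and Phi_scaling: "\<And>r R. 0 < r \<Longrightarrow> r \<le> R \<Longrightarrow>
        a3 * (R / r) powr \<alpha>1 \<le> \<Phi> R / \<Phi> r \<and> \<Phi> R / \<Phi> r \<le> a4 * (R / r) powr \<alpha>2"
begin

lemma Phi_pos: "0 < r \<Longrightarrow> 0 < \<Phi> r"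
  using strict_mono_onD[OF Phi(1), of 0 r] Phi(2) by simp

lemma Phi_less: "0 \<le> r \<Longrightarrow> r < R \<Longrightarrow> \<Phi> r < \<Phi> R"
  using strict_mono_onD[OF Phi(1), of r R] by simp

lemma Phi_ge: "0 < r \<Longrightarrow> 1 \<le> k \<Longrightarrow> a3 * k powr \<alpha>1 * \<Phi> r \<le> \<Phi> (k * r)"
  using Phi_scaling[of r "k * r"] Phi_pos[of r] by (simp add: field_simps)

lemma Phi_le: "0 < r \<Longrightarrow> 1 \<le> k \<Longrightarrow> \<Phi> (k * r) \<le> a4 * k powr \<alpha>2 * \<Phi> r"
  using Phi_scaling[of r "k * r"] Phi_pos[of r] by (simp add: field_simps)

lemma Phi_div_le: "0 < r \<Longrightarrow> 1 \<le> k \<Longrightarrow> a3 * k powr \<alpha>1 * \<Phi> (r / k) \<le> \<Phi> r"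
  using Phi_ge[of "r / k" k] by simp

lemma Phi_div_ge: "0 < r \<Longrightarrow> 1 \<le> k \<Longrightarrow> \<Phi> r \<le> a4 * k powr \<alpha>2 * \<Phi> (r / k)"
  using Phi_le[of "r / k" k] by simp

lemma a3_le_1: "a3 \<le> 1"
  using Phi_ge[of 1 1] Phi_pos[of 1] by simp

lemma Phi_unbounded: "\<exists>s\<ge>0. t < \<Phi> s"
proof -
  define k where "k = max 1 ((\<bar>t\<bar> + 1) / (a3 * \<Phi> 1))"
  have k: "1 \<le> k"
    by (simp add: k_def)
  have "t < a3 * \<Phi> 1 * ((\<bar>t\<bar> + 1) / (a3 * \<Phi> 1))"
    using a34 Phi_pos[of 1] by simp
  also have "\<dots> \<le> a3 * \<Phi> 1 * k"
    using a34 Phi_pos[of 1] by (intro mult_left_mono) (auto simp: k_def)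
  also have "\<dots> \<le> a3 * \<Phi> 1 * k powr \<alpha>1"
    using a34 Phi_pos[of 1] powr_mono[of 1 \<alpha>1 k] alpha k by (intro mult_left_mono) auto
  also have "\<dots> \<le> \<Phi> k"
    using Phi_ge[of 1 k] k by (simp add: mult_ac)
  finally show ?thesis
    using k by (intro exI[of _ k]) auto
qed

lemma right_inv_le: "0 \<le> s \<Longrightarrow> t < \<Phi> s \<Longrightarrow> right_inv \<Phi> t \<le> s"
  unfolding right_inv_def by (rule cInf_lower) (auto intro: bdd_belowI[of _ 0])

lemma le_right_inv: "(\<And>s. 0 \<le> s \<Longrightarrow> t < \<Phi> s \<Longrightarrow> u \<le> s) \<Longrightarrow> u \<le> right_inv \<Phi> t"
  unfolding right_inv_def using Phi_unbounded by (intro cInf_greatest) auto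

lemma right_inv_nonneg: "0 \<le> right_inv \<Phi> t"
  by (rule le_right_inv)

lemma less_Phi: "right_inv \<Phi> t < s \<Longrightarrow> t < \<Phi> s"
  using le_right_inv[of t s] Phi_less right_inv_nonneg[of t]
  by (metis dual_order.strict_trans less_le_not_le linorder_le_less_linear order_trans)

lemma right_inv_mono: "t \<le> t' \<Longrightarrow> right_inv \<Phi> t \<le> right_inv \<Phi> t'"
  by (rule le_right_inv) (auto intro: right_inv_le)

text \<open>The scaling forces \<open>\<Phi>\<close> to tend to 0 at 0, so \<open>\<Phi>\<close> is
  still at most \<open>t\<close> at some positive point \<open>1 / k\<close>.\<close>

lemma right_inv_pos:
  assumes "0 < t"
  shows "0 < right_inv \<Phi> t"
proof -
  define k where "k = max 1 (\<Phi> 1 / (a3 * t))"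
  have k: "1 \<le> k" "0 < k"
    by (auto simp: k_def)
  have "a3 * k powr \<alpha>1 * \<Phi> (1 / k) \<le> \<Phi> 1"
    using k by (intro Phi_div_le) auto
  moreover have "a3 * k * \<Phi> (1 / k) \<le> a3 * k powr \<alpha>1 * \<Phi> (1 / k)"
    using a34 k Phi_pos[of "1 / k"] powr_mono[of 1 \<alpha>1 k] alpha by (intro mult_right_mono mult_left_mono) auto
  moreover have "\<Phi> 1 \<le> a3 * k * t"
    using a34 assms by (simp add: k_def max_def field_simps)
  ultimately have "a3 * k * \<Phi> (1 / k) \<le> a3 * k * t"
    by linarith
  then have "\<Phi> (1 / k) \<le> t"
    using a34 k by simp
  then have "1 / k \<le> right_inv \<Phi> t"
    using Phi_less k by (intro le_right_inv) (metis linorder_not_less order_trans not_less_iff_gr_or_eq)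
  then show ?thesis
    using k by (meson divide_pos_pos less_le_trans zero_less_one)
qed

lemma right_inv_scale:
  assumes "0 < t" "1 \<le> k"
  shows "right_inv \<Phi> (k * t) \<le> 2 * (k / a3) powr (1 / \<alpha>1) * right_inv \<Phi> t"
proof -
  define K where "K = (k / a3) powr (1 / \<alpha>1)"
  \<comment> \<open>The factor 2 moves strictly beyond the infimum, where
    \<open>t < \<Phi> s\<close> is guaranteed.\<close>
  define s where "s = 2 * right_inv \<Phi> t"
  have s: "0 < s" "t < \<Phi> s"
    using right_inv_pos[OF assms(1)] by (auto simp: s_def intro: less_Phi)
  have "1 \<le> k / a3"
    using a3_le_1 a34 assms by simp
  then have K: "1 \<le> K"
    unfolding K_def using alpha by (intro ge_one_powr_ge_zero) auto
  have "a3 * K powr \<alpha>1 = k"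
    using a34 assms alpha by (simp add: K_def powr_powr)
  then have "k * t < a3 * K powr \<alpha>1 * \<Phi> s"
    using s assms by simp
  also have "\<dots> \<le> \<Phi> (K * s)"
    using s K by (intro Phi_ge) auto
  finally have "right_inv \<Phi> (k * t) \<le> K * s"
    using s K by (intro right_inv_le) auto
  then show ?thesis
    by (simp add: s_def K_def mult_ac)
qed

end

section \<open>The exponent m of the heat kernel\<close>

lemma (in scale_function) m_function_bounds:
  assumes "m_function \<Phi> m"
  shows "\<exists>b1 b2. 0 < b1 \<and> 0 < b2 \<and>
    (\<forall>t>0. \<forall>r>0. b1 * \<Phi> (r / m t r) \<le> t / m t r \<and> t / m t r \<le> b2 * \<Phi> (r / m t r))"
  using assms unfolding m_function_def comparable_on_def by fastforce

text \<open>For \<open>k = m t r > 1\<close> the defining relation and the scaling give k^(\<alpha>1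
  - 1) \<le> b2 / a3 when \<open>\<Phi> r \<le> t\<close>; here \<alpha>1 > 1 is decisive. At
  \<open>r = 0\<close> the convention \<open>m t 0 = 0\<close> applies.\<close>

lemma (in scale_function) m_bounded:
  assumes m: "m_function \<Phi> m"
  obtains C where "0 < C" "\<And>t r. 0 < t \<Longrightarrow> 0 \<le> r \<Longrightarrow> \<Phi> r \<le> t \<Longrightarrow> m t r \<le> C"
proof -
  obtain b1 b2 where b: "0 < b1" "0 < b2"
    "\<And>t r. 0 < t \<Longrightarrow> 0 < r \<Longrightarrow> b1 * \<Phi> (r / m t r) \<le> t / m t r"
    "\<And>t r. 0 < t \<Longrightarrow> 0 < r \<Longrightarrow> t / m t r \<le> b2 * \<Phi> (r / m t r)"
    using m_function_bounds[OF m] by auto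
  define C where "C = max 1 ((b2 / a3) powr (1 / (\<alpha>1 - 1)))"
  have "m t r \<le> C" if t: "0 < t" and r: "0 \<le> r" "\<Phi> r \<le> t" for t r
  proof (cases "r = 0 \<or> m t r \<le> 1")
    case True
    then show ?thesis
      using m t by (auto simp: m_function_def C_def)
  next
    case False
    define k where "k = m t r"
    have r0: "0 < r" and k: "1 < k"
      using False r by (auto simp: k_def)
    have "a3 * k powr \<alpha>1 * (t / k) \<le> a3 * k powr \<alpha>1 * (b2 * \<Phi> (r / k))"
      using b(4)[OF t r0] a34 by (intro mult_left_mono) (auto simp: k_def)
    also have "\<dots> \<le> b2 * \<Phi> r"
      using mult_left_mono[OF Phi_div_le[OF r0, of k], of b2] k b by (simp add: mult_ac)
    also have "\<dots> \<le> b2 * t"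
      using r b by (intro mult_left_mono) auto
    finally have "k powr (\<alpha>1 - 1) \<le> b2 / a3"
      using t k a34 by (simp add: powr_diff field_simps)
    then have "k \<le> (b2 / a3) powr (1 / (\<alpha>1 - 1))"
      using k alpha by (intro powr_le_imp_le_powr_inverse) auto
    then show ?thesis
      by (simp add: k_def C_def)
  qed
  then show ?thesis
    using that[of C] by (simp add: C_def)
qed

text \<open>Polynomial control in the other direction: it lets an exponential in \<open>m\<close>
  beat any power of \<open>\<Phi> r / t\<close>, such as the one from volume doubling.\<close>

lemma (in scale_function) Phi_div_le_m:
  assumes m: "m_function \<Phi> m"
  obtains C where "0 < C" "\<And>t r. 0 < t \<Longrightarrow> 0 < r \<Longrightarrow> \<Phi> r / t \<le> C * (1 + m t r) powr \<alpha>2"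
proof -
  obtain b1 b2 where b: "0 < b1" "0 < b2"
    "\<And>t r. 0 < t \<Longrightarrow> 0 < r \<Longrightarrow> b1 * \<Phi> (r / m t r) \<le> t / m t r"
    "\<And>t r. 0 < t \<Longrightarrow> 0 < r \<Longrightarrow> t / m t r \<le> b2 * \<Phi> (r / m t r)"
    using m_function_bounds[OF m] by auto
  define C where "C = max (a4 / b1) (1 / (b1 * a3))"
  have C: "0 < C"
    using a34 b by (simp add: C_def less_max_iff_disj)
  have "\<Phi> r / t \<le> C * (1 + m t r) powr \<alpha>2" if t: "0 < t" and r: "0 < r" for t r
  proof -
    define k where "k = m t r"
    have k: "0 < k"
      using m t r by (simp add: k_def m_function_def)
    have bk: "b1 * \<Phi> (r / k) \<le> t / k"
      using b(3)[OF t r] by (simp add: k_def)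
    show ?thesis
    proof (cases "1 \<le> k")
      case True
      have "b1 * \<Phi> r \<le> a4 * k powr \<alpha>2 * (b1 * \<Phi> (r / k))"
        using mult_left_mono[OF Phi_div_ge[OF r True], of b1] b by (simp add: mult_ac)
      also have "\<dots> \<le> a4 * k powr \<alpha>2 * (t / k)"
        using a34 by (intro mult_left_mono bk) auto
      also have "\<dots> \<le> a4 * k powr \<alpha>2 * t"
        using a34 t True by (intro mult_left_mono) (auto simp: field_simps)
      finally have "\<Phi> r / t \<le> a4 / b1 * k powr \<alpha>2"
        using t b by (simp add: field_simps)
      also have "\<dots> \<le> C * (1 + k) powr \<alpha>2"
        using C alpha k a34 b by (intro mult_mono powr_mono2) (auto simp: C_def)
      finally show ?thesis
        by (simp add: k_def)
    next
      case False
      have "a3 * (1 / k) powr \<alpha>1 * \<Phi> r \<le> \<Phi> (1 / k * r)"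
        using False k r by (intro Phi_ge) auto
      moreover have "a3 * (1 / k) * \<Phi> r \<le> a3 * (1 / k) powr \<alpha>1 * \<Phi> r"
        using powr_mono[of 1 \<alpha>1 "1 / k"] a34 alpha False k Phi_pos[OF r]
        by (intro mult_right_mono mult_left_mono) auto
      ultimately have "b1 * (a3 * (1 / k) * \<Phi> r) \<le> b1 * \<Phi> (r / k)"
        using b by (intro mult_left_mono) auto
      with bk have "b1 * (a3 * (1 / k) * \<Phi> r) \<le> t / k"
        by linarith
      then have "\<Phi> r / t \<le> 1 / (b1 * a3) * 1"
        using t b a34 k by (simp add: field_simps)
      also have "\<dots> \<le> C * (1 + k) powr \<alpha>2"
        using k alpha C a34 b by (intro mult_mono ge_one_powr_ge_zero) (auto simp: C_def)
      finally show ?thesis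
        by (simp add: k_def)
    qed
  qed
  then show ?thesis
    using that C by blast
qed

text \<open>At time \<open>n * T\<close> the value \<open>n\<close> itself solves the relation that
  determines \<open>m\<close>, up to constants, and since \<alpha>1 > 1 two such solutions have
  bounded ratio. With \<open>T = 1 / \<phi> (n / t)\<close> this identifies the heat kernel exponent
  at the balancing time.\<close>

lemma (in scale_function) m_comparable:
  assumes m: "m_function \<Phi> m" and e: "0 < e1" "0 < e2"
  obtains c C where "0 < c" "0 < C"
    "\<And>n T r. 0 < n \<Longrightarrow> 0 < T \<Longrightarrow> 0 < r \<Longrightarrow> e1 * \<Phi> (r / n) \<le> T \<Longrightarrow> T \<le> e2 * \<Phi> (r / n) \<Longrightarrow>
      c * n \<le> m (n * T) r \<and> m (n * T) r \<le> C * n"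
proof -
  obtain b1 b2 where b: "0 < b1" "0 < b2"
    "\<And>t r. 0 < t \<Longrightarrow> 0 < r \<Longrightarrow> b1 * \<Phi> (r / m t r) \<le> t / m t r"
    "\<And>t r. 0 < t \<Longrightarrow> 0 < r \<Longrightarrow> t / m t r \<le> b2 * \<Phi> (r / m t r)"
    using m_function_bounds[OF m] by auto
  define K1 where "K1 = max 1 ((e2 / (a3 * b1)) powr (1 / (\<alpha>1 - 1)))"
  define K2 where "K2 = max 1 ((b2 / (e1 * a3)) powr (1 / (\<alpha>1 - 1)))"
  have K: "1 \<le> K1" "1 \<le> K2"
    by (auto simp: K1_def K2_def)
  have "n \<le> K1 * m (n * T) r \<and> m (n * T) r \<le> K2 * n"
    if n: "0 < n" and T: "0 < T" and r: "0 < r" and le: "e1 * \<Phi> (r / n) \<le> T" "T \<le> e2 * \<Phi> (r / n)" for n T r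
  proof -
    define u where "u = m (n * T) r"
    have u: "0 < u"
      using m n T r by (simp add: u_def m_function_def)
    have bu: "b1 * \<Phi> (r / u) \<le> n * T / u" "n * T / u \<le> b2 * \<Phi> (r / u)"
      using b(3,4)[of "n * T" r] n T r by (auto simp: u_def)
    have "n \<le> K1 * u"
    proof (cases "n \<le> u")
      case True
      also have "u \<le> K1 * u"
        using K u by simp
      finally show ?thesis .
    next
      case False
      define k where "k = n / u"
      have k: "1 \<le> k"
        using False u by (simp add: k_def)
      have "a3 * k powr \<alpha>1 * \<Phi> (r / n) \<le> \<Phi> (k * (r / n))"
        using k r n by (intro Phi_ge) auto
      also have "k * (r / n) = r / u"
        using n by (simp add: k_def)
      finally have "b1 * (a3 * k powr \<alpha>1 * \<Phi> (r / n)) \<le> b1 * \<Phi> (r / u)"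
        using b by (intro mult_left_mono) auto
      also have "\<dots> \<le> k * T"
        using bu by (simp add: k_def)
      also have "\<dots> \<le> k * (e2 * \<Phi> (r / n))"
        using le k by (intro mult_left_mono) auto
      finally have "b1 * a3 * k powr \<alpha>1 * \<Phi> (r / n) \<le> k * e2 * \<Phi> (r / n)"
        by (simp add: mult_ac)
      then have "b1 * a3 * k powr \<alpha>1 \<le> k * e2"
        using Phi_pos[of "r / n"] r n by simp
      then have "k powr (\<alpha>1 - 1) \<le> e2 / (a3 * b1)"
        using k a34 b by (simp add: powr_diff field_simps)
      then have "k \<le> (e2 / (a3 * b1)) powr (1 / (\<alpha>1 - 1))"
        using k alpha by (intro powr_le_imp_le_powr_inverse) auto
      then have "k \<le> K1"
        by (simp add: K1_def)
      then show ?thesis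
        using u by (simp add: k_def field_simps)
    qed
    moreover have "u \<le> K2 * n"
    proof (cases "u \<le> n")
      case True
      also have "n \<le> K2 * n"
        using K n by simp
      finally show ?thesis .
    next
      case False
      define k where "k = u / n"
      have k: "1 \<le> k"
        using False n by (simp add: k_def)
      have "a3 * k powr \<alpha>1 * \<Phi> (r / u) \<le> \<Phi> (k * (r / u))"
        using k r u by (intro Phi_ge) auto
      also have "k * (r / u) = r / n"
        using u by (simp add: k_def)
      finally have *: "a3 * k powr \<alpha>1 * \<Phi> (r / u) \<le> \<Phi> (r / n)" .
      have "e1 * (a3 * k powr \<alpha>1) * (T / k) \<le> e1 * (a3 * k powr \<alpha>1) * (b2 * \<Phi> (r / u))"
        using e a34 bu n by (intro mult_left_mono) (auto simp: k_def field_simps)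
      also have "\<dots> = b2 * (e1 * (a3 * k powr \<alpha>1 * \<Phi> (r / u)))"
        by simp
      also have "\<dots> \<le> b2 * (e1 * \<Phi> (r / n))"
        using b e * by (intro mult_left_mono) auto
      also have "\<dots> \<le> b2 * T"
        using b le by (intro mult_left_mono) auto
      finally have "k powr (\<alpha>1 - 1) \<le> b2 / (e1 * a3)"
        using T k e a34 by (simp add: powr_diff field_simps)
      then have "k \<le> (b2 / (e1 * a3)) powr (1 / (\<alpha>1 - 1))"
        using k alpha by (intro powr_le_imp_le_powr_inverse) auto
      then have "k \<le> K2"
        by (simp add: K2_def)
      then show ?thesis
        using n by (simp add: k_def field_simps)
    qed
    ultimately show ?thesis
      by (simp add: u_def)
  qed
  then show ?thesis
    using K by (intro that[of "1 / K1" K2]) (auto simp: field_simps)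
qed

text \<open>A rescaled Gamma integral; it evaluates the mixture over \<open>r\<close> once the
  volume has been frozen.\<close>

lemma nn_integral_mult_exp:
  fixes s :: real
  assumes s: "0 < s"
  shows "(\<integral>\<^sup>+r. ennreal (r * exp (- (r / s))) * indicator {0<..} r \<partial>lborel) = ennreal (s\<^sup>2)"
proof -
  have "(\<integral>\<^sup>+r. ennreal (r * exp (- (r / s))) * indicator {0<..} r \<partial>lborel) =
      ennreal s * (\<integral>\<^sup>+r. ennreal ((s * r) * exp (- r)) * indicator {0<..} (s * r) \<partial>lborel)"
    using s by (subst nn_integral_real_affine[where c=s and t=0]) auto
  also have "(\<integral>\<^sup>+r. ennreal ((s * r) * exp (- r)) * indicator {0<..} (s * r) \<partial>lborel) =
      (\<integral>\<^sup>+r. ennreal s * (ennreal (r ^ 1 * exp (- r)) * indicator {0..} r) \<partial>lborel)"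
    using s by (intro nn_integral_cong) (auto simp: indicator_def ennreal_mult' zero_less_mult_iff mult.assoc)
  also have "\<dots> = ennreal s"
    by (subst nn_integral_cmult) (auto simp: nn_intergal_power_times_exp_Ici[of 1, simplified])
  finally show ?thesis
    using s by (simp add: power2_eq_square ennreal_mult)
qed

section \<open>Estimates of the subordinated kernel\<close>

locale subordinated_heat_kernel =
  subordinator_with_densities M S N \<nu> \<phi> \<beta>1 \<beta>2 k1 k2 pbar + scale_function \<Phi> a3 a4 \<alpha>1 \<alpha>2
  for M :: "'w measure" and S N \<nu> \<phi> \<beta>1 \<beta>2 k1 k2 pbar \<Phi> a3 a4 \<alpha>1 \<alpha>2 +
  fixes \<mu> :: "'a::metric_space measure" and a1 a2 d1 d2 :: real
    and m :: "real \<Rightarrow> real \<Rightarrow> real" and p0 :: "real \<Rightarrow> 'a \<Rightarrow> 'a \<Rightarrow> real" and C1 C2 C3 C4 :: real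
  assumes a12: "0 < a1" "0 < a2" and d12: "0 < d1" "d1 \<le> d2"
    and volume: "\<And>x r R. 0 < r \<Longrightarrow> r \<le> R \<Longrightarrow>
        a1 * (R / r) powr d1 \<le> vol \<mu> x R / vol \<mu> x r \<and> vol \<mu> x R / vol \<mu> x r \<le> a2 * (R / r) powr d2"
    and sets_mu: "sets \<mu> = sets borel"
    and m: "m_function \<Phi> m"
    and C: "0 < C1" "0 < C2" "0 < C3" "0 < C4"
    and p0_bounds: "\<And>t x y. 0 < t \<Longrightarrow>
        C1 / vol \<mu> x (right_inv \<Phi> t) * exp (- (C2 * m t (dist x y))) \<le> p0 t x y \<and>
        p0 t x y \<le> C3 / vol \<mu> x (right_inv \<Phi> t) * exp (- (C4 * m t (dist x y)))"
begin

definition ivol :: "'a \<Rightarrow> real \<Rightarrow> real" where "ivol x r = vol \<mu> x (right_inv \<Phi> r)"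

text \<open>With \<open>R = r\<close> a volume of 0 would give the quotient 0 / 0 = 0 < a1. As
  \<open>measure\<close> is 0 on sets of infinite measure, balls of infinite volume are excluded
  too.\<close>

lemma vol_pos: "0 < r \<Longrightarrow> 0 < vol \<mu> x r"
  using volume[of r r x] a12 by (cases "vol \<mu> x r = 0") (auto simp: vol_def zero_less_measure_iff)

lemma vol_mono: "0 < r \<Longrightarrow> r \<le> R \<Longrightarrow> vol \<mu> x r \<le> vol \<mu> x R"
proof -
  assume r: "0 < r" "r \<le> R"
  have "emeasure \<mu> (ball x R) \<noteq> \<infinity>"
    using vol_pos[of R x] r by (auto simp: vol_def measure_def)
  then show ?thesis
    unfolding vol_def using r by (intro measure_mono_fmeasurable fmeasurableI) (auto simp: sets_mu less_top)
qed

lemma ivol_pos: "0 < r \<Longrightarrow> 0 < ivol x r"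
  by (simp add: ivol_def vol_pos right_inv_pos)

lemma ivol_mono: "0 < r \<Longrightarrow> r \<le> R \<Longrightarrow> ivol x r \<le> ivol x R"
  by (simp add: ivol_def vol_mono right_inv_pos right_inv_mono)

text \<open>Volume growth of order \<open>d2\<close> composed with growth of order
  \<open>1 / \<alpha>1\<close> of the inverse of \<open>\<Phi>\<close>.\<close>

lemma ivol_doubling:
  obtains K D where "0 < K" "0 < D" "\<And>x r k. 0 < r \<Longrightarrow> 1 \<le> k \<Longrightarrow> ivol x (k * r) \<le> K * k powr D * ivol x r"
proof (rule that)
  define K where "K = a2 * (2 * (1 / a3) powr (1 / \<alpha>1)) powr d2"
  show "0 < K" "0 < d2 / \<alpha>1"
    using a12 a34 alpha d12 by (auto simp: K_def)
  fix x r k :: _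
  show "ivol x (k * r) \<le> K * k powr (d2 / \<alpha>1) * ivol x r" if r: "0 < r" and k: "1 \<le> k"
  proof -
    define u where "u = right_inv \<Phi> r"
    define v where "v = right_inv \<Phi> (k * r)"
    have u: "0 < u" and uv: "u \<le> v"
      using r k by (auto simp: u_def v_def intro: right_inv_pos right_inv_mono)
    have "v \<le> 2 * (k / a3) powr (1 / \<alpha>1) * u"
      using right_inv_scale[OF r k] by (simp add: u_def v_def)
    then have "v / u \<le> 2 * (1 / a3) powr (1 / \<alpha>1) * k powr (1 / \<alpha>1)"
      using u k a34 by (simp add: powr_divide field_simps)
    then have "(v / u) powr d2 \<le> (2 * (1 / a3) powr (1 / \<alpha>1) * k powr (1 / \<alpha>1)) powr d2"
      using u uv d12 by (intro powr_mono2) auto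
    also have "\<dots> = (2 * (1 / a3) powr (1 / \<alpha>1)) powr d2 * k powr (d2 / \<alpha>1)"
      using k a34 by (simp add: powr_mult powr_powr)
    finally have "a2 * (v / u) powr d2 \<le> K * k powr (d2 / \<alpha>1)"
      using a12 by (simp add: K_def mult.assoc)
    moreover have "vol \<mu> x v / vol \<mu> x u \<le> a2 * (v / u) powr d2"
      using volume[OF u uv] by auto
    ultimately have "vol \<mu> x v / vol \<mu> x u \<le> K * k powr (d2 / \<alpha>1)"
      by linarith
    then show ?thesis
      using vol_pos[OF u, of x] by (simp add: ivol_def u_def[symmetric] v_def[symmetric] field_simps)
  qed
qed

text \<open>\<open>ivol x\<close> is monotone on the half-line, hence measurable there; the
  indicator removes all other arguments.\<close>

lemma ivol_measurable: "(\<lambda>r. indicator {0<..} r * (r / ivol x r)) \<in> borel_measurable borel"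
proof -
  have "mono_on {0<..} (ivol x)"
    by (intro mono_onI ivol_mono) auto
  then have "ivol x \<in> borel_measurable (restrict_space borel {0<..})"
    by (rule borel_measurable_mono_on_fnc)
  then have "(\<lambda>r. r / ivol x r) \<in> borel_measurable (restrict_space borel {0<..})"
    by (intro borel_measurable_divide) (auto intro: measurable_restrict_space1)
  then show ?thesis
    by (subst (asm) borel_measurable_restrict_space_iff) auto
qed

lemma p0_lower: "0 < r \<Longrightarrow> C1 / ivol x r * exp (- (C2 * m r (dist x y))) \<le> p0 r x y"
  using p0_bounds by (simp add: ivol_def)

lemma p0_upper: "0 < r \<Longrightarrow> p0 r x y \<le> C3 / ivol x r * exp (- (C4 * m r (dist x y)))"
  using p0_bounds by (simp add: ivol_def)

lemma p0_nonneg: "0 < r \<Longrightarrow> 0 \<le> p0 r x y"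
  using p0_lower[of r x y] ivol_pos[of r x] C by (meson divide_pos_pos exp_gt_zero less_imp_le mult_pos_pos order_trans)

lemma m_nonneg: "0 < t \<Longrightarrow> 0 \<le> r \<Longrightarrow> 0 \<le> m t r"
  using m by (cases "r = 0") (auto simp: m_function_def less_imp_le)

lemma m_antimono: "0 < s \<Longrightarrow> s \<le> t \<Longrightarrow> 0 < r \<Longrightarrow> m t r \<le> m s r"
  using m by (auto simp: m_function_def monotone_on_def)

text \<open>For times below \<open>\<Phi> d\<close> the off-diagonal decay compensates the growth of the inverse volume.\<close>

lemma exp_m_div_ivol_le:
  assumes c: "0 < c"
  obtains K where "0 < K"
    "\<And>x r d. 0 < r \<Longrightarrow> 0 < d \<Longrightarrow> r \<le> \<Phi> d \<Longrightarrow> exp (- (c * m r d)) / ivol x r \<le> K / ivol x (\<Phi> d)"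
proof -
  obtain K D where KD: "0 < K" "0 < D"
    "\<And>x r k. 0 < r \<Longrightarrow> 1 \<le> k \<Longrightarrow> ivol x (k * r) \<le> K * k powr D * ivol x r"
    by (rule ivol_doubling) blast
  obtain A where A: "0 < A" "\<And>t r. 0 < t \<Longrightarrow> 0 < r \<Longrightarrow> \<Phi> r / t \<le> A * (1 + m t r) powr \<alpha>2"
    by (rule Phi_div_le_m[OF m]) blast
  obtain B where B: "0 < B" "\<And>y. 0 \<le> y \<Longrightarrow> (1 + y) powr (\<alpha>2 * D) * exp (- (c * y)) \<le> B"
    by (rule powr_mult_exp_minus_bounded[of "\<alpha>2 * D" c]) (use c KD alpha in auto)
  have "exp (- (c * m r d)) / ivol x r \<le> K * A powr D * B / ivol x (\<Phi> d)"
    if r: "0 < r" and d: "0 < d" and rd: "r \<le> \<Phi> d" for x r d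
  proof -
    have "ivol x (\<Phi> d) = ivol x (\<Phi> d / r * r)"
      using r by simp
    also have "\<dots> \<le> K * (\<Phi> d / r) powr D * ivol x r"
      using r rd by (intro KD) auto
    also have "\<dots> \<le> K * (A * (1 + m r d) powr \<alpha>2) powr D * ivol x r"
      using KD A(2)[OF r d] ivol_pos[OF r, of x] r Phi_pos[OF d]
      by (intro mult_right_mono mult_left_mono powr_mono2) auto
    also have "\<dots> = K * A powr D * (1 + m r d) powr (\<alpha>2 * D) * ivol x r"
      using A by (simp add: powr_mult powr_powr)
    finally have "exp (- (c * m r d)) * ivol x (\<Phi> d) \<le>
        exp (- (c * m r d)) * (K * A powr D * (1 + m r d) powr (\<alpha>2 * D) * ivol x r)"
      by (intro mult_left_mono) auto
    also have "\<dots> = K * A powr D * ((1 + m r d) powr (\<alpha>2 * D) * exp (- (c * m r d))) * ivol x r"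
      by simp
    also have "\<dots> \<le> K * A powr D * B * ivol x r"
      using KD A ivol_pos[OF r, of x] m_nonneg[OF r, of d] d
      by (intro mult_right_mono mult_left_mono B) auto
    finally show ?thesis
      using ivol_pos[OF r, of x] ivol_pos[OF Phi_pos[OF d], of x] by (simp add: field_simps)
  qed
  then show ?thesis
    using that[of "K * A powr D * B"] KD A B by simp
qed

section \<open>The near-diagonal estimate\<close>

abbreviation q :: "real \<Rightarrow> 'a \<Rightarrow> 'a \<Rightarrow> ennreal" where "q \<equiv> subordinate_kernel p0 pbar"

abbreviation near_diagonal :: "real \<Rightarrow> 'a \<Rightarrow> 'a \<Rightarrow> ennreal" where
  "near_diagonal t x y \<equiv> (\<integral>\<^sup>+r\<in>{\<Phi> (dist x y)..2 / \<phi> (1 / t)}. ennreal (r / ivol x r) \<partial>lborel)"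

lemma Phi_nonneg: "0 \<le> d \<Longrightarrow> 0 \<le> \<Phi> d"
  using Phi_pos[of d] Phi(2) by (cases "d = 0") auto

text \<open>The indicator changes nothing: the range contains no negative time, and at
  \<open>r = 0\<close> the integrand vanishes. This form has a measurable integrand.\<close>

lemma near_diagonal_eq:
  "near_diagonal t x y = (\<integral>\<^sup>+r. ennreal (indicator {0<..} r * (r / ivol x r)) * indicator {\<Phi> (dist x y)..2 / \<phi> (1 / t)} r \<partial>lborel)"
proof (rule nn_integral_cong)
  fix r :: real
  consider "r < 0" | "r = 0" | "0 < r"
    by linarith
  then show "ennreal (r / ivol x r) * indicator {\<Phi> (dist x y)..2 / \<phi> (1 / t)} r =
      ennreal (indicator {0<..} r * (r / ivol x r)) * indicator {\<Phi> (dist x y)..2 / \<phi> (1 / t)} r"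
    by cases (use Phi_nonneg[of "dist x y"] in \<open>auto simp: indicator_def\<close>)
qed

text \<open>The part of the integral over [u, 2u] is already this large. The upper limit 2 /
  \<phi>(1/t), rather than 1 / \<phi>(1/t), makes room for this window up to u = 1 /
  \<phi>(1/t).\<close>

lemma near_diagonal_ge:
  assumes "0 < u" "\<Phi> (dist x y) \<le> u" "2 * u \<le> 2 / \<phi> (1 / t)"
  shows "ennreal (u\<^sup>2 / ivol x (2 * u)) \<le> near_diagonal t x y"
proof -
  have "ennreal (u\<^sup>2 / ivol x (2 * u)) = (\<integral>\<^sup>+r\<in>{u..2 * u}. ennreal (u / ivol x (2 * u)) \<partial>lborel)"
    using assms ivol_pos[of "2 * u" x]
    by (subst nn_integral_cmult_indicator) (auto simp: power2_eq_square simp flip: ennreal_mult)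
  also have "\<dots> \<le> near_diagonal t x y"
    using assms ivol_pos ivol_mono
    by (intro nn_integral_mono) (auto simp: indicator_def intro!: ennreal_leI frac_le)
  finally show ?thesis .
qed

text \<open>With s = 1 / \<phi>(1/t), times in [\<Phi> d, 2 s] give the claimed integral. Shorter
  times are controlled by the heat kernel decay, longer ones by the decay of the density, and
  \<open>near_diagonal_ge\<close> with u = \<Phi> d and u = s absorbs these two
  contributions.\<close>

lemma near_diagonal_upper:
  obtains K where "0 < K"
    "\<And>t x y. 0 < t \<Longrightarrow> \<Phi> (dist x y) * \<phi> (1 / t) \<le> 1 \<Longrightarrow>
      q t x y \<le> ennreal K * (ennreal (\<phi> (1 / t) / t) * near_diagonal t x y)"
proof -
  obtain K D where KD: "0 < K" "0 < D"
    "\<And>x r k. 0 < r \<Longrightarrow> 1 \<le> k \<Longrightarrow> ivol x (k * r) \<le> K * k powr D * ivol x r"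
    by (rule ivol_doubling) blast
  obtain E where E: "0 < E"
    "\<And>x r d. 0 < r \<Longrightarrow> 0 < d \<Longrightarrow> r \<le> \<Phi> d \<Longrightarrow> exp (- (C4 * m r d)) / ivol x r \<le> E / ivol x (\<Phi> d)"
    by (rule exp_m_div_ivol_le[OF C(4)]) blast
  obtain G where G: "0 < G"
    "\<And>r t. 0 < r \<Longrightarrow> 0 < t \<Longrightarrow> pbar r t \<le> G * (r * \<phi> (1 / t) / t) * exp (- (r * \<phi> (1 / t) / 4))"
    by (rule pbar_upper_exp) blast
  \<comment> \<open>17 = 1 + 16: the middle range, and the long times through (4 s)^2; the last
    summand is for times below \<Phi> d, with one doubling from \<Phi> d to 2 \<Phi> d.\<close>
  define H where "H = C3 * G * (17 + E * (K * 2 powr D))"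
  have "q t x y \<le> ennreal H * (ennreal (\<phi> (1 / t) / t) * near_diagonal t x y)"
    if t: "0 < t" and near: "\<Phi> (dist x y) * \<phi> (1 / t) \<le> 1" for t x y
  proof -
    define d where "d = dist x y"
    define s where "s = 1 / \<phi> (1 / t)"
    define A where "A = C3 * G * (\<phi> (1 / t) / t)"
    define I where "I = near_diagonal t x y"
    have phi_t: "0 < \<phi> (1 / t)"
      using t phi_pos by simp
    have s: "0 < s" "\<Phi> d \<le> s"
      using phi_t near by (auto simp: s_def d_def field_simps)
    have A: "0 < A"
      using C G phi_t t by (simp add: A_def)
    have Phi_d: "0 \<le> \<Phi> d"
      by (simp add: Phi_nonneg d_def)
    have d: "0 < d" if "0 < \<Phi> d"
      using that Phi(2) by (auto simp: d_def intro: ccontr)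
    have pb: "pbar r t \<le> G * (\<phi> (1 / t) / t) * (r * exp (- (r / (4 * s))))" if "0 < r" for r
      using G(2)[OF that t] by (simp add: s_def mult_ac)
    have pb': "pbar r t \<le> G * (\<phi> (1 / t) / t) * r" if "0 < r" for r
      using pb[OF that] mult_left_mono[of "r * exp (- (r / (4 * s)))" r "G * (\<phi> (1 / t) / t)"] that s G phi_t t
      by (simp add: mult_left_le)
    have p0W: "p0 r x y \<le> C3 / ivol x r" if "0 < r" for r
      using p0_upper[OF that, of x y] mult_left_mono[of "exp (- (C4 * m r (dist x y)))" 1 "C3 / ivol x r"]
        C ivol_pos[OF that, of x] m_nonneg[OF that, of "dist x y"] by simp
    let ?f1 = "\<lambda>r. ennreal A * (ennreal (indicator {0<..} r * (r / ivol x r)) * indicator {\<Phi> d..2 * s} r)"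
    let ?f2 = "\<lambda>r. ennreal (A / ivol x (2 * s)) * (ennreal (r * exp (- (r / (4 * s)))) * indicator {0<..} r)"
    let ?f3 = "\<lambda>r. ennreal (A * E * \<Phi> d / ivol x (\<Phi> d)) * indicator {0..\<Phi> d} r"
    have "ennreal (p0 r x y * pbar r t) * indicator {0<..} r \<le> ?f1 r + ?f2 r + ?f3 r" for r
    proof (cases "0 < r")
      case False
      then show ?thesis by (simp add: indicator_def)
    next
      case r: True
      consider "r < \<Phi> d" | "\<Phi> d \<le> r" "r \<le> 2 * s" | "2 * s < r"
        by linarith
      then show ?thesis
      proof cases
        case 1
        then have d0: "0 < d"
          using r d by simp
        have "p0 r x y \<le> C3 * (exp (- (C4 * m r d)) / ivol x r)"
          using p0_upper[OF r, of x y] by (simp add: d_def)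
        also have "\<dots> \<le> C3 * (E / ivol x (\<Phi> d))"
          using C E(2)[OF r d0, of x] 1 by (intro mult_left_mono) auto
        finally have "p0 r x y * pbar r t \<le> C3 * (E / ivol x (\<Phi> d)) * (G * (\<phi> (1 / t) / t) * r)"
          using p0_nonneg[OF r] pbar_nonneg[OF r t] pb'[OF r] C E ivol_pos[OF Phi_pos[OF d0], of x]
          by (intro mult_mono) auto
        also have "\<dots> \<le> C3 * (E / ivol x (\<Phi> d)) * (G * (\<phi> (1 / t) / t) * \<Phi> d)"
          using 1 C E G phi_t t ivol_pos[OF Phi_pos[OF d0], of x] by (intro mult_left_mono) auto
        also have "\<dots> = A * E * \<Phi> d / ivol x (\<Phi> d)"
          by (simp add: A_def mult_ac)
        finally have "ennreal (p0 r x y * pbar r t) * indicator {0<..} r \<le> ?f3 r"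
          using 1 r by (simp add: ennreal_leI)
        also have "\<dots> \<le> ?f1 r + ?f2 r + ?f3 r"
          by simp
        finally show ?thesis .
      next
        case 2
        have "p0 r x y * pbar r t \<le> C3 / ivol x r * (G * (\<phi> (1 / t) / t) * r)"
          using p0_nonneg[OF r] pbar_nonneg[OF r t] pb'[OF r] C p0W[OF r] ivol_pos[OF r, of x]
          by (intro mult_mono) auto
        also have "\<dots> = A * (r / ivol x r)"
          by (simp add: A_def mult_ac)
        finally have "ennreal (p0 r x y * pbar r t) * indicator {0<..} r \<le> ?f1 r"
          using 2 r A ivol_pos[OF r, of x] by (simp add: ennreal_leI flip: ennreal_mult)
        also have "\<dots> \<le> ?f1 r + ?f2 r + ?f3 r"
          by (simp add: add.assoc)
        finally show ?thesis .
      next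
        case 3
        have "p0 r x y \<le> C3 / ivol x (2 * s)"
          using p0W[OF r] frac_le[of C3 C3 "ivol x (2 * s)" "ivol x r"] C ivol_pos[of "2 * s" x] ivol_mono[of "2 * s" r x] s 3
          by simp
        then have "p0 r x y * pbar r t \<le> C3 / ivol x (2 * s) * (G * (\<phi> (1 / t) / t) * (r * exp (- (r / (4 * s)))))"
          using p0_nonneg[OF r] pbar_nonneg[OF r t] pb[OF r] C ivol_pos[of "2 * s" x] s
          by (intro mult_mono) auto
        also have "\<dots> = A / ivol x (2 * s) * (r * exp (- (r / (4 * s))))"
          by (simp add: A_def mult_ac)
        finally have "ennreal (p0 r x y * pbar r t) * indicator {0<..} r \<le> ?f2 r"
          using r A ivol_pos[of "2 * s" x] s by (simp add: ennreal_leI flip: ennreal_mult)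
        also have "\<dots> \<le> ?f1 r + ?f2 r + ?f3 r"
          by (simp add: add.commute add.left_commute)
        finally show ?thesis .
      qed
    qed
    then have "q t x y \<le> (\<integral>\<^sup>+r. ?f1 r + ?f2 r + ?f3 r \<partial>lborel)"
      unfolding subordinate_kernel_def by (intro nn_integral_mono) auto
    also have "\<dots> = (\<integral>\<^sup>+r. ?f1 r \<partial>lborel) + (\<integral>\<^sup>+r. ?f2 r \<partial>lborel) + (\<integral>\<^sup>+r. ?f3 r \<partial>lborel)"
      using ivol_measurable[of x] by (subst nn_integral_add, measurable, subst nn_integral_add, measurable)
    also have "(\<integral>\<^sup>+r. ?f1 r \<partial>lborel) = ennreal A * I"
      using ivol_measurable[of x] by (subst nn_integral_cmult, measurable) (simp add: I_def near_diagonal_eq s_def d_def)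
    also have "(\<integral>\<^sup>+r. ?f2 r \<partial>lborel) = ennreal (A / ivol x (2 * s)) * ennreal ((4 * s)\<^sup>2)"
      using nn_integral_mult_exp[of "4 * s"] s by (subst nn_integral_cmult) auto
    also have "(\<integral>\<^sup>+r. ?f3 r \<partial>lborel) = ennreal (A * E * \<Phi> d / ivol x (\<Phi> d)) * ennreal (\<Phi> d)"
      using Phi_d by (subst nn_integral_cmult_indicator) auto
    also have "ennreal (A / ivol x (2 * s)) * ennreal ((4 * s)\<^sup>2) = ennreal (16 * A) * ennreal (s\<^sup>2 / ivol x (2 * s))"
      using A s ivol_pos[of "2 * s" x] by (simp add: power2_eq_square flip: ennreal_mult)
    also have "\<dots> \<le> ennreal (16 * A) * I"
      unfolding I_def using s by (intro mult_left_mono near_diagonal_ge) (auto simp: d_def s_def)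
    also have "ennreal (A * E * \<Phi> d / ivol x (\<Phi> d)) * ennreal (\<Phi> d) \<le> ennreal (A * E * (K * 2 powr D)) * I"
    proof (cases "\<Phi> d = 0")
      case False
      then have Pd: "0 < \<Phi> d"
        using Phi_d by simp
      have "ivol x (2 * \<Phi> d) \<le> K * 2 powr D * ivol x (\<Phi> d)"
        using Pd by (intro KD) auto
      then have "1 / ivol x (\<Phi> d) \<le> K * 2 powr D / ivol x (2 * \<Phi> d)"
        using ivol_pos[OF Pd, of x] ivol_pos[of "2 * \<Phi> d" x] Pd by (simp add: field_simps)
      then have "A * E * (\<Phi> d)\<^sup>2 * (1 / ivol x (\<Phi> d)) \<le> A * E * (\<Phi> d)\<^sup>2 * (K * 2 powr D / ivol x (2 * \<Phi> d))"
        using A E by (intro mult_left_mono) auto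
      then have "A * E * \<Phi> d / ivol x (\<Phi> d) * \<Phi> d \<le> A * E * (K * 2 powr D) * ((\<Phi> d)\<^sup>2 / ivol x (2 * \<Phi> d))"
        by (simp add: power2_eq_square mult_ac)
      then have "ennreal (A * E * \<Phi> d / ivol x (\<Phi> d)) * ennreal (\<Phi> d) \<le>
          ennreal (A * E * (K * 2 powr D)) * ennreal ((\<Phi> d)\<^sup>2 / ivol x (2 * \<Phi> d))"
        using A E KD Pd ivol_pos[OF Pd, of x] ivol_pos[of "2 * \<Phi> d" x] by (simp add: ennreal_leI flip: ennreal_mult)
      also have "\<dots> \<le> ennreal (A * E * (K * 2 powr D)) * I"
        unfolding I_def using s Pd by (intro mult_left_mono near_diagonal_ge) (auto simp: d_def s_def)
      finally show ?thesis .
    qed simp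
    finally have "q t x y \<le> ennreal A * I + ennreal (16 * A) * I + ennreal (A * E * (K * 2 powr D)) * I"
      by (simp add: add_left_mono add_right_mono add_mono)
    also have "\<dots> = ennreal (A + 16 * A + A * E * (K * 2 powr D)) * I"
      using A E KD by (subst ennreal_plus, simp, simp, subst ennreal_plus, simp, simp) (simp only: distrib_right)
    also have "A + 16 * A + A * E * (K * 2 powr D) = H * (\<phi> (1 / t) / t)"
      by (simp add: A_def H_def algebra_simps)
    also have "ennreal (H * (\<phi> (1 / t) / t)) = ennreal H * ennreal (\<phi> (1 / t) / t)"
      using C G E KD phi_t t by (intro ennreal_mult) (auto simp: H_def)
    finally show ?thesis
      by (simp add: I_def mult.assoc)
  qed
  moreover have "0 < H"
    using C G E KD by (simp add: H_def add_pos_pos)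
  ultimately show ?thesis
    using that by blast
qed

text \<open>On the range of integration neither exponential matters: \<open>m\<close> is bounded
  because \<Phi> d \<le> r, and the density bound with \<open>n = 1\<close> is valid exactly up to 2
  / \<phi>(1/t).\<close>

lemma near_diagonal_lower:
  obtains K where "0 < K"
    "\<And>t x y. 0 < t \<Longrightarrow> \<Phi> (dist x y) * \<phi> (1 / t) \<le> 1 \<Longrightarrow>
      ennreal K * (ennreal (\<phi> (1 / t) / t) * near_diagonal t x y) \<le> q t x y"
proof -
  obtain B where B: "0 < B" "\<And>t r. 0 < t \<Longrightarrow> 0 \<le> r \<Longrightarrow> \<Phi> r \<le> t \<Longrightarrow> m t r \<le> B"
    by (rule m_bounded[OF m]) blast
  obtain c L where c: "0 < c" and
    L: "\<And>r t n. 0 < r \<Longrightarrow> 0 < t \<Longrightarrow> 0 < n \<Longrightarrow> r \<le> 2 * n / \<phi> (n / t) \<Longrightarrow>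
      c * (r * \<phi> (1 / t) / t) * exp (- (L * n)) \<le> pbar r t"
    by (rule pbar_lower_exp) blast
  define H where "H = C1 * exp (- (C2 * B)) * c * exp (- L)"
  have H: "0 < H"
    using C c by (simp add: H_def)
  have "ennreal H * (ennreal (\<phi> (1 / t) / t) * near_diagonal t x y) \<le> q t x y"
    if t: "0 < t" for t x y
  proof -
    have phi_t: "0 < \<phi> (1 / t)"
      using t phi_pos by simp
    have "ennreal (H * (\<phi> (1 / t) / t)) = ennreal H * ennreal (\<phi> (1 / t) / t)"
      using H phi_t t by (intro ennreal_mult) auto
    then have "ennreal H * (ennreal (\<phi> (1 / t) / t) * near_diagonal t x y) =
        (\<integral>\<^sup>+r. ennreal (H * (\<phi> (1 / t) / t)) *
          (ennreal (indicator {0<..} r * (r / ivol x r)) * indicator {\<Phi> (dist x y)..2 / \<phi> (1 / t)} r) \<partial>lborel)"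
      unfolding near_diagonal_eq using ivol_measurable[of x]
      by (subst nn_integral_cmult, measurable) (simp only: mult.assoc)
    also have "\<dots> \<le> q t x y"
      unfolding subordinate_kernel_def
    proof (rule nn_integral_mono)
      fix r :: real
      show "ennreal (H * (\<phi> (1 / t) / t)) *
          (ennreal (indicator {0<..} r * (r / ivol x r)) * indicator {\<Phi> (dist x y)..2 / \<phi> (1 / t)} r) \<le>
          ennreal (p0 r x y * pbar r t) * indicator {0<..} r"
      proof (cases "0 < r \<and> \<Phi> (dist x y) \<le> r \<and> r \<le> 2 / \<phi> (1 / t)")
        case True
        then have r: "0 < r" by simp
        have "C1 / ivol x r * exp (- (C2 * B)) \<le> C1 / ivol x r * exp (- (C2 * m r (dist x y)))"
          using C ivol_pos[OF r, of x] B(2)[of r "dist x y"] True by (intro mult_left_mono) auto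
        also have "\<dots> \<le> p0 r x y"
          by (rule p0_lower[OF r])
        finally have "(C1 / ivol x r * exp (- (C2 * B))) * (c * (r * \<phi> (1 / t) / t) * exp (- (L * 1))) \<le> p0 r x y * pbar r t"
          using L[OF r t, of 1] True C ivol_pos[OF r, of x] p0_nonneg[OF r, of x y] c r phi_t t
          by (intro mult_mono) auto
        also have "(C1 / ivol x r * exp (- (C2 * B))) * (c * (r * \<phi> (1 / t) / t) * exp (- (L * 1))) =
            H * (\<phi> (1 / t) / t) * (r / ivol x r)"
          by (simp add: H_def mult_ac)
        finally show ?thesis
          using True H phi_t t ivol_pos[OF r, of x] by (simp add: ennreal_leI flip: ennreal_mult)
      next
        case False
        then show ?thesis
          by (auto simp: indicator_def)
      qed
    qed
    finally show ?thesis .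
  qed
  then show ?thesis
    using that H by blast
qed

section \<open>The exponent n and the balancing time\<close>

lemma n_function_bounds:
  assumes "n_function \<phi> \<Phi> n"
  shows "\<exists>e1 e2. 0 < e1 \<and> 0 < e2 \<and>
    (\<forall>t>0. \<forall>r>0. e1 * \<Phi> (r / n t r) \<le> 1 / \<phi> (n t r / t) \<and> 1 / \<phi> (n t r / t) \<le> e2 * \<Phi> (r / n t r))"
  using assms unfolding n_function_def comparable_on_def by fastforce

lemma n_function_pos: "n_function \<phi> \<Phi> n \<Longrightarrow> 0 < t \<Longrightarrow> 0 < r \<Longrightarrow> 0 < n t r"
  by (simp add: n_function_def)

text \<open>If u = n(t, r) is small, then \<Phi>(r/u) \<phi>(u/t) is at least a multiple of
  u^(\<beta>2 - \<alpha>1), while the defining relation keeps it bounded; \<alpha>1 > \<beta>2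
  therefore bounds u from below. This uniform bound is what allows the comparison of time scales
  that follows.\<close>

lemma n_function_ge:
  assumes n: "n_function \<phi> \<Phi> n"
  obtains c where "0 < c" "c \<le> 1"
    "\<And>t r. 0 < t \<Longrightarrow> 0 < r \<Longrightarrow> 1 \<le> \<Phi> r * \<phi> (1 / t) \<Longrightarrow> c \<le> n t r"
proof -
  obtain e1 e2 where e: "0 < e1" "\<And>t r. 0 < t \<Longrightarrow> 0 < r \<Longrightarrow> e1 * \<Phi> (r / n t r) \<le> 1 / \<phi> (n t r / t)"
    using n_function_bounds[OF n] by auto
  define K where "K = max 1 ((k2 / (e1 * a3)) powr (1 / (\<alpha>1 - \<beta>2)))"
  have K: "1 \<le> K"
    by (simp add: K_def)
  have "1 / K \<le> n t r" if t: "0 < t" and r: "0 < r" and far: "1 \<le> \<Phi> r * \<phi> (1 / t)" for t r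
  proof (cases "1 \<le> n t r")
    case True
    have "1 / K \<le> 1"
      using K by simp
    with True show ?thesis by linarith
  next
    case False
    define u where "u = n t r"
    define k where "k = 1 / u"
    have u: "0 < u"
      using n_function_pos[OF n t r] by (simp add: u_def)
    have k: "1 \<le> k"
      using False u by (simp add: k_def u_def[symmetric])
    have uk: "u = 1 / k"
      using u by (simp add: k_def)
    have p1: "0 < \<phi> (1 / t)" and pu: "0 < \<phi> (u / t)"
      using t u phi_pos by auto
    have "a3 * k powr \<alpha>1 * \<Phi> r \<le> \<Phi> (k * r)"
      using r k by (intro Phi_ge)
    then have "e1 * (a3 * k powr \<alpha>1 * \<Phi> r) \<le> e1 * \<Phi> (k * r)"
      using e by (intro mult_left_mono) auto
    also have "\<dots> \<le> 1 / \<phi> (u / t)"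
      using e(2)[OF t r] by (simp add: u_def[symmetric] uk mult.commute)
    finally have "e1 * (a3 * k powr \<alpha>1 * \<Phi> r) * \<phi> (u / t) \<le> 1"
      using pu by (simp add: field_simps)
    moreover have "\<phi> (1 / t) \<le> k2 * k powr \<beta>2 * \<phi> (u / t)"
      using phi_le[of "u / t" k] u t k by (simp add: k_def)
    then have "1 \<le> \<Phi> r * (k2 * k powr \<beta>2 * \<phi> (u / t))"
      using far Phi_pos[OF r] mult_left_mono[of "\<phi> (1 / t)" _ "\<Phi> r"] by (meson less_imp_le order_trans)
    ultimately have "e1 * (a3 * k powr \<alpha>1 * \<Phi> r) * \<phi> (u / t) \<le> \<Phi> r * (k2 * k powr \<beta>2 * \<phi> (u / t))"
      by linarith
    then have "(e1 * a3 * k powr \<alpha>1) * (\<Phi> r * \<phi> (u / t)) \<le> (k2 * k powr \<beta>2) * (\<Phi> r * \<phi> (u / t))"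
      by (simp add: mult_ac)
    then have "e1 * a3 * k powr \<alpha>1 \<le> k2 * k powr \<beta>2"
      by (rule mult_right_le_imp_le) (use pu Phi_pos[OF r] in simp)
    then have "k powr (\<alpha>1 - \<beta>2) \<le> k2 / (e1 * a3)"
      using e a34 k by (simp add: powr_diff field_simps)
    then have "k \<le> (k2 / (e1 * a3)) powr (1 / (\<alpha>1 - \<beta>2))"
      using k alpha beta by (intro powr_le_imp_le_powr_inverse) auto
    then have "k \<le> K"
      by (simp add: K_def)
    then show ?thesis
      using u K by (simp add: k_def u_def[symmetric] field_simps)
  qed
  then show ?thesis
    using that[of "1 / K"] K by simp
qed

text \<open>Compares s = 1 / \<phi>(1/t) with the balancing time R = n / \<phi>(n/t). The first
  bound exchanges s for R in prefactors; the second shows that R exceeds s at most linearly in n, so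
  the volumes at R and s differ at most by a power of n.\<close>

lemma n_scale_bounds:
  assumes c: "0 < c" "c \<le> 1"
  obtains K where "1 \<le> K"
    "\<And>t n. 0 < t \<Longrightarrow> c \<le> n \<Longrightarrow> 1 / \<phi> (1 / t) \<le> K * (n / \<phi> (n / t))"
    "\<And>t n. 0 < t \<Longrightarrow> c \<le> n \<Longrightarrow> n / \<phi> (n / t) \<le> K * n * (1 / \<phi> (1 / t))"
proof -
  define K where "K = k2 / c + 1 / k1"
  have "1 \<le> k2 / c"
    using k2_ge_1 c by simp
  moreover have "0 < 1 / k1"
    using k12 by simp
  ultimately have K: "1 \<le> K" "k2 / c \<le> K" "1 / k1 \<le> K"
    unfolding K_def by linarith+
  have *: "\<phi> (n / t) \<le> K * n * \<phi> (1 / t) \<and> \<phi> (1 / t) \<le> K * \<phi> (n / t)" if t: "0 < t" and n: "c \<le> n" for t n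
  proof (cases "1 \<le> n")
    case True
    have "\<phi> (n * (1 / t)) \<le> k2 * n powr \<beta>2 * \<phi> (1 / t)"
      using True t by (intro phi_le) auto
    also have "\<dots> \<le> k2 / c * n * \<phi> (1 / t)"
    proof (intro mult_mono)
      show "n powr \<beta>2 \<le> n"
        using powr_mono[of \<beta>2 1 n] True beta by simp
      show "k2 \<le> k2 / c"
        using c k2_ge_1 by (simp add: field_simps)
    qed (use c True k2_ge_1 t phi_nonneg[of "1 / t"] in auto)
    also have "\<dots> \<le> K * n * \<phi> (1 / t)"
      using True K t phi_nonneg[of "1 / t"] by (intro mult_right_mono) auto
    finally have 1: "\<phi> (n / t) \<le> K * n * \<phi> (1 / t)"
      by simp
    have "\<phi> (1 / t) \<le> n powr \<beta>1 * \<phi> (1 / t)"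
      using ge_one_powr_ge_zero[of n \<beta>1] True beta t phi_nonneg[of "1 / t"]
        mult_right_mono[of 1 "n powr \<beta>1" "\<phi> (1 / t)"] by simp
    also have "\<dots> \<le> 1 / k1 * \<phi> (n * (1 / t))"
      using phi_ge[of "1 / t" n] True t k12 by (simp add: field_simps)
    also have "\<dots> \<le> K * \<phi> (n * (1 / t))"
      using K True t by (intro mult_right_mono phi_nonneg) auto
    finally show ?thesis
      using 1 by simp
  next
    case False
    have n0: "0 < n"
      using n c by linarith
    have "\<phi> (n / t) \<le> \<phi> (1 / t)"
      using False t n0 by (intro phi_mono) (auto simp: field_simps)
    also have "\<dots> \<le> K * n * \<phi> (1 / t)"
    proof -
      have "1 \<le> k2 / c * n"
        using mult_mono[of 1 k2 c n] k2_ge_1 c n by (simp add: field_simps)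
      also have "\<dots> \<le> K * n"
        using K n0 by (intro mult_right_mono) auto
      finally show ?thesis
        using t phi_nonneg[of "1 / t"] mult_right_mono[of 1 "K * n" "\<phi> (1 / t)"] by simp
    qed
    finally have 1: "\<phi> (n / t) \<le> K * n * \<phi> (1 / t)" .
    have "\<phi> (1 / n * (n / t)) \<le> k2 * (1 / n) powr \<beta>2 * \<phi> (n / t)"
      using False n0 t by (intro phi_le) auto
    also have "\<dots> \<le> k2 * (1 / c) * \<phi> (n / t)"
    proof (intro mult_right_mono mult_left_mono)
      have "(1 / n) powr \<beta>2 \<le> 1 / n"
        using powr_mono[of \<beta>2 1 "1 / n"] False n0 beta by simp
      also have "\<dots> \<le> 1 / c"
        using c n by (simp add: frac_le)
      finally show "(1 / n) powr \<beta>2 \<le> 1 / c" .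
    qed (use k2_ge_1 n0 t phi_nonneg[of "n / t"] in auto)
    also have "\<dots> \<le> K * \<phi> (n / t)"
      using K n0 t phi_nonneg[of "n / t"] by (intro mult_right_mono) auto
    finally show ?thesis
      using 1 n0 by simp
  qed
  have "1 / \<phi> (1 / t) \<le> K * (n / \<phi> (n / t)) \<and> n / \<phi> (n / t) \<le> K * n * (1 / \<phi> (1 / t))"
    if "0 < t" "c \<le> n" for t n
  proof -
    have "\<phi> (n / t) \<le> K * n * \<phi> (1 / t)" "\<phi> (1 / t) \<le> K * \<phi> (n / t)" "0 \<le> n"
      using * that c by auto
    then show ?thesis
      using mult_left_mono[of "\<phi> (1 / t)" "K * \<phi> (n / t)" n] phi_pos[of "1 / t"] phi_pos[of "n / t"] that c
      by (simp add: divide_simps mult_ac)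
  qed
  then show ?thesis
    using that K by blast
qed

section \<open>The off-diagonal estimates\<close>

text \<open>At each time one of the two factors supplies exp(-b u): the heat kernel up to R, the
  density after R. What is left of the density bound is integrated over all times.\<close>

lemma off_diagonal_upper:
  assumes n: "n_function \<phi> \<Phi> n"
  obtains c3 c4 where "0 < c3" "0 < c4"
    "\<And>t x y. 0 < t \<Longrightarrow> 1 \<le> \<Phi> (dist x y) * \<phi> (1 / t) \<Longrightarrow>
      q t x y \<le> ennreal (c3 / (t * ivol x (1 / \<phi> (1 / t))) *
        (n t (dist x y) / \<phi> (n t (dist x y) / t)) * exp (- (c4 * n t (dist x y))))"
proof -
  obtain e1 e2 where e: "0 < e1" "0 < e2"
    "\<And>t r. 0 < t \<Longrightarrow> 0 < r \<Longrightarrow> e1 * \<Phi> (r / n t r) \<le> 1 / \<phi> (n t r / t)"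
    "\<And>t r. 0 < t \<Longrightarrow> 0 < r \<Longrightarrow> 1 / \<phi> (n t r / t) \<le> e2 * \<Phi> (r / n t r)"
    using n_function_bounds[OF n] by auto
  obtain cm Cm where cm: "0 < cm" and
    cm': "\<And>n T r. 0 < n \<Longrightarrow> 0 < T \<Longrightarrow> 0 < r \<Longrightarrow> e1 * \<Phi> (r / n) \<le> T \<Longrightarrow> T \<le> e2 * \<Phi> (r / n) \<Longrightarrow>
      cm * n \<le> m (n * T) r \<and> m (n * T) r \<le> Cm * n"
    by (rule m_comparable[OF m e(1,2)]) blast
  obtain c0 where c0: "0 < c0" "c0 \<le> 1"
    "\<And>t r. 0 < t \<Longrightarrow> 0 < r \<Longrightarrow> 1 \<le> \<Phi> r * \<phi> (1 / t) \<Longrightarrow> c0 \<le> n t r"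
    by (rule n_function_ge[OF n]) blast
  obtain K where K: "1 \<le> K"
    "\<And>t n. 0 < t \<Longrightarrow> c0 \<le> n \<Longrightarrow> 1 / \<phi> (1 / t) \<le> K * (n / \<phi> (n / t))"
    by (rule n_scale_bounds[OF c0(1,2)]) blast
  obtain E where E: "0 < E"
    "\<And>x r d. 0 < r \<Longrightarrow> 0 < d \<Longrightarrow> r \<le> \<Phi> d \<Longrightarrow> exp (- (C4 / 2 * m r d)) / ivol x r \<le> E / ivol x (\<Phi> d)"
    by (rule exp_m_div_ivol_le[of "C4 / 2"]) (use C in auto)
  obtain G c where G: "0 < G" and c: "0 < c" and
    G1: "\<And>r t. 0 < r \<Longrightarrow> 0 < t \<Longrightarrow> pbar r t \<le> G * (r * \<phi> (1 / t) / t) * exp (- (r * \<phi> (1 / t) / 4))" and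
    G2: "\<And>r t n. 0 < r \<Longrightarrow> 0 < t \<Longrightarrow> 0 < n \<Longrightarrow> n / \<phi> (n / t) \<le> r \<Longrightarrow>
      pbar r t \<le> G * (r * \<phi> (1 / t) / t) * exp (- (r * \<phi> (1 / t) / 4)) * exp (- (c * n))"
    by (rule pbar_upper_exp) blast
  define b where "b = min (C4 / 2 * cm) c"
  have b: "0 < b" "b \<le> C4 / 2 * cm" "b \<le> c"
    using C cm c by (auto simp: b_def)
  define H where "H = 16 * C3 * (E + 1) * G * K"
  have H: "0 < H"
    using C E G K by (simp add: H_def)
  have "q t x y \<le> ennreal (H / (t * ivol x (1 / \<phi> (1 / t))) *
      (n t (dist x y) / \<phi> (n t (dist x y) / t)) * exp (- (b * n t (dist x y))))"
    if t: "0 < t" and far: "1 \<le> \<Phi> (dist x y) * \<phi> (1 / t)" for t x y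
  proof -
    define d where "d = dist x y"
    define s where "s = 1 / \<phi> (1 / t)"
    define u where "u = n t d"
    define R where "R = u / \<phi> (u / t)"
    have phi_t: "0 < \<phi> (1 / t)"
      using t phi_pos by simp
    have s: "0 < s" "s \<le> \<Phi> d"
      using phi_t far by (auto simp: s_def d_def field_simps)
    have d: "0 < d"
      using s Phi(2) by (cases "d = 0") (auto simp: d_def)
    have u: "0 < u" "c0 \<le> u"
      using n_function_pos[OF n t d] c0(3)[OF t d] far by (auto simp: u_def d_def)
    have phi_u: "0 < \<phi> (u / t)"
      using u t by (intro phi_pos) simp
    have R: "0 < R" "s \<le> K * R"
      using u phi_u K(2)[OF t u(2)] by (auto simp: R_def s_def)
    \<comment> \<open>The two exponents meet here: R = u T with T = 1 / \<phi>(u/t), and T is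
      comparable with \<Phi>(d/u) by the relation defining \<open>n\<close>.\<close>
    have mR: "cm * u \<le> m R d"
      using cm'[of u "1 / \<phi> (u / t)" d] e(3,4)[OF t d] u phi_u d by (simp add: u_def[symmetric] R_def)
    have Ws: "0 < ivol x s"
      by (rule ivol_pos[OF s(1)])
    define A where "A = C3 * ((E + 1) / ivol x s) * (G * (\<phi> (1 / t) / t)) * exp (- (b * u))"
    have A: "0 \<le> A"
      using C E G Ws phi_t t by (simp add: A_def)
    \<comment> \<open>Half of the exponent buys the volume at time \<open>s\<close>. The added 1
      covers \<open>r\<close> above \<open>\<Phi> d\<close>, where monotonicity of the volume
      suffices.\<close>
    have half: "exp (- (C4 / 2 * m r d)) / ivol x r \<le> (E + 1) / ivol x s" if r: "0 < r" for r
    proof (cases "r \<le> \<Phi> d")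
      case True
      have "exp (- (C4 / 2 * m r d)) / ivol x r \<le> E / ivol x (\<Phi> d)"
        by (rule E(2)[OF r d True])
      also have "\<dots> \<le> (E + 1) / ivol x s"
        using E Ws s ivol_mono[OF s] by (intro frac_le) auto
      finally show ?thesis .
    next
      case False
      then show ?thesis
        using E Ws s ivol_mono[of s r x] C m_nonneg[OF r, of d] d by (intro frac_le) (auto intro: order_trans[of _ 1])
    qed
    have main: "p0 r x y * pbar r t \<le> A * (r * exp (- (r / (4 * s))))" if r: "0 < r" for r
    proof -
      define P where "P = G * (\<phi> (1 / t) / t) * (r * exp (- (r / (4 * s))))"
      have P: "0 \<le> P"
        using G phi_t t r by (simp add: P_def)
      have "p0 r x y \<le> C3 / ivol x r * exp (- (C4 * m r d))"
        using p0_upper[OF r, of x y] by (simp add: d_def)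
      also have "exp (- (C4 * m r d)) = exp (- (C4 / 2 * m r d)) * exp (- (C4 / 2 * m r d))"
        by (simp flip: exp_add)
      also have "C3 / ivol x r * \<dots> = C3 * (exp (- (C4 / 2 * m r d)) / ivol x r) * exp (- (C4 / 2 * m r d))"
        by simp
      also have "\<dots> \<le> C3 * ((E + 1) / ivol x s) * exp (- (C4 / 2 * m r d))"
        using C half[OF r] by (intro mult_right_mono mult_left_mono) auto
      finally have p: "p0 r x y \<le> C3 * ((E + 1) / ivol x s) * exp (- (C4 / 2 * m r d))" .
      \<comment> \<open>\<open>v\<close> bounds the remaining heat kernel factor and
        \<open>w\<close> the extra decay of the density; one of them is
        \<open>exp (- (b * u))\<close>, the other 1. Before \<open>R\<close> this uses that
        \<open>m\<close> is non-increasing in time.\<close>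
      have "\<exists>v w. exp (- (C4 / 2 * m r d)) \<le> v \<and> pbar r t \<le> P * w \<and> 0 \<le> v \<and> 0 \<le> w \<and> v * w = exp (- (b * u))"
      proof (cases "r \<le> R")
        case True
        have "b * u \<le> C4 / 2 * cm * u"
          using b u by (intro mult_right_mono) auto
        also have "\<dots> = C4 / 2 * (cm * u)"
          by simp
        also have "\<dots> \<le> C4 / 2 * m r d"
          using C mR m_antimono[OF r True d] by (intro mult_left_mono) auto
        finally have "exp (- (C4 / 2 * m r d)) \<le> exp (- (b * u))"
          by simp
        moreover have "pbar r t \<le> P * 1"
          using G1[OF r t] by (simp add: P_def s_def mult_ac)
        ultimately show ?thesis
          by (intro exI[of _ "exp (- (b * u))"] exI[of _ 1]) auto
      next
        case False
        have "pbar r t \<le> P * exp (- (c * u))"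
          using G2[OF r t u(1)] False by (simp add: P_def s_def R_def mult_ac)
        also have "\<dots> \<le> P * exp (- (b * u))"
          using P b u by (intro mult_left_mono) (auto intro: mult_right_mono)
        finally show ?thesis
          using C m_nonneg[OF r, of d] d by (intro exI[of _ 1] exI[of _ "exp (- (b * u))"]) auto
      qed
      then obtain v w where vw: "exp (- (C4 / 2 * m r d)) \<le> v" "pbar r t \<le> P * w" "0 \<le> v" "0 \<le> w"
        "v * w = exp (- (b * u))"
        by auto
      have "p0 r x y \<le> C3 * ((E + 1) / ivol x s) * v"
        using C E Ws by (intro order_trans[OF p] mult_left_mono vw) auto
      then have "p0 r x y * pbar r t \<le> (C3 * ((E + 1) / ivol x s) * v) * (P * w)"
        using vw p0_nonneg[OF r, of x y] pbar_nonneg[OF r t] C E Ws by (intro mult_mono) auto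
      also have "\<dots> = C3 * ((E + 1) / ivol x s) * P * (v * w)"
        by simp
      also have "\<dots> = A * (r * exp (- (r / (4 * s))))"
        unfolding vw(5) by (simp add: A_def P_def)
      finally show ?thesis .
    qed
    have "q t x y \<le> (\<integral>\<^sup>+r. ennreal A * (ennreal (r * exp (- (r / (4 * s)))) * indicator {0<..} r) \<partial>lborel)"
      unfolding subordinate_kernel_def
    proof (rule nn_integral_mono)
      fix r :: real
      show "ennreal (p0 r x y * pbar r t) * indicator {0<..} r \<le>
          ennreal A * (ennreal (r * exp (- (r / (4 * s)))) * indicator {0<..} r)"
        using main[of r] A by (cases "0 < r") (auto simp: ennreal_leI simp flip: ennreal_mult)
    qed
    also have "\<dots> = ennreal A * ennreal ((4 * s)\<^sup>2)"
      using nn_integral_mult_exp[of "4 * s"] s by (subst nn_integral_cmult) auto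
    also have "\<dots> = ennreal (A * (4 * s)\<^sup>2)"
      using A by (simp add: ennreal_mult)
    also have "A * (4 * s)\<^sup>2 = 16 * C3 * (E + 1) * G * exp (- (b * u)) / (t * ivol x s) * s * (\<phi> (1 / t) * s)"
      by (simp add: A_def power2_eq_square mult_ac)
    \<comment> \<open>One of the two factors \<open>s\<close> from the Gamma integral cancels
      against the density's prefactor; the other is exchanged for \<open>R\<close>.\<close>
    also have "\<phi> (1 / t) * s = 1"
      using phi_t by (simp add: s_def)
    also have "16 * C3 * (E + 1) * G * exp (- (b * u)) / (t * ivol x s) * s * 1 \<le>
        16 * C3 * (E + 1) * G * exp (- (b * u)) / (t * ivol x s) * (K * R)"
      unfolding mult_1_right using R C E G t Ws by (intro mult_left_mono) auto
    also have "\<dots> = H / (t * ivol x s) * R * exp (- (b * u))"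
      by (simp add: H_def)
    finally show ?thesis
      by (simp add: s_def R_def u_def d_def ennreal_leI)
  qed
  then show ?thesis
    using that H b by blast
qed

text \<open>On [R, 2R] both exponents are at most a multiple of u, so the length R of this window
  times a pointwise lower bound suffices.\<close>

lemma off_diagonal_lower:
  assumes n: "n_function \<phi> \<Phi> n"
  obtains c1 c2 where "0 < c1" "0 < c2"
    "\<And>t x y. 0 < t \<Longrightarrow> 1 \<le> \<Phi> (dist x y) * \<phi> (1 / t) \<Longrightarrow>
      ennreal (c1 / (t * ivol x (1 / \<phi> (1 / t))) *
        (n t (dist x y) / \<phi> (n t (dist x y) / t)) * exp (- (c2 * n t (dist x y)))) \<le> q t x y"
proof -
  obtain e1 e2 where e: "0 < e1" "0 < e2"
    "\<And>t r. 0 < t \<Longrightarrow> 0 < r \<Longrightarrow> e1 * \<Phi> (r / n t r) \<le> 1 / \<phi> (n t r / t)"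
    "\<And>t r. 0 < t \<Longrightarrow> 0 < r \<Longrightarrow> 1 / \<phi> (n t r / t) \<le> e2 * \<Phi> (r / n t r)"
    using n_function_bounds[OF n] by auto
  obtain cm Cm where Cm: "0 < Cm" and
    Cm': "\<And>n T r. 0 < n \<Longrightarrow> 0 < T \<Longrightarrow> 0 < r \<Longrightarrow> e1 * \<Phi> (r / n) \<le> T \<Longrightarrow> T \<le> e2 * \<Phi> (r / n) \<Longrightarrow>
      cm * n \<le> m (n * T) r \<and> m (n * T) r \<le> Cm * n"
    by (rule m_comparable[OF m e(1,2)]) blast
  obtain c0 where c0: "0 < c0" "c0 \<le> 1"
    "\<And>t r. 0 < t \<Longrightarrow> 0 < r \<Longrightarrow> 1 \<le> \<Phi> r * \<phi> (1 / t) \<Longrightarrow> c0 \<le> n t r"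
    by (rule n_function_ge[OF n]) blast
  obtain K where K: "1 \<le> K"
    "\<And>t n. 0 < t \<Longrightarrow> c0 \<le> n \<Longrightarrow> 1 / \<phi> (1 / t) \<le> K * (n / \<phi> (n / t))"
    "\<And>t n. 0 < t \<Longrightarrow> c0 \<le> n \<Longrightarrow> n / \<phi> (n / t) \<le> K * n * (1 / \<phi> (1 / t))"
    by (rule n_scale_bounds[OF c0(1,2)]) blast
  obtain J D where JD: "0 < J" "0 < D"
    "\<And>x r k. 0 < r \<Longrightarrow> 1 \<le> k \<Longrightarrow> ivol x (k * r) \<le> J * k powr D * ivol x r"
    by (rule ivol_doubling) blast
  obtain B where B: "0 < B" "\<And>y. 0 \<le> y \<Longrightarrow> (1 + y) powr D * exp (- (1 * y)) \<le> B"
    by (rule powr_mult_exp_minus_bounded[of D 1]) (use JD in auto)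
  obtain c L where c: "0 < c" and L: "0 < L" and
    L': "\<And>r t n. 0 < r \<Longrightarrow> 0 < t \<Longrightarrow> 0 < n \<Longrightarrow> r \<le> 2 * n / \<phi> (n / t) \<Longrightarrow>
      c * (r * \<phi> (1 / t) / t) * exp (- (L * n)) \<le> pbar r t"
    by (rule pbar_lower_exp) blast
  define Q where "Q = J * (2 * K) powr D * B"
  have Q: "0 < Q"
    using JD K B by (simp add: Q_def)
  define H where "H = C1 / Q * (c / K)"
  \<comment> \<open>The three summands pay for the change of volume, for the heat kernel and for the
    density.\<close>
  define b where "b = 1 + C2 * Cm + L"
  have H: "0 < H" and b: "0 < b"
    using C Q c K Cm L by (auto simp: H_def b_def add_pos_pos)
  have "ennreal (H / (t * ivol x (1 / \<phi> (1 / t))) *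
      (n t (dist x y) / \<phi> (n t (dist x y) / t)) * exp (- (b * n t (dist x y)))) \<le> q t x y"
    if t: "0 < t" and far: "1 \<le> \<Phi> (dist x y) * \<phi> (1 / t)" for t x y
  proof -
    define d where "d = dist x y"
    define s where "s = 1 / \<phi> (1 / t)"
    define u where "u = n t d"
    define R where "R = u / \<phi> (u / t)"
    have phi_t: "0 < \<phi> (1 / t)"
      using t phi_pos by simp
    have s: "0 < s" "s \<le> \<Phi> d"
      using phi_t far by (auto simp: s_def d_def field_simps)
    have d: "0 < d"
      using s Phi(2) by (cases "d = 0") (auto simp: d_def)
    have u: "0 < u" "c0 \<le> u"
      using n_function_pos[OF n t d] c0(3)[OF t d] far by (auto simp: u_def d_def)
    have phi_u: "0 < \<phi> (u / t)"
      using u t by (intro phi_pos) simp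
    have R: "0 < R" "s \<le> K * R" "R \<le> K * u * s"
      using u phi_u K(2,3)[OF t u(2)] by (auto simp: R_def s_def)
    have mR: "m R d \<le> Cm * u"
      using Cm'[of u "1 / \<phi> (u / t)" d] e(3,4)[OF t d] u phi_u d by (simp add: u_def[symmetric] R_def)
    have Ws: "0 < ivol x s"
      by (rule ivol_pos[OF s(1)])
    have "1 * 1 \<le> 2 * K * (1 + u)"
      using K u by (intro mult_mono) auto
    then have k: "1 \<le> 2 * K * (1 + u)"
      by simp
    have "0 \<le> K * s"
      using K s by simp
    then have "2 * R \<le> 2 * K * (1 + u) * s"
      using R by (simp add: algebra_simps)
    then have "ivol x (2 * R) \<le> ivol x (2 * K * (1 + u) * s)"
      using R by (intro ivol_mono) auto
    also have "\<dots> \<le> J * (2 * K * (1 + u)) powr D * ivol x s"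
      by (rule JD(3)[OF s(1) k])
    \<comment> \<open>Passing from the volume at 2R to that at s costs a power of
      \<open>1 + u\<close>; inserting exp(u) exp(-u) turns it into the constant \<open>B\<close> and
      a factor exp(u).\<close>
    also have "(2 * K * (1 + u)) powr D = (2 * K) powr D * (1 + u) powr D * (exp u * exp (- (1 * u)))"
      using K u by (subst powr_mult) (auto simp flip: exp_add)
    also have "J * \<dots> * ivol x s = J * (2 * K) powr D * ivol x s * exp u * ((1 + u) powr D * exp (- (1 * u)))"
      by (simp only: mult_ac)
    also have "\<dots> \<le> J * (2 * K) powr D * ivol x s * exp u * B"
      using JD K Ws u by (intro mult_left_mono B) auto
    finally have W2R: "ivol x (2 * R) \<le> Q * ivol x s * exp u"
      by (simp add: Q_def mult_ac)
    define A where "A = H / (t * ivol x s) * exp (- (b * u))"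
    have A: "0 \<le> A"
      using H t Ws by (simp add: A_def)
    have main: "A \<le> p0 r x y * pbar r t" if r: "R \<le> r" "r \<le> 2 * R" for r
    proof -
      have r0: "0 < r"
        using R r by linarith
      have "ivol x r \<le> Q * ivol x s * exp u"
        using ivol_mono[of r "2 * R" x] r0 r W2R by linarith
      then have "C1 / (Q * ivol x s * exp u) \<le> C1 / ivol x r"
        using C ivol_pos[OF r0, of x] by (intro frac_le) auto
      moreover have "C2 * m r d \<le> C2 * (Cm * u)"
        using C mR m_antimono[OF R(1) r(1) d] by (intro mult_left_mono) auto
      ultimately have "C1 / (Q * ivol x s * exp u) * exp (- (C2 * (Cm * u))) \<le> C1 / ivol x r * exp (- (C2 * m r d))"
        using C ivol_pos[OF r0, of x] by (intro mult_mono) auto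
      also have "\<dots> \<le> p0 r x y"
        using p0_lower[OF r0] by (simp add: d_def)
      finally have p: "C1 / (Q * ivol x s * exp u) * exp (- (C2 * (Cm * u))) \<le> p0 r x y" .
      \<comment> \<open>Hence the factor r \<phi>(1/t) in the density bound is at least 1 / K on the
        window.\<close>
      have "s \<le> K * r"
        using R r K by (meson less_le_trans mult_left_mono order_trans zero_le_one)
      then have "1 / K \<le> r * \<phi> (1 / t)"
        using K phi_t by (simp add: s_def field_simps)
      then have "c * (1 / K / t) * exp (- (L * u)) \<le> c * (r * \<phi> (1 / t) / t) * exp (- (L * u))"
        using c t by (intro mult_right_mono mult_left_mono divide_right_mono) auto
      also have "\<dots> \<le> pbar r t"
        using r by (intro L' r0 t u) (simp add: R_def)
      finally have "(C1 / (Q * ivol x s * exp u) * exp (- (C2 * (Cm * u)))) * (c * (1 / K / t) * exp (- (L * u))) \<le>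
          p0 r x y * pbar r t"
        using p C Q Ws c K t p0_nonneg[OF r0, of x y] by (intro mult_mono) auto
      also have "(C1 / (Q * ivol x s * exp u) * exp (- (C2 * (Cm * u)))) * (c * (1 / K / t) * exp (- (L * u))) =
          H / (t * ivol x s) * (exp (- u) * exp (- (C2 * (Cm * u))) * exp (- (L * u)))"
        by (simp add: H_def exp_minus field_simps)
      also have "exp (- u) * exp (- (C2 * (Cm * u))) * exp (- (L * u)) = exp (- (b * u))"
        by (simp add: b_def algebra_simps flip: exp_add)
      finally show ?thesis
        by (simp add: A_def)
    qed
    have "ennreal (H / (t * ivol x s) * R * exp (- (b * u))) = ennreal A * ennreal R"
      using A R by (simp add: A_def mult_ac flip: ennreal_mult)
    also have "\<dots> = (\<integral>\<^sup>+r. ennreal A * indicator {R..2 * R} r \<partial>lborel)"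
      using R by (subst nn_integral_cmult_indicator) auto
    also have "\<dots> \<le> q t x y"
      unfolding subordinate_kernel_def using main R
      by (intro nn_integral_mono) (auto simp: indicator_def ennreal_leI)
    finally show ?thesis
      by (simp add: s_def R_def u_def d_def)
  qed
  then show ?thesis
    using that H b by blast
qed

section \<open>Existence of n\<close>

text \<open>The equation \<Phi>(r/u) \<phi>(u/t) = 1 may have no solution, as \<open>\<Phi>\<close>
  can jump, and its left side need not be monotone in u. The supremum of the set where the left side
  is at least 1 serves instead; these sets shrink as t grows, which gives the required
  monotonicity.\<close>

lemma n_function_exists: "\<exists>n. n_function \<phi> \<Phi> n"
proof -
  define f where "f t r u = \<Phi> (r / u) * \<phi> (u / t)" for t r u
  define X where "X t r = {u. 0 < u \<and> 1 \<le> f t r u}" for t r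
  define n where "n t r = Sup (X t r)" for t r
  \<comment> \<open>The most that \<open>f\<close> can lose when \<open>u\<close> grows by a factor
    up to 2: only the \<open>\<Phi>\<close> part decreases.\<close>
  define c where "c = a4 * 2 powr \<alpha>2"
  have c: "0 < c"
    using a34 by (simp add: c_def)
  have f_pos: "0 < f t r u" if "0 < t" "0 < r" "0 < u" for t r u
    using that by (simp add: f_def Phi_pos phi_pos)
  have f_up: "f t r (k * u) \<le> k2 / a3 * k powr (\<beta>2 - \<alpha>1) * f t r u"
    if "0 < t" "0 < r" "0 < u" "1 \<le> k" for t r u k
  proof -
    have "a3 * k powr \<alpha>1 * \<Phi> (r / u / k) \<le> \<Phi> (r / u)"
      using that by (intro Phi_div_le) auto
    then have "\<Phi> (r / (k * u)) \<le> \<Phi> (r / u) / (a3 * k powr \<alpha>1)"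
      using that a34 by (simp add: field_simps)
    moreover have "\<phi> (k * u / t) \<le> k2 * k powr \<beta>2 * \<phi> (u / t)"
      using phi_le[of "u / t" k] that by simp
    ultimately have "f t r (k * u) \<le> \<Phi> (r / u) / (a3 * k powr \<alpha>1) * (k2 * k powr \<beta>2 * \<phi> (u / t))"
      unfolding f_def using that Phi_pos[of "r / u"] a34 phi_nonneg[of "k * u / t"] by (intro mult_mono) auto
    also have "\<dots> = k2 / a3 * k powr (\<beta>2 - \<alpha>1) * f t r u"
      by (simp add: f_def powr_diff)
    finally show ?thesis .
  qed
  have f_down: "f t r u \<le> c * f t r (k * u)"
    if "0 < t" "0 < r" "0 < u" "1 \<le> k" "k \<le> 2" for t r u k
  proof -
    have "\<Phi> (r / u) \<le> a4 * k powr \<alpha>2 * \<Phi> (r / u / k)"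
      using that by (intro Phi_div_ge) auto
    also have "\<dots> \<le> c * \<Phi> (r / u / k)"
      unfolding c_def using that a34 alpha Phi_pos[of "r / u / k"]
      by (intro mult_right_mono mult_left_mono powr_mono2) auto
    finally have "\<Phi> (r / u) \<le> c * \<Phi> (r / (k * u))"
      by (simp add: mult.commute)
    moreover have "\<phi> (u / t) \<le> \<phi> (k * u / t)"
      using that by (intro phi_mono divide_right_mono) auto
    ultimately have "f t r u \<le> c * \<Phi> (r / (k * u)) * \<phi> (k * u / t)"
      unfolding f_def using that c Phi_pos[of "r / (k * u)"] phi_nonneg[of "u / t"] by (intro mult_mono) auto
    then show ?thesis
      by (simp add: f_def)
  qed
  have X_ne: "X t r \<noteq> {}" and X_bdd: "bdd_above (X t r)" if t: "0 < t" and r: "0 < r" for t r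
  proof -
    \<comment> \<open>By \<open>f_up\<close>, \<open>f\<close> decays at least like the power
      \<open>- p\<close> of its argument: it exceeds 1 near 0 and drops below 1 far out.\<close>
    define p where "p = \<alpha>1 - \<beta>2"
    have p: "0 < p"
      using alpha beta by (simp add: p_def)
    have f1: "0 < f t r 1"
      using f_pos t r by simp
    define k where "k = max 1 ((k2 / (a3 * f t r 1)) powr (1 / p))"
    have k: "1 \<le> k"
      by (simp add: k_def)
    have "k2 / (a3 * f t r 1) = ((k2 / (a3 * f t r 1)) powr (1 / p)) powr p"
      using k2_ge_1 a34 f1 p by (simp add: powr_powr)
    also have "\<dots> \<le> k powr p"
      unfolding k_def using p by (intro powr_mono2) auto
    finally have kp: "k2 / (a3 * f t r 1) \<le> k powr p" .
    have "f t r (k * (1 / k)) \<le> k2 / a3 * k powr (\<beta>2 - \<alpha>1) * f t r (1 / k)"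
      using t r k by (intro f_up) auto
    also have "k powr (\<beta>2 - \<alpha>1) = 1 / k powr p"
      by (simp add: p_def flip: powr_minus_divide)
    finally have "f t r 1 * k powr p \<le> k2 / a3 * f t r (1 / k)"
      using k a34 by (simp add: field_simps)
    moreover have "k2 / a3 \<le> f t r 1 * k powr p"
      using kp f1 a34 by (simp add: field_simps)
    ultimately have "k2 / a3 * 1 \<le> k2 / a3 * f t r (1 / k)"
      by simp
    then have "1 \<le> f t r (1 / k)"
      using k2_ge_1 a34 by (subst (asm) mult_le_cancel_left_pos) auto
    then show "X t r \<noteq> {}"
      using k by (auto simp: X_def intro!: exI[of _ "1 / k"])
    have "u \<le> max 1 ((k2 / a3 * f t r 1) powr (1 / p))" if u: "u \<in> X t r" for u
    proof (cases "1 \<le> u")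
      case True
      have "1 \<le> f t r (u * 1)"
        using u by (simp add: X_def)
      also have "\<dots> \<le> k2 / a3 * u powr (\<beta>2 - \<alpha>1) * f t r 1"
        using t r True by (intro f_up) auto
      also have "u powr (\<beta>2 - \<alpha>1) = 1 / u powr p"
        by (simp add: p_def flip: powr_minus_divide)
      finally have "u powr p \<le> k2 / a3 * f t r 1"
        using True a34 by (simp add: field_simps)
      then have "u \<le> (k2 / a3 * f t r 1) powr (1 / p)"
        using True p by (intro powr_le_imp_le_powr_inverse) auto
      then show ?thesis by simp
    qed simp
    then show "bdd_above (X t r)"
      by (rule bdd_aboveI)
  qed
  have n_pos: "0 < n t r" if t: "0 < t" and r: "0 < r" for t r
  proof -
    obtain u where "u \<in> X t r"
      using X_ne[OF t r] by auto
    then have "u \<le> n t r" "0 < u"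
      unfolding n_def using X_bdd[OF t r] by (auto intro: cSup_upper simp: X_def)
    then show ?thesis by simp
  qed
  have n_mono: "n t' r \<le> n t r" if t: "0 < t" "t \<le> t'" and r: "0 < r" for t t' r
  proof -
    have "f t' r u \<le> f t r u" if u: "0 < u" for u
      unfolding f_def using t u r Phi_pos[of "r / u"] by (intro mult_left_mono phi_mono) (auto simp: frac_le)
    then have "X t' r \<subseteq> X t r"
      by (auto simp: X_def intro: order_trans)
    then show ?thesis
      unfolding n_def using X_ne[of t' r] X_bdd[of t r] t r by (intro cSup_subset_mono) auto
  qed
  have n_val: "f t r (n t r) \<le> c" "1 \<le> c * f t r (n t r)" if t: "0 < t" and r: "0 < r" for t r
  proof -
    have n0: "0 < n t r"
      by (rule n_pos[OF t r])
    \<comment> \<open>The supremum need not belong to the set, so \<open>f\<close> at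
      \<open>n t r\<close> is compared with its value at \<open>2 * n t r\<close>, outside the set,
      and at a member above half the supremum; each comparison costs the factor
      \<open>c\<close>.\<close>
    have "2 * n t r \<notin> X t r"
      using cSup_upper[of "2 * n t r" "X t r"] X_bdd[OF t r] n0 unfolding n_def by auto
    then have "f t r (2 * n t r) \<le> 1"
      using n0 by (auto simp: X_def)
    then have "c * f t r (2 * n t r) \<le> c * 1"
      using c by (intro mult_left_mono) auto
    then show "f t r (n t r) \<le> c"
      using f_down[OF t r n0, of 2] by simp
    obtain u where u: "u \<in> X t r" "n t r / 2 < u"
      using less_cSupD[OF X_ne[OF t r], of "n t r / 2"] n0 unfolding n_def by auto
    have u': "0 < u" "1 \<le> f t r u" "u \<le> n t r"
      using u X_bdd[OF t r] unfolding n_def by (auto simp: X_def intro!: cSup_upper)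
    have "f t r u \<le> c * f t r (n t r / u * u)"
      using u u' t r by (intro f_down) (auto simp: field_simps)
    then show "1 \<le> c * f t r (n t r)"
      using u' by simp
  qed
  have "n_function \<phi> \<Phi> n"
    unfolding n_function_def comparable_on_def
  proof (intro conjI)
    show "\<forall>t>0. \<forall>r>0. 0 < n t r"
      using n_pos by blast
    show "\<forall>r>0. antimono_on {0<..} (\<lambda>t. n t r)"
      using n_mono by (auto intro!: monotone_onI)
    have "1 / c * \<Phi> (r / n t r) \<le> 1 / \<phi> (n t r / t) \<and> 1 / \<phi> (n t r / t) \<le> c * \<Phi> (r / n t r)"
      if "0 < t" "0 < r" for t r
    proof -
      have "0 < \<phi> (n t r / t)"
        using that n_pos phi_pos by simp
      then show ?thesis
        using n_val[OF that] c by (simp add: f_def field_simps)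
    qed
    then show "\<exists>c' c''. 0 < c' \<and> 0 < c'' \<and>
        (\<forall>z\<in>{0<..} \<times> {0<..}. c' * (case z of (t, r) \<Rightarrow> \<Phi> (r / n t r)) \<le> (case z of (t, r) \<Rightarrow> 1 / \<phi> (n t r / t)) \<and>
          (case z of (t, r) \<Rightarrow> 1 / \<phi> (n t r / t)) \<le> c'' * (case z of (t, r) \<Rightarrow> \<Phi> (r / n t r)))"
      using c by - (rule exI[of _ "1 / c"], rule exI[of _ c], auto)
  qed
  then show ?thesis by blast
qed

end

theorem theorem4p9:
  fixes \<mu> :: "'a::metric_space measure"
    and a1 a2 d1 d2 :: real
    and M :: "'w measure" and S :: "real \<Rightarrow> 'w \<Rightarrow> real" and N :: "real measure"
    and \<nu> \<phi> :: "real \<Rightarrow> real" and \<beta>1 \<beta>2 k1 k2 :: real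
    and pbar :: "real \<Rightarrow> real \<Rightarrow> real"
    and \<Phi> :: "real \<Rightarrow> real" and a3 a4 \<alpha>1 \<alpha>2 :: real
    and m :: "real \<Rightarrow> real \<Rightarrow> real"
    and W :: "'b measure" and F :: "ennreal \<Rightarrow> 'b measure"
    and X :: "real \<Rightarrow> 'b \<Rightarrow> 'a" and P :: "'a \<Rightarrow> 'b measure"
    and P0 :: "real \<Rightarrow> ('a \<Rightarrow> real) \<Rightarrow> 'a \<Rightarrow> real"
    and p0 :: "real \<Rightarrow> 'a \<Rightarrow> 'a \<Rightarrow> real"
    and C1 C2 C3 C4 :: real
  defines "V \<equiv> vol \<mu>"
    and "q \<equiv> subordinate_kernel p0 pbar"
  assumes E: "locally_compact_space (euclidean :: 'a topology)"
      "separable_space (euclidean :: 'a topology)"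
    and mu: "radon_measure \<mu>" "full_support \<mu>"
    and a12: "0 < a1" "0 < a2" and d12: "0 < d1" "d1 \<le> d2"
    and volume: "\<And>x r R. 0 < r \<Longrightarrow> r \<le> R \<Longrightarrow>
        a1 * (R / r) powr d1 \<le> V x R / V x r \<and> V x R / V x r \<le> a2 * (R / r) powr d2"
    and S: "driftless_subordinator M S N \<phi>"
    and beta: "0 < \<beta>1" "\<beta>1 < \<beta>2" "\<beta>2 < 1" and k12: "0 < k1" "0 < k2"
    and phi_scaling: "\<And>l k. 0 < l \<Longrightarrow> 1 \<le> k \<Longrightarrow>
        k1 * k powr \<beta>1 \<le> \<phi> (k * l) / \<phi> l \<and> \<phi> (k * l) / \<phi> l \<le> k2 * k powr \<beta>2"
    and phi_1: "\<phi> 1 = 1"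
    and nu_density: "set_borel_measurable borel {0<..} \<nu>" "\<And>z. 0 < z \<Longrightarrow> 0 \<le> \<nu> z"
      "N = density lborel (\<lambda>z. ennreal (\<nu> z) * indicator {0<..} z)"
    and nu_mono: "antimono_on {0<..} (\<lambda>t. t * \<nu> t)"
    and pbar: "subordinator_densities M S pbar"
    and Phi: "strict_mono_on {0..} \<Phi>" "\<Phi> 0 = 0"
    and a34: "0 < a3" "0 < a4" and alpha: "1 < \<alpha>1" "\<alpha>1 \<le> \<alpha>2"
    and Phi_scaling: "\<And>r R. 0 < r \<Longrightarrow> r \<le> R \<Longrightarrow>
        a3 * (R / r) powr \<alpha>1 \<le> \<Phi> R / \<Phi> r \<and> \<Phi> R / \<Phi> r \<le> a4 * (R / r) powr \<alpha>2"
    and m: "m_function \<Phi> m"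
    and X: "conservative_diffusion W F X P"
    and P0: "diffusion_semigroup \<mu> X P P0"
    and p0: "heat_kernel \<mu> X P p0"
    and C: "0 < C1" "0 < C2" "0 < C3" "0 < C4"
    and p0_bounds: "\<And>t x y. 0 < t \<Longrightarrow>
        C1 / V x (right_inv \<Phi> t) * exp (- (C2 * m t (dist x y))) \<le> p0 t x y \<and>
        p0 t x y \<le> C3 / V x (right_inv \<Phi> t) * exp (- (C4 * m t (dist x y)))"
  shows
    "ecomparable_on {(t, x, y). 0 < t \<and> \<Phi> (dist x y) * \<phi> (1 / t) \<le> 1}
       (\<lambda>(t, x, y). q t x y)
       (\<lambda>(t, x, y). ennreal (\<phi> (1 / t) / t) *
          (\<integral>\<^sup>+r\<in>{\<Phi> (dist x y)..2 / \<phi> (1 / t)}. ennreal (r / V x (right_inv \<Phi> r)) \<partial>lborel)) \<and>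
     (\<exists>n. n_function \<phi> \<Phi> n) \<and>
     (\<forall>n. n_function \<phi> \<Phi> n \<longrightarrow>
       (\<exists>c1 c2 c3 c4. 0 < c1 \<and> 0 < c2 \<and> 0 < c3 \<and> 0 < c4 \<and>
         (\<forall>t x y. 0 < t \<and> 1 \<le> \<Phi> (dist x y) * \<phi> (1 / t) \<longrightarrow>
            ennreal (c1 / (t * V x (right_inv \<Phi> (1 / \<phi> (1 / t)))) *
                (n t (dist x y) / \<phi> (n t (dist x y) / t)) * exp (- (c2 * n t (dist x y))))
              \<le> q t x y \<and>
            q t x y
              \<le> ennreal (c3 / (t * V x (right_inv \<Phi> (1 / \<phi> (1 / t)))) *
                (n t (dist x y) / \<phi> (n t (dist x y) / t)) * exp (- (c4 * n t (dist x y)))))))"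
proof -
  interpret subordinated_heat_kernel M S N \<nu> \<phi> \<beta>1 \<beta>2 k1 k2 pbar \<Phi> a3 a4 \<alpha>1 \<alpha>2 \<mu> a1 a2 d1 d2 m p0 C1 C2 C3 C4
  proof unfold_locales
    show "sets \<mu> = sets borel"
      using mu(1) by (simp add: radon_measure_def)
  qed (fact S beta k12 phi_scaling nu_density nu_mono pbar Phi a34 alpha Phi_scaling a12 d12
      volume[unfolded V_def] m C p0_bounds[unfolded V_def])+
  have Vi: "V x (right_inv \<Phi> r) = ivol x r" for x r
    by (simp add: V_def ivol_def)
  obtain K1 where K1: "0 < K1"
    "\<And>t x y. 0 < t \<Longrightarrow> \<Phi> (dist x y) * \<phi> (1 / t) \<le> 1 \<Longrightarrow>
      q t x y \<le> ennreal K1 * (ennreal (\<phi> (1 / t) / t) * near_diagonal t x y)"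
    unfolding q_def by (rule near_diagonal_upper) blast
  obtain K2 where K2: "0 < K2"
    "\<And>t x y. 0 < t \<Longrightarrow> \<Phi> (dist x y) * \<phi> (1 / t) \<le> 1 \<Longrightarrow>
      ennreal K2 * (ennreal (\<phi> (1 / t) / t) * near_diagonal t x y) \<le> q t x y"
    unfolding q_def by (rule near_diagonal_lower) blast
  have near: "ecomparable_on {(t, x, y). 0 < t \<and> \<Phi> (dist x y) * \<phi> (1 / t) \<le> 1}
       (\<lambda>(t, x, y). q t x y)
       (\<lambda>(t, x, y). ennreal (\<phi> (1 / t) / t) *
          (\<integral>\<^sup>+r\<in>{\<Phi> (dist x y)..2 / \<phi> (1 / t)}. ennreal (r / V x (right_inv \<Phi> r)) \<partial>lborel))"
    unfolding ecomparable_on_def Vi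
    by (rule exI[of _ K2], rule exI[of _ K1]) (use K1 K2 in auto)
  \<comment> \<open>The constants are chosen after \<open>n\<close>, since the comparison constants
    of \<open>n\<close> enter them.\<close>
  have far: "\<exists>c1 c2 c3 c4. 0 < c1 \<and> 0 < c2 \<and> 0 < c3 \<and> 0 < c4 \<and>
         (\<forall>t x y. 0 < t \<and> 1 \<le> \<Phi> (dist x y) * \<phi> (1 / t) \<longrightarrow>
            ennreal (c1 / (t * V x (right_inv \<Phi> (1 / \<phi> (1 / t)))) *
                (n t (dist x y) / \<phi> (n t (dist x y) / t)) * exp (- (c2 * n t (dist x y))))
              \<le> q t x y \<and>
            q t x y
              \<le> ennreal (c3 / (t * V x (right_inv \<Phi> (1 / \<phi> (1 / t)))) *
                (n t (dist x y) / \<phi> (n t (dist x y) / t)) * exp (- (c4 * n t (dist x y)))))"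
    if n: "n_function \<phi> \<Phi> n" for n
  proof -
    obtain c1 c2 where lower: "0 < c1" "0 < c2"
      "\<And>t x y. 0 < t \<Longrightarrow> 1 \<le> \<Phi> (dist x y) * \<phi> (1 / t) \<Longrightarrow>
        ennreal (c1 / (t * ivol x (1 / \<phi> (1 / t))) *
          (n t (dist x y) / \<phi> (n t (dist x y) / t)) * exp (- (c2 * n t (dist x y)))) \<le> q t x y"
      unfolding q_def by (rule off_diagonal_lower[OF n]) blast
    obtain c3 c4 where upper: "0 < c3" "0 < c4"
      "\<And>t x y. 0 < t \<Longrightarrow> 1 \<le> \<Phi> (dist x y) * \<phi> (1 / t) \<Longrightarrow>
        q t x y \<le> ennreal (c3 / (t * ivol x (1 / \<phi> (1 / t))) *
          (n t (dist x y) / \<phi> (n t (dist x y) / t)) * exp (- (c4 * n t (dist x y))))"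
      unfolding q_def by (rule off_diagonal_upper[OF n]) blast
    show ?thesis
      unfolding Vi
      by (rule exI[of _ c1], rule exI[of _ c2], rule exI[of _ c3], rule exI[of _ c4],
          intro conjI allI impI lower upper) auto
  qed
  show ?thesis
    by (intro conjI allI impI near far n_function_exists)
qed

end
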